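(* Let $\pi: M \to N$ be a smooth fibre bundle, let $F: TM\to\mathbb{R}$ be a Finsler function on $M$ with energy $E=\frac12F^2$ and canonical spray $S$, and let $h:\pi^*TN\to TM$ be the nonlinear splitting on $\pi$ induced by $F$. Then: (i) $h$ is a homogeneous nonlinear splitting, i.e. $h(m,\lambda v_n)=\lambda h(m,v_n)$ for all $\lambda>0$ and all $(m,v_n)\in\pi^*TN$. (ii) The canonical spray $S$ of $F$ is tangent to the horizontal manifold $\mathrm{Im}\,h$ if and only if $$Y^{\mathrm C}(E)\circ h=0$$ for every $\pi$-vertical vector field $Y$ on $M$. (iii) If the canonical spray $S$ is tangent to $\mathrm{Im}\,h$, then so is every other spray in its projective class.
   Context: $\tau:TM\to M$, $\bar\tau:TN\to N$ are the tangent bundles; a ring $\mathring{T}$ denotes the tangent bundle with the zero section removed. The pullback bundle is $\pi^*TN=\{(m,v_n)\in M\times TN : \pi(m)=\bar\tau(v_n)\}$, with projections $p_1$ to $M$ and $p_2$ to $TN$. A nonlinear splitting on $\pi$ is a map $h:\pi^*TN\to TM$, smooth on the slit pullback bundle $\pi^*\mathring{T}N$, with $\tau\circ h=p_1$ and $T\pi\circ h=p_2$. Its image $\mathrm{Im}\,h\subset TM$ is called the horizontal manifold. It is homogeneous if $h(m,\lambda v_n)=\lambda h(m,v_n)$ for all $\lambda>0$. A Finsler function $F:TM\to\mathbb{R}$ is a non-negative continuous function which is positively homogeneous of degree 1 on fibres, smooth on $\mathring TM$, and strongly convex: with $E=\frac12F^2$ and natural coordinates $(q^a,u^a)$ on $TM$,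 the matrix $\left(\frac{\partial^2E}{\partial u^a\partial u^b}\right)$ is positive definite at every point of $\mathring TM$. For a vector field $X=X^a\,\partial/\partial q^a$ on $M$, the vertical lift is $X^{\mathrm V}=X^a\,\partial/\partial u^a$ and the complete lift is $X^{\mathrm C}=X^a\,\partial/\partial q^a+u^b\frac{\partial X^a}{\partial q^b}\,\partial/\partial u^a$. A spray is a second-order vector field $S=u^a\,\partial/\partial q^a+f^a\,\partial/\partial u^a$ (defined and smooth on $\mathring TM$) with $[\Delta,S]=S$, where $\Delta=u^a\,\partial/\partial u^a$ is the Liouville vector field. The canonical spray $S$ of $F$ is the unique spray with $S(X^{\mathrm V}(E))-X^{\mathrm C}(E)=0$ for all vector fields $X$ on $M$. A spray $\tilde S$ is projectively related to $S$ if $\tilde S=S-2P\Delta$ for some (positively 1-homogeneous) function $P$; the projective class of $S$ is the set of all sprays projectively related to it. A vector field $Y$ on $M$ is $\pi$-vertical if $T\pi\circ Y=0$. The nonlinear splitting induced by $F$ is the map $h:\pi^*TN\to TM$ determined by $Y^{\mathrm V}(E)\circ h=0$ for all $\pi$-vertical vector fields $Y$ on $M$. In coordinates $(x^i,y^\alpha)$ on $M$ adapted to $\pi$, with fibre coordinates $(v^i,w^\alpha)$ on $TM$, $h(x,y,v)=(x,y,v,h^\alpha(x,y,v))$, where $w^\alpha=h^\alpha(x,y,v)$ is the solution of $\frac{\partial E}{\partial w^\alpha}(x,y,v,w)=0$. On zero vectors $h(m,0)=0$. Sprays and smooth conditions are considered away from the zero section, so tangency to $\mathrm{Im}\,h$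 refers to the points $h(m,v_n)$ with $v_n\ne0$, and $Y^{\mathrm C}(E)\circ h=0$ is required on $\pi^*\mathring TN$. *)

theory Defs
  imports "HOL-Analysis.Analysis"
begin

section \<open>Smooth maps on open subsets of vector spaces\<close>

text \<open>Only used for an open set \<^term>\<open>U\<close> in a finite-dimensional space, where being
  \<open>k\<close> times continuously differentiable may be tested on directional derivatives.\<close>

primrec Ck_on :: "nat \<Rightarrow> 'a::real_normed_vector set \<Rightarrow> ('a \<Rightarrow> 'b::real_normed_vector) \<Rightarrow> bool" where
  "Ck_on 0 U f \<longleftrightarrow> continuous_on U f"
| "Ck_on (Suc k) U f \<longleftrightarrow> (\<forall>x\<in>U. f differentiable (at x)) \<and>
     (\<forall>v. Ck_on k U (\<lambda>x. frechet_derivative f (at x) v))"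

definition smooth_on :: "'a::real_normed_vector set \<Rightarrow> ('a \<Rightarrow> 'b::real_normed_vector) \<Rightarrow> bool" where
  "smooth_on U f \<longleftrightarrow> (\<forall>k. Ck_on k U f)"


section \<open>Manifolds\<close>

text \<open>An atlas is a family of charts indexed by a type \<^typ>\<open>'i\<close>; a chart may have empty
  domain, so that every set of charts on a set can be presented in this way. The underlying
  set is the union of the chart domains and its topology is the one induced by the charts.
  The tangent bundle, the product and open submanifolds are again given by atlases, and the
  natural charts of the tangent bundle have the same index type as the charts of the base.\<close>

datatype ('a, 'i, 'e) atlas =
  Atlas (cdom: "'i \<Rightarrow> 'a set") (cmap: "'i \<Rightarrow> 'a \<Rightarrow> 'e")

definition points :: "('a, 'i, 'e) atlas \<Rightarrow> 'a set" where
  "points M = (\<Union>i. cdom M i)"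

definition cinv :: "('a, 'i, 'e) atlas \<Rightarrow> 'i \<Rightarrow> 'e \<Rightarrow> 'a" where
  "cinv M i = inv_into (cdom M i) (cmap M i)"

definition mtop :: "('a, 'i, 'e::real_normed_vector) atlas \<Rightarrow> 'a topology" where
  "mtop M = topology (\<lambda>W. W \<subseteq> points M \<and> (\<forall>i. open (cmap M i ` (W \<inter> cdom M i))))"

lemma openin_mtop:
  fixes M :: "('a, 'i, 'e::real_normed_vector) atlas"
  assumes inj: "\<And>i. inj_on (cmap M i) (cdom M i)"
  shows "openin (mtop M) W \<longleftrightarrow> W \<subseteq> points M \<and> (\<forall>i. open (cmap M i ` (W \<inter> cdom M i)))"
proof -
  let ?P = "\<lambda>W. W \<subseteq> points M \<and> (\<forall>i. open (cmap M i ` (W \<inter> cdom M i)))"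
  have "?P (V \<inter> W)" if "?P V" "?P W" for V W
  proof -
    have "cmap M i ` (V \<inter> W \<inter> cdom M i) =
        cmap M i ` (V \<inter> cdom M i) \<inter> cmap M i ` (W \<inter> cdom M i)" for i
      using inj[of i] unfolding inj_on_def by blast
    then show ?thesis using that by auto
  qed
  moreover have "?P (\<Union>\<K>)" if "\<forall>K\<in>\<K>. ?P K" for \<K>
  proof -
    have "cmap M i ` (\<Union>\<K> \<inter> cdom M i) = (\<Union>K\<in>\<K>. cmap M i ` (K \<inter> cdom M i))" for i by blast
    then show ?thesis using that by auto
  qed
  ultimately have "istopology ?P" unfolding istopology_def by blast
  then show ?thesis unfolding mtop_def by (simp add: topology_inverse')
qed

definition smooth_manifold :: "('a, 'i, 'e::real_normed_vector) atlas \<Rightarrow> bool" where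
  "smooth_manifold M \<longleftrightarrow>
     (\<forall>i. inj_on (cmap M i) (cdom M i) \<and> open (cmap M i ` cdom M i)) \<and>
     (\<forall>i j. open (cmap M i ` (cdom M i \<inter> cdom M j)) \<and>
            smooth_on (cmap M i ` (cdom M i \<inter> cdom M j)) (cmap M j \<circ> cinv M i)) \<and>
     Hausdorff_space (mtop M) \<and> second_countable (mtop M)"

text \<open>The openness requirement in the following definition is the continuity of \<^term>\<open>f\<close>.\<close>

definition smooth_map ::
  "('a, 'i, 'e::real_normed_vector) atlas \<Rightarrow> ('b, 'j, 'd::real_normed_vector) atlas
    \<Rightarrow> ('a \<Rightarrow> 'b) \<Rightarrow> bool" where
  "smooth_map M N f \<longleftrightarrow> f ` points M \<subseteq> points N \<and>
     (\<forall>i j. open (cmap M i ` (cdom M i \<inter> f -` cdom N j)) \<and>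
            smooth_on (cmap M i ` (cdom M i \<inter> f -` cdom N j)) (cmap N j \<circ> f \<circ> cinv M i))"

definition diffeo ::
  "('a, 'i, 'e::real_normed_vector) atlas \<Rightarrow> ('b, 'j, 'd::real_normed_vector) atlas
    \<Rightarrow> ('a \<Rightarrow> 'b) \<Rightarrow> bool" where
  "diffeo M N f \<longleftrightarrow> bij_betw f (points M) (points N) \<and> smooth_map M N f \<and>
     smooth_map N M (inv_into (points M) f)"

definition real_line :: "(real, unit, real) atlas" where
  "real_line = Atlas (\<lambda>_. UNIV) (\<lambda>_ x. x)"

definition sub_atlas :: "('a, 'i, 'e) atlas \<Rightarrow> 'a set \<Rightarrow> ('a, 'i, 'e) atlas" where
  "sub_atlas M W = Atlas (\<lambda>i. cdom M i \<inter> W) (cmap M)"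

definition prod_atlas ::
  "('a, 'i, 'e) atlas \<Rightarrow> ('b, 'j, 'd) atlas \<Rightarrow> ('a \<times> 'b, 'i \<times> 'j, 'e \<times> 'd) atlas" where
  "prod_atlas M N = Atlas (\<lambda>(i, j). cdom M i \<times> cdom N j)
                          (\<lambda>(i, j) (x, y). (cmap M i x, cmap N j y))"

text \<open>\<open>Fib\<close> is the typical fibre. If the model space of \<^term>\<open>M\<close> is finite-dimensional, then
  so are those of \<^term>\<open>N\<close> and \<open>Fib\<close>, by local triviality (unless there are no points at all);
  no Euclidean type class is imposed on them, since it would exclude dimension \<open>0\<close>.\<close>

definition fibre_bundle ::
  "('a, 'i, 'e::real_normed_vector) atlas \<Rightarrow> ('b, 'j, 'd::real_normed_vector) atlas
    \<Rightarrow> ('c, 'k, 'f::real_normed_vector) atlas \<Rightarrow> ('a \<Rightarrow> 'b) \<Rightarrow> bool" where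
  "fibre_bundle M N Fib \<pi> \<longleftrightarrow>
     smooth_manifold M \<and> smooth_manifold N \<and> smooth_manifold Fib \<and>
     smooth_map M N \<pi> \<and> \<pi> ` points M = points N \<and>
     (\<forall>n\<in>points N. \<exists>W \<psi>. openin (mtop N) W \<and> n \<in> W \<and>
        diffeo (sub_atlas M (\<pi> -` W)) (prod_atlas (sub_atlas N W) Fib) \<psi> \<and>
        (\<forall>m\<in>points M \<inter> \<pi> -` W. fst (\<psi> m) = \<pi> m))"


section \<open>Tangent bundles\<close>

text \<open>A tangent vector at \<^term>\<open>p\<close> is the family of its components in all charts around
  \<^term>\<open>p\<close>, subject to the usual transformation law; the components in the other charts are
  set to \<open>0\<close>. Elements of the tangent bundle are pairs of a point and a tangent vector there,
  and the bundle projection is \<^const>\<open>fst\<close>.\<close>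

type_synonym ('a, 'i, 'e) tangent = "'a \<times> ('i \<Rightarrow> 'e)"

definition tangent_space ::
  "('a, 'i, 'e::real_normed_vector) atlas \<Rightarrow> 'a \<Rightarrow> ('i \<Rightarrow> 'e) set" where
  "tangent_space M p = {v. (\<forall>i. p \<notin> cdom M i \<longrightarrow> v i = 0) \<and>
     (\<forall>i j. p \<in> cdom M i \<inter> cdom M j \<longrightarrow>
        v j = frechet_derivative (cmap M j \<circ> cinv M i) (at (cmap M i p)) (v i))}"

definition TB ::
  "('a, 'i, 'e::real_normed_vector) atlas \<Rightarrow> (('a, 'i, 'e) tangent, 'i, 'e \<times> 'e) atlas" where
  "TB M = Atlas (\<lambda>i. SIGMA p:cdom M i. tangent_space M p)
                (\<lambda>i (p, v). (cmap M i p, v i))"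

definition tscale :: "real \<Rightarrow> ('a, 'i, 'e::real_normed_vector) tangent \<Rightarrow> ('a, 'i, 'e) tangent" where
  "tscale t u = (fst u, \<lambda>i. t *\<^sub>R snd u i)"

definition tzero :: "'a \<Rightarrow> ('a, 'i, 'e::real_normed_vector) tangent" where
  "tzero p = (p, \<lambda>i. 0)"

definition slit_TB ::
  "('a, 'i, 'e::real_normed_vector) atlas \<Rightarrow> (('a, 'i, 'e) tangent, 'i, 'e \<times> 'e) atlas" where
  "slit_TB M = sub_atlas (TB M) {u. u \<noteq> tzero (fst u)}"

text \<open>In the next two definitions the chart at the base point of the argument is chosen
  arbitrarily; by the chain rule, the values on tangent vectors of a manifold do not depend
  on the choice.\<close>

definition tangent_map ::
  "('a, 'i, 'e::real_normed_vector) atlas \<Rightarrow> ('b, 'j, 'd::real_normed_vector) atlas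
    \<Rightarrow> ('a \<Rightarrow> 'b) \<Rightarrow> ('a, 'i, 'e) tangent \<Rightarrow> ('b, 'j, 'd) tangent" where
  "tangent_map M N f u =
     (let i = (SOME i. fst u \<in> cdom M i)
      in (f (fst u), \<lambda>j. if f (fst u) \<in> cdom N j
            then frechet_derivative (cmap N j \<circ> f \<circ> cinv M i) (at (cmap M i (fst u))) (snd u i)
            else 0))"

definition tderiv ::
  "('a, 'i, 'e::real_normed_vector) atlas \<Rightarrow> ('a, 'i, 'e) tangent \<Rightarrow> ('a \<Rightarrow> real) \<Rightarrow> real" where
  "tderiv M u f =
     (let i = (SOME i. fst u \<in> cdom M i)
      in frechet_derivative (f \<circ> cinv M i) (at (cmap M i (fst u))) (snd u i))"

definition vector_field ::
  "('a, 'i, 'e::real_normed_vector) atlas \<Rightarrow> ('a \<Rightarrow> ('a, 'i, 'e) tangent) \<Rightarrow> bool" where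
  "vector_field M X \<longleftrightarrow> smooth_map M (TB M) X \<and> (\<forall>p\<in>points M. fst (X p) = p)"

definition comps ::
  "('a, 'i, 'e) atlas \<Rightarrow> ('a \<Rightarrow> ('a, 'i, 'e) tangent) \<Rightarrow> 'i \<Rightarrow> 'e \<Rightarrow> 'e" where
  "comps M X i q = snd (X (cinv M i q)) i"

definition lie_bracket ::
  "('a, 'i, 'e::real_normed_vector) atlas \<Rightarrow> ('a \<Rightarrow> ('a, 'i, 'e) tangent)
    \<Rightarrow> ('a \<Rightarrow> ('a, 'i, 'e) tangent) \<Rightarrow> 'a \<Rightarrow> ('a, 'i, 'e) tangent" where
  "lie_bracket M X Y p =
     (p, \<lambda>i. if p \<in> cdom M i
        then frechet_derivative (comps M Y i) (at (cmap M i p)) (snd (X p) i)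
           - frechet_derivative (comps M X i) (at (cmap M i p)) (snd (Y p) i)
        else 0)"

definition vertical_lift ::
  "('a, 'i, 'e::real_normed_vector) atlas \<Rightarrow> ('a \<Rightarrow> ('a, 'i, 'e) tangent)
    \<Rightarrow> ('a, 'i, 'e) tangent \<Rightarrow> (('a, 'i, 'e) tangent, 'i, 'e \<times> 'e) tangent" where
  "vertical_lift M X u =
     (u, \<lambda>i. if fst u \<in> cdom M i then (0, snd (X (fst u)) i) else 0)"

definition complete_lift ::
  "('a, 'i, 'e::real_normed_vector) atlas \<Rightarrow> ('a \<Rightarrow> ('a, 'i, 'e) tangent)
    \<Rightarrow> ('a, 'i, 'e) tangent \<Rightarrow> (('a, 'i, 'e) tangent, 'i, 'e \<times> 'e) tangent" where
  "complete_lift M X u =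
     (u, \<lambda>i. if fst u \<in> cdom M i
        then (snd (X (fst u)) i,
              frechet_derivative (comps M X i) (at (cmap M i (fst u))) (snd u i))
        else 0)"

definition liouville ::
  "('a, 'i, 'e::real_normed_vector) atlas \<Rightarrow> ('a, 'i, 'e) tangent
    \<Rightarrow> (('a, 'i, 'e) tangent, 'i, 'e \<times> 'e) tangent" where
  "liouville M u = (u, \<lambda>i. if fst u \<in> cdom M i then (0, snd u i) else 0)"

text \<open>The velocities of smooth curves in a subset; for an embedded submanifold they are the
  tangent vectors of the submanifold.\<close>

definition tangent_to_subset ::
  "('a, 'i, 'e::real_normed_vector) atlas \<Rightarrow> 'a set \<Rightarrow> ('a, 'i, 'e) tangent set" where
  "tangent_to_subset M A = {u. \<exists>\<epsilon>>0. \<exists>c.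
     smooth_map (sub_atlas real_line {-\<epsilon><..<\<epsilon>}) M c \<and> c ` {-\<epsilon><..<\<epsilon>} \<subseteq> A \<and>
     tangent_map (sub_atlas real_line {-\<epsilon><..<\<epsilon>}) M c (0, \<lambda>_. 1) = u}"


section \<open>Finsler functions and sprays\<close>

text \<open>The function \<open>\<partial>\<^sup>2E/\<partial>u\<^sup>a\<partial>u\<^sup>b\<close> at \<^term>\<open>u\<close>, in the natural chart with index \<^term>\<open>i\<close>.\<close>

definition fibre_hessian ::
  "('a, 'i, 'e::real_normed_vector) atlas \<Rightarrow> (('a, 'i, 'e) tangent \<Rightarrow> real) \<Rightarrow> 'i
    \<Rightarrow> ('a, 'i, 'e) tangent \<Rightarrow> 'e \<Rightarrow> 'e \<Rightarrow> real" where
  "fibre_hessian M E i u a b =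
     frechet_derivative
       (\<lambda>y. frechet_derivative (\<lambda>x. E (cinv (TB M) i (cmap M i (fst u), x))) (at y) b)
       (at (snd u i)) a"

definition energy :: "('t \<Rightarrow> real) \<Rightarrow> 't \<Rightarrow> real" where
  "energy F u = (1/2) * (F u)\<^sup>2"

definition finsler ::
  "('a, 'i, 'e::euclidean_space) atlas \<Rightarrow> (('a, 'i, 'e) tangent \<Rightarrow> real) \<Rightarrow> bool" where
  "finsler M F \<longleftrightarrow>
     (\<forall>u\<in>points (TB M). F u \<ge> 0) \<and>
     continuous_map (mtop (TB M)) euclideanreal F \<and>
     (\<forall>u\<in>points (TB M). \<forall>t>0. F (tscale t u) = t * F u) \<and>
     smooth_map (slit_TB M) real_line F \<and>
     (\<forall>i. \<forall>u\<in>cdom (slit_TB M) i. \<forall>w\<noteq>0.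
        (\<Sum>a\<in>Basis. \<Sum>b\<in>Basis. (w \<bullet> a) * (w \<bullet> b) * fibre_hessian M (energy F) i u a b) > 0)"

definition spray ::
  "('a, 'i, 'e::real_normed_vector) atlas
    \<Rightarrow> (('a, 'i, 'e) tangent \<Rightarrow> (('a, 'i, 'e) tangent, 'i, 'e \<times> 'e) tangent) \<Rightarrow> bool" where
  "spray M S \<longleftrightarrow> vector_field (slit_TB M) S \<and>
     (\<forall>i. \<forall>u\<in>cdom (slit_TB M) i. fst (snd (S u) i) = snd u i) \<and>
     (\<forall>u\<in>points (slit_TB M). lie_bracket (slit_TB M) (liouville M) S u = S u)"

definition canonical_spray ::
  "('a, 'i, 'e::real_normed_vector) atlas \<Rightarrow> (('a, 'i, 'e) tangent \<Rightarrow> real)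
    \<Rightarrow> (('a, 'i, 'e) tangent \<Rightarrow> (('a, 'i, 'e) tangent, 'i, 'e \<times> 'e) tangent) \<Rightarrow> bool" where
  "canonical_spray M F S \<longleftrightarrow> spray M S \<and>
     (\<forall>X. vector_field M X \<longrightarrow> (\<forall>u\<in>points (slit_TB M).
        tderiv (slit_TB M) (S u) (\<lambda>u'. tderiv (slit_TB M) (vertical_lift M X u') (energy F))
          - tderiv (slit_TB M) (complete_lift M X u) (energy F) = 0))"

definition projectively_related ::
  "('a, 'i, 'e::real_normed_vector) atlas
    \<Rightarrow> (('a, 'i, 'e) tangent \<Rightarrow> (('a, 'i, 'e) tangent, 'i, 'e \<times> 'e) tangent)
    \<Rightarrow> (('a, 'i, 'e) tangent \<Rightarrow> (('a, 'i, 'e) tangent, 'i, 'e \<times> 'e) tangent) \<Rightarrow> bool" where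
  "projectively_related M S' S \<longleftrightarrow> spray M S' \<and>
     (\<exists>P :: ('a, 'i, 'e) tangent \<Rightarrow> real. \<forall>u\<in>points (slit_TB M).
        (\<forall>t>0. P (tscale t u) = t * P u) \<and>
        S' u = (u, \<lambda>i. snd (S u) i - (2 * P u) *\<^sub>R snd (liouville M u) i))"


section \<open>Nonlinear splittings\<close>

definition pullback_TB ::
  "('a, 'i, 'e::real_normed_vector) atlas \<Rightarrow> ('b, 'j, 'd::real_normed_vector) atlas \<Rightarrow> ('a \<Rightarrow> 'b)
    \<Rightarrow> ('a \<times> ('b, 'j, 'd) tangent, 'i \<times> 'j, 'e \<times> 'd) atlas" where
  "pullback_TB M N \<pi> =
     Atlas (\<lambda>(i, j). {(m, w). m \<in> cdom M i \<and> w \<in> cdom (TB N) j \<and> \<pi> m = fst w})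
           (\<lambda>(i, j) (m, w). (cmap M i m, snd w j))"

definition slit_pullback_TB ::
  "('a, 'i, 'e::real_normed_vector) atlas \<Rightarrow> ('b, 'j, 'd::real_normed_vector) atlas \<Rightarrow> ('a \<Rightarrow> 'b)
    \<Rightarrow> ('a \<times> ('b, 'j, 'd) tangent, 'i \<times> 'j, 'e \<times> 'd) atlas" where
  "slit_pullback_TB M N \<pi> =
     sub_atlas (pullback_TB M N \<pi>) {(m, w). w \<noteq> tzero (fst w)}"

definition splitting_map ::
  "('a, 'i, 'e::real_normed_vector) atlas \<Rightarrow> ('b, 'j, 'd::real_normed_vector) atlas \<Rightarrow> ('a \<Rightarrow> 'b)
    \<Rightarrow> ('a \<times> ('b, 'j, 'd) tangent \<Rightarrow> ('a, 'i, 'e) tangent) \<Rightarrow> bool" where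
  "splitting_map M N \<pi> h \<longleftrightarrow> (\<forall>z\<in>points (pullback_TB M N \<pi>).
     h z \<in> points (TB M) \<and> fst (h z) = fst z \<and> tangent_map M N \<pi> (h z) = snd z)"

definition nonlinear_splitting ::
  "('a, 'i, 'e::real_normed_vector) atlas \<Rightarrow> ('b, 'j, 'd::real_normed_vector) atlas \<Rightarrow> ('a \<Rightarrow> 'b)
    \<Rightarrow> ('a \<times> ('b, 'j, 'd) tangent \<Rightarrow> ('a, 'i, 'e) tangent) \<Rightarrow> bool" where
  "nonlinear_splitting M N \<pi> h \<longleftrightarrow>
     splitting_map M N \<pi> h \<and> smooth_map (slit_pullback_TB M N \<pi>) (TB M) h"

definition homogeneous_splitting ::
  "('a, 'i, 'e::real_normed_vector) atlas \<Rightarrow> ('b, 'j, 'd::real_normed_vector) atlas \<Rightarrow> ('a \<Rightarrow> 'b)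
    \<Rightarrow> ('a \<times> ('b, 'j, 'd) tangent \<Rightarrow> ('a, 'i, 'e) tangent) \<Rightarrow> bool" where
  "homogeneous_splitting M N \<pi> h \<longleftrightarrow> (\<forall>(m, w)\<in>points (pullback_TB M N \<pi>). \<forall>t>0.
     h (m, tscale t w) = tscale t (h (m, w)))"

definition horizontal_manifold ::
  "('a, 'i, 'e::real_normed_vector) atlas \<Rightarrow> ('b, 'j, 'd::real_normed_vector) atlas \<Rightarrow> ('a \<Rightarrow> 'b)
    \<Rightarrow> ('a \<times> ('b, 'j, 'd) tangent \<Rightarrow> ('a, 'i, 'e) tangent) \<Rightarrow> ('a, 'i, 'e) tangent set" where
  "horizontal_manifold M N \<pi> h = h ` points (pullback_TB M N \<pi>)"

definition tangent_to_horizontal ::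
  "('a, 'i, 'e::real_normed_vector) atlas \<Rightarrow> ('b, 'j, 'd::real_normed_vector) atlas \<Rightarrow> ('a \<Rightarrow> 'b)
    \<Rightarrow> ('a \<times> ('b, 'j, 'd) tangent \<Rightarrow> ('a, 'i, 'e) tangent)
    \<Rightarrow> (('a, 'i, 'e) tangent \<Rightarrow> (('a, 'i, 'e) tangent, 'i, 'e \<times> 'e) tangent) \<Rightarrow> bool" where
  "tangent_to_horizontal M N \<pi> h S \<longleftrightarrow> (\<forall>z\<in>points (slit_pullback_TB M N \<pi>).
     S (h z) \<in> tangent_to_subset (TB M) (horizontal_manifold M N \<pi> h))"

definition vertical_field ::
  "('a, 'i, 'e::real_normed_vector) atlas \<Rightarrow> ('b, 'j, 'd::real_normed_vector) atlas \<Rightarrow> ('a \<Rightarrow> 'b)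
    \<Rightarrow> ('a \<Rightarrow> ('a, 'i, 'e) tangent) \<Rightarrow> bool" where
  "vertical_field M N \<pi> Y \<longleftrightarrow> vector_field M Y \<and>
     (\<forall>p\<in>points M. tangent_map M N \<pi> (Y p) = tzero (\<pi> p))"

text \<open>Smoothness away from the zero section is not required here: it is a consequence of the
  strong convexity of \<^term>\<open>F\<close>.\<close>

definition induced_splitting ::
  "('a, 'i, 'e::real_normed_vector) atlas \<Rightarrow> ('b, 'j, 'd::real_normed_vector) atlas \<Rightarrow> ('a \<Rightarrow> 'b)
    \<Rightarrow> (('a, 'i, 'e) tangent \<Rightarrow> real)
    \<Rightarrow> ('a \<times> ('b, 'j, 'd) tangent \<Rightarrow> ('a, 'i, 'e) tangent) \<Rightarrow> bool" where
  "induced_splitting M N \<pi> F h \<longleftrightarrow> splitting_map M N \<pi> h \<and>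
     (\<forall>m\<in>points M. h (m, tzero (\<pi> m)) = tzero m) \<and>
     (\<forall>Y. vertical_field M N \<pi> Y \<longrightarrow> (\<forall>z\<in>points (slit_pullback_TB M N \<pi>).
        tderiv (slit_TB M) (vertical_lift M Y (h z)) (energy F) = 0))"

end

(*
  On the fibre of TM over m, the vectors projecting to a fixed v \<noteq> 0 form an affine space missing 0, on
  which E is strictly convex; so the critical point h(m, v) is unique, which gives homogeneity, and
  by the inverse function theorem, applied to (q, u) \<mapsto> (q, T\<pi> u, dE along vertical directions), it
  depends smoothly on (m, v).

  The same map straightens Im h, so a vector \<xi> at a point of Im h is tangent to Im h iff
  \<xi>(Y\<^sup>V(E)) = 0 for all \<pi>-vertical fields Y: the values of these fields span the vertical spaces, by
  local triviality and bump functions. Since S(Y\<^sup>V(E)) = Y\<^sup>C(E), this is (ii); and (iii) holds because the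
  Liouville field is tangent to the cone Im h.
*)
theory Submission
  imports Defs
begin

section \<open>Calculus of smooth maps\<close>

text \<open>Strict convexity makes the straightening map \<Phi> injective on its whole domain, so
  invariance of domain already provides an open image and a continuous inverse, and only the
  derivatives of the inverse remain to be computed. This requires \<Phi> to map an open part of
  \<open>'e \<times> 'e\<close> into \<open>'e \<times> 'e\<close>, whereas the model spaces of
  \<open>N\<close> and of the fibre are merely normed. Hence the projection of \<open>u\<close> and
  the vertical differential of the energy are packed into one vector of \<open>'e\<close>: the
  former is moved there by a right inverse \<open>J\<close> of the linearised projection
  \<open>R\<close>, the latter is represented through the inner product and then projected to the
  kernel of \<open>R\<close>, a complement of the range of \<open>J\<close>.

  Tangent vectors of \<open>Im h\<close> are velocities of curves. One half of the tangency
  criterion therefore differentiates a function that vanishes along a curve; the other half has to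
  produce a curve, which is a straight line in the coordinates \<Phi>.\<close>

abbreviation FD :: "('a::real_normed_vector \<Rightarrow> 'b::real_normed_vector) \<Rightarrow> 'a \<Rightarrow> 'a \<Rightarrow> 'b" where
  "FD f x \<equiv> frechet_derivative f (at x)"

lemma FD_works: "f differentiable (at x) \<Longrightarrow> (f has_derivative FD f x) (at x)"
  using frechet_derivative_works by blast

lemma FD_eq: "(f has_derivative f') (at x) \<Longrightarrow> FD f x = f'"
  using frechet_derivative_at by metis

lemma FD_cong:
  assumes "f differentiable (at x)" "open U" "x \<in> U" "\<And>y. y \<in> U \<Longrightarrow> f y = g y"
  shows "g differentiable (at x)" "FD g x = FD f x"
proof -
  have "(g has_derivative FD f x) (at x)"
    using has_derivative_transform_within_open[OF FD_works[OF assms(1)] assms(2,3)] assms(4) by auto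
  then show "g differentiable (at x)" "FD g x = FD f x"
    by (auto simp: differentiable_def FD_eq)
qed

lemma Ck_on_Suc_lower: "Ck_on (Suc k) U f \<Longrightarrow> Ck_on k U f"
proof (induction k arbitrary: f)
  case 0
  then show ?case
    by (auto intro!: continuous_at_imp_continuous_on differentiable_imp_continuous_within)
qed auto

lemma Ck_on_subset: "Ck_on k U f \<Longrightarrow> V \<subseteq> U \<Longrightarrow> Ck_on k V f"
  by (induction k arbitrary: f) (auto intro: continuous_on_subset)

lemma Ck_on_cong: "open U \<Longrightarrow> (\<And>x. x \<in> U \<Longrightarrow> f x = g x) \<Longrightarrow> Ck_on k U f \<Longrightarrow> Ck_on k U g"
proof (induction k arbitrary: f g)
  case 0
  then show ?case using continuous_on_cong by (metis Ck_on.simps(1))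
next
  case (Suc k)
  have diff: "g differentiable (at x)" "FD g x = FD f x" if "x \<in> U" for x
    using FD_cong[OF _ Suc.prems(1) that Suc.prems(2)] Suc.prems(3) that by auto
  have "Ck_on k U (\<lambda>x. FD g x v)" for v
    by (rule Suc.IH[of "\<lambda>x. FD f x v"]) (use Suc.prems diff in auto)
  with diff show ?case by auto
qed

lemma Ck_on_local: "(\<And>x. x \<in> U \<Longrightarrow> \<exists>V. open V \<and> x \<in> V \<and> Ck_on k V f) \<Longrightarrow> Ck_on k U f"
proof (induction k arbitrary: f)
  case 0
  then show ?case
    by (metis Ck_on.simps(1) continuous_at_imp_continuous_on continuous_on_eq_continuous_at)
next
  case (Suc k)
  have "Ck_on k U (\<lambda>x. FD f x v)" for v
    by (rule Suc.IH) (use Suc.prems in force)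
  with Suc.prems show ?case by force
qed

text \<open>Uniqueness of derivatives determines \<open>frechet_derivative\<close> on
  \<open>U\<close>. With this rule the closure properties below only have to exhibit a derivative
  formula built from maps that are already known to be in \<open>Ck_on k\<close>.\<close>

lemma Ck_on_SucI:
  assumes "open U" "\<And>x. x \<in> U \<Longrightarrow> (f has_derivative f' x) (at x)" "\<And>v. Ck_on k U (\<lambda>x. f' x v)"
  shows "Ck_on (Suc k) U f"
proof -
  have "Ck_on k U (\<lambda>x. FD f x v)" for v
    by (rule Ck_on_cong[OF assms(1) _ assms(3)[of v]]) (use FD_eq assms(2) in metis)
  then show ?thesis using assms(2) by (auto simp: differentiable_def)
qed

lemma Ck_on_has_derivative: "Ck_on (Suc k) U f \<Longrightarrow> x \<in> U \<Longrightarrow> (f has_derivative FD f x) (at x)"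
  by (auto intro: FD_works)

lemma Ck_on_const: "open U \<Longrightarrow> Ck_on k U (\<lambda>x. c)"
  by (induction k arbitrary: c) (auto)

lemma Ck_on_bounded_linear_outer:
  assumes L: "bounded_linear L" and U: "open U" shows "Ck_on k U f \<Longrightarrow> Ck_on k U (\<lambda>x. L (f x))"
proof (induction k arbitrary: f)
  case 0
  then show ?case using L by (auto intro: bounded_linear.continuous_on)
next
  case (Suc k)
  show ?case
  proof (rule Ck_on_SucI[OF U])
    show "((\<lambda>x. L (f x)) has_derivative (\<lambda>v. L (FD f x v))) (at x)" if "x \<in> U" for x
      using bounded_linear.has_derivative[OF L] Suc.prems that Ck_on_has_derivative by blast
    show "Ck_on k U (\<lambda>x. L (FD f x v))" for v
      using Suc by auto
  qed
qed

text \<open>The derivative in direction \<open>v\<close> is the derivative of \<open>f\<close> in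
  the fixed direction \<open>T v\<close>, so the middle space may be any normed space. This covers
  the product of the model spaces of base and fibre, to which \<open>Ck_on_compose\<close> does not
  apply.\<close>

lemma Ck_on_affine_inner:
  assumes T: "bounded_linear T" and V: "open V" and sub: "\<And>x. x \<in> V \<Longrightarrow> c + T x \<in> U"
  shows "Ck_on k U f \<Longrightarrow> Ck_on k V (\<lambda>x. f (c + T x))"
proof (induction k arbitrary: f)
  case 0
  then show ?case using sub bounded_linear.linear[OF T]
    by (auto intro!: continuous_on_compose2[of U f] continuous_intros bounded_linear.continuous_on[OF T])
next
  case (Suc k)
  show ?case
  proof (rule Ck_on_SucI[OF V])
    show "((\<lambda>x. f (c + T x)) has_derivative (\<lambda>v. FD f (c + T x) (T v))) (at x)" if "x \<in> V" for x
    proof -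
      have "((\<lambda>x. c + T x) has_derivative T) (at x)"
        using bounded_linear_imp_has_derivative[OF T] by (auto intro!: derivative_eq_intros)
      from diff_chain_at[OF this Ck_on_has_derivative[OF Suc.prems sub[OF that]]]
      show ?thesis by (simp add: o_def)
    qed
    show "Ck_on k V (\<lambda>x. FD f (c + T x) (T v))" for v
      using Suc by auto
  qed
qed

lemma Ck_on_add: "open U \<Longrightarrow> Ck_on k U f \<Longrightarrow> Ck_on k U g \<Longrightarrow> Ck_on k U (\<lambda>x. f x + g x)"
proof (induction k arbitrary: f g)
  case 0 then show ?case by (auto intro: continuous_intros)
next
  case (Suc k)
  show ?case
    by (rule Ck_on_SucI[OF Suc.prems(1) has_derivative_add[OF Ck_on_has_derivative[OF Suc.prems(2)] Ck_on_has_derivative[OF Suc.prems(3)]]])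
      (use Suc in auto)
qed

lemma Ck_on_sum:
  "open U \<Longrightarrow> (\<And>i. i \<in> I \<Longrightarrow> Ck_on k U (f i)) \<Longrightarrow> Ck_on k U (\<lambda>x. \<Sum>i\<in>I. f i x)"
  by (induction I rule: infinite_finite_induct) (auto intro: Ck_on_const Ck_on_add)

lemma Ck_on_bilinear:
  assumes B: "bounded_bilinear B" and U: "open U"
  shows "Ck_on k U f \<Longrightarrow> Ck_on k U g \<Longrightarrow> Ck_on k U (\<lambda>x. B (f x) (g x))"
proof (induction k arbitrary: f g)
  case 0 then show ?case by (auto intro: bounded_bilinear.continuous_on[OF B])
next
  case (Suc k)
  show ?case
  proof (rule Ck_on_SucI[OF U])
    show "((\<lambda>x. B (f x) (g x)) has_derivative (\<lambda>v. B (f x) (FD g x v) + B (FD f x v) (g x))) (at x)"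
      if "x \<in> U" for x
      by (rule bounded_bilinear.FDERIV[OF B Ck_on_has_derivative[OF Suc.prems(1) that]
            Ck_on_has_derivative[OF Suc.prems(2) that]])
    show "Ck_on k U (\<lambda>x. B (f x) (FD g x v) + B (FD f x v) (g x))" for v
      by (intro Ck_on_add Suc.IH U Ck_on_Suc_lower[OF Suc.prems(1)] Ck_on_Suc_lower[OF Suc.prems(2)])
        (use Suc.prems in auto)
  qed
qed

lemma linear_euclidean_expansion:
  fixes f :: "'a::euclidean_space \<Rightarrow> 'b::real_normed_vector"
  assumes "linear f" shows "f x = (\<Sum>b\<in>Basis. (x \<bullet> b) *\<^sub>R f b)"
proof -
  have "f x = f (\<Sum>b\<in>Basis. (x \<bullet> b) *\<^sub>R b)" by (simp add: euclidean_representation)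
  then show ?thesis by (simp only: linear_sum[OF assms] linear_cmul[OF assms])
qed

text \<open>The chain rule differentiates \<open>g\<close> in the direction \<open>FD f x v\<close>,
  which moves with \<open>x\<close>, while \<open>Ck_on\<close> controls fixed directions only.
  Expanding in the basis of the Euclidean middle space leaves finitely many fixed directions with
  varying coefficients.\<close>

lemma Ck_on_compose:
  fixes f :: "'a::real_normed_vector \<Rightarrow> 'b::euclidean_space"
  assumes U: "open U" and sub: "\<And>x. x \<in> U \<Longrightarrow> f x \<in> V"
  shows "Ck_on k V g \<Longrightarrow> Ck_on k U f \<Longrightarrow> Ck_on k U (\<lambda>x. g (f x))"
proof (induction k arbitrary: g)
  case 0 then show ?case using sub by (auto intro!: continuous_on_compose2[of V g])
next
  case (Suc k)
  show ?case
  proof (rule Ck_on_SucI[OF U])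
    show "((\<lambda>x. g (f x)) has_derivative (\<lambda>v. \<Sum>b\<in>Basis. (FD f x v \<bullet> b) *\<^sub>R FD g (f x) b)) (at x)"
      if "x \<in> U" for x
    proof -
      have g: "(g has_derivative FD g (f x)) (at (f x))"
        using Suc.prems(1) sub[OF that] by (rule Ck_on_has_derivative)
      have "((\<lambda>x. g (f x)) has_derivative (\<lambda>v. FD g (f x) (FD f x v))) (at x)"
        using diff_chain_at[OF Ck_on_has_derivative[OF Suc.prems(2) that] g] by (simp add: o_def)
      moreover have "(\<lambda>v. FD g (f x) (FD f x v)) = (\<lambda>v. \<Sum>b\<in>Basis. (FD f x v \<bullet> b) *\<^sub>R FD g (f x) b)"
        by (rule ext) (rule linear_euclidean_expansion[OF has_derivative_linear[OF g]])
      ultimately show ?thesis by (simp only:)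
    qed
    show "Ck_on k U (\<lambda>x. \<Sum>b\<in>Basis. (FD f x v \<bullet> b) *\<^sub>R FD g (f x) b)" for v
      by (intro Ck_on_sum U Ck_on_bilinear[OF bounded_bilinear_scaleR]
          Ck_on_bounded_linear_outer[OF bounded_linear_inner_left] Suc.IH
          Ck_on_Suc_lower[OF Suc.prems(2)]) (use Suc.prems in auto)
  qed
qed

lemma smooth_on_subset: "smooth_on U f \<Longrightarrow> V \<subseteq> U \<Longrightarrow> smooth_on V f"
  unfolding smooth_on_def using Ck_on_subset by blast

lemma smooth_on_cong:
  "smooth_on U f \<Longrightarrow> open U \<Longrightarrow> (\<And>x. x \<in> U \<Longrightarrow> f x = g x) \<Longrightarrow> smooth_on U g"
  unfolding smooth_on_def by (metis Ck_on_cong)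

lemma smooth_on_local:
  "(\<And>x. x \<in> U \<Longrightarrow> \<exists>V. open V \<and> x \<in> V \<and> smooth_on V f) \<Longrightarrow> smooth_on U f"
  unfolding smooth_on_def by (meson Ck_on_local)

lemma smooth_on_has_derivative: "smooth_on U f \<Longrightarrow> x \<in> U \<Longrightarrow> (f has_derivative FD f x) (at x)"
  unfolding smooth_on_def using Ck_on_has_derivative by blast

lemma smooth_on_differentiable: "smooth_on U f \<Longrightarrow> x \<in> U \<Longrightarrow> f differentiable (at x)"
  using smooth_on_has_derivative differentiable_def by blast

lemma smooth_on_continuous_on: "smooth_on U f \<Longrightarrow> continuous_on U f"
  unfolding smooth_on_def by (metis Ck_on.simps(1))

lemma smooth_on_FD: "smooth_on U f \<Longrightarrow> smooth_on U (\<lambda>x. FD f x v)"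
  unfolding smooth_on_def by (metis Ck_on.simps(2))

lemma smooth_on_const: "open U \<Longrightarrow> smooth_on U (\<lambda>x. c)"
  unfolding smooth_on_def using Ck_on_const by blast

lemma smooth_on_bounded_linear_outer:
  "bounded_linear L \<Longrightarrow> open U \<Longrightarrow> smooth_on U f \<Longrightarrow> smooth_on U (\<lambda>x. L (f x))"
  unfolding smooth_on_def using Ck_on_bounded_linear_outer by blast

lemma smooth_on_affine_inner:
  "bounded_linear T \<Longrightarrow> open V \<Longrightarrow> (\<And>x. x \<in> V \<Longrightarrow> c + T x \<in> U) \<Longrightarrow> smooth_on U f \<Longrightarrow>
    smooth_on V (\<lambda>x. f (c + T x))"
  unfolding smooth_on_def using Ck_on_affine_inner[of T V c U _ f] by blast

lemma smooth_on_id: "open U \<Longrightarrow> smooth_on U (\<lambda>x. x)"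
proof -
  assume U: "open U"
  have "Ck_on k U (\<lambda>x. x)" for k
  proof (cases k)
    case (Suc n)
    then show ?thesis using Ck_on_SucI[OF U has_derivative_ident] Ck_on_const[OF U] by blast
  qed auto
  then show ?thesis by (simp add: smooth_on_def)
qed

lemma smooth_on_add:
  "open U \<Longrightarrow> smooth_on U f \<Longrightarrow> smooth_on U g \<Longrightarrow> smooth_on U (\<lambda>x. f x + g x)"
  unfolding smooth_on_def using Ck_on_add by blast

lemma smooth_on_sum:
  "open U \<Longrightarrow> (\<And>i. i \<in> I \<Longrightarrow> smooth_on U (f i)) \<Longrightarrow> smooth_on U (\<lambda>x. \<Sum>i\<in>I. f i x)"
  unfolding smooth_on_def using Ck_on_sum[of U I] by blast

lemma smooth_on_bilinear:
  "bounded_bilinear B \<Longrightarrow> open U \<Longrightarrow> smooth_on U f \<Longrightarrow> smooth_on U g \<Longrightarrow>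
    smooth_on U (\<lambda>x. B (f x) (g x))"
  unfolding smooth_on_def using Ck_on_bilinear by blast

lemma smooth_on_compose:
  fixes f :: "'a::real_normed_vector \<Rightarrow> 'b::euclidean_space"
  shows "smooth_on V g \<Longrightarrow> open U \<Longrightarrow> (\<And>x. x \<in> U \<Longrightarrow> f x \<in> V) \<Longrightarrow> smooth_on U f \<Longrightarrow>
    smooth_on U (\<lambda>x. g (f x))"
  unfolding smooth_on_def using Ck_on_compose[of U f V _ g] by blast

lemma smooth_on_Pair:
  assumes U: "open U" and "smooth_on U f" "smooth_on U g"
  shows "smooth_on U (\<lambda>x. (f x, g x))"
proof -
  have "bounded_linear (\<lambda>a. (a, 0))" "bounded_linear (\<lambda>a. (0, a))"
    by (auto intro!: bounded_linear_Pair bounded_linear_ident bounded_linear_zero)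
  from smooth_on_add[OF U smooth_on_bounded_linear_outer[OF this(1) U assms(2)]
      smooth_on_bounded_linear_outer[OF this(2) U assms(3)]]
  show ?thesis by simp
qed

text \<open>Base point and direction vary together, by the same basis expansion; this is what makes
  tangent maps smooth in coordinates.\<close>

lemma smooth_on_FD_compose:
  fixes g :: "'a::real_normed_vector \<Rightarrow> 'b::euclidean_space"
  assumes f: "smooth_on V f" and U: "open U" and sub: "\<And>x. x \<in> U \<Longrightarrow> g x \<in> V"
    and g: "smooth_on U g" and w: "smooth_on U w"
  shows "smooth_on U (\<lambda>x. FD f (g x) (w x))"
proof (rule smooth_on_cong[OF _ U])
  show "smooth_on U (\<lambda>x. \<Sum>b\<in>Basis. (w x \<bullet> b) *\<^sub>R FD f (g x) b)"
    by (intro smooth_on_sum U smooth_on_bilinear[OF bounded_bilinear_scaleR]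
        smooth_on_bounded_linear_outer[OF bounded_linear_inner_left U w]
        smooth_on_compose[OF smooth_on_FD[OF f] U sub g])
  show "(\<Sum>b\<in>Basis. (w x \<bullet> b) *\<^sub>R FD f (g x) b) = FD f (g x) (w x)" if "x \<in> U" for x
    using linear_euclidean_expansion[OF has_derivative_linear[OF smooth_on_has_derivative[OF f sub[OF that]]]]
    by metis
qed

lemma smooth_on_fst: "open U \<Longrightarrow> smooth_on U f \<Longrightarrow> smooth_on U (\<lambda>x. fst (f x))"
  using smooth_on_bounded_linear_outer[OF bounded_linear_fst] .

lemma smooth_on_snd: "open U \<Longrightarrow> smooth_on U f \<Longrightarrow> smooth_on U (\<lambda>x. snd (f x))"
  using smooth_on_bounded_linear_outer[OF bounded_linear_snd] .

section \<open>Smooth inverses of injective maps with injective derivative\<close>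

text \<open>Since \<open>f\<close> is injective on all of \<open>W\<close>, invariance of domain
  takes the place of the contraction argument of the inverse function theorem: it gives the open
  image and the continuous inverse. An injective endomorphism of a Euclidean space is bijective,
  which supplies the derivative of the inverse.\<close>

lemma inj_derivative_inverse:
  fixes f :: "'a::euclidean_space \<Rightarrow> 'a"
  assumes W: "open W" and inj: "inj_on f W"
    and der: "\<And>x. x \<in> W \<Longrightarrow> (f has_derivative f' x) (at x)"
    and inj': "\<And>x v. x \<in> W \<Longrightarrow> f' x v = 0 \<Longrightarrow> v = 0"
  shows "open (f ` W)"
    and "\<And>x. x \<in> W \<Longrightarrow> bij (f' x)"
    and "\<And>x. x \<in> W \<Longrightarrow> (inv_into W f has_derivative inv (f' x)) (at (f x))"
proof -
  have cont: "continuous_on W f"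
    using der has_derivative_continuous continuous_at_imp_continuous_on by blast
  show op: "open (f ` W)"
    using invariance_of_domain_gen[OF W cont inj] by simp
  fix x assume x: "x \<in> W"
  have lin: "linear (f' x)" using der[OF x] has_derivative_linear by blast
  have i: "inj (f' x)" using inj'[OF x] lin by (simp add: linear_injective_0)
  then show b: "bij (f' x)" using lin by (simp add: bij_def eucl.linear_inj_imp_surj)
  have bl: "bounded_linear (inv (f' x))"
    using eucl.inj_linear_imp_inv_linear[OF lin i] by (simp add: linear_conv_bounded_linear)
  show "(inv_into W f has_derivative inv (f' x)) (at (f x))"
  proof (rule has_derivative_inverse_basic[OF _ bl _ _ op])
    show "(f has_derivative f' x) (at (inv_into W f (f x)))"
      using der[OF x] inv_into_f_f[OF inj x] by simp
    show "inv (f' x) \<circ> f' x = id" using i by (auto simp: o_def)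
    have "continuous_on (f ` W) (inv_into W f)"
      by (rule continuous_on_inverse_open[OF W cont]) (use inj in auto)
    then show "continuous (at (f x)) (inv_into W f)"
      using op x continuous_on_eq_continuous_at by blast
    show "f x \<in> f ` W" using x by auto
    show "f (inv_into W f z) = z" if "z \<in> f ` W" for z using f_inv_into_f that by metis
  qed
qed

text \<open>Differentiability of the pointwise inverse comes from applying the previous lemma
  to the fibre-preserving map \<open>(x, v) \<mapsto> (x, FD f x v)\<close>; higher derivatives are then given by
  \<open>d(A\<inverse>) = - A\<inverse> (dA) A\<inverse>\<close>.\<close>

lemma Ck_on_inv_FD:
  fixes f :: "'a::euclidean_space \<Rightarrow> 'a"
  assumes W: "open W" and f: "smooth_on W f"
    and inj': "\<And>x v. x \<in> W \<Longrightarrow> FD f x v = 0 \<Longrightarrow> v = 0"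
  shows "Ck_on k W (\<lambda>x. inv (FD f x) v)"
proof -
  let ?N = "\<lambda>v x. inv (FD f x) v"
  have lin: "linear (FD f x)" if "x \<in> W" for x
    using has_derivative_linear[OF smooth_on_has_derivative[OF f that]] .
  have inj: "inj (FD f x)" if "x \<in> W" for x
    using inj'[OF that] lin[OF that] by (simp add: linear_injective_0)
  have FN: "FD f x (?N v x) = v" if "x \<in> W" for x v
    using eucl.linear_inj_imp_surj[OF lin inj] that surj_f_inv_f by metis
  have NF: "?N (FD f x v) x = v" if "x \<in> W" for x v
    using inv_f_f[OF inj[OF that]] .
  have linN: "linear (inv (FD f x))" if "x \<in> W" for x
    using eucl.inj_linear_imp_inv_linear[OF lin inj] that by metis
  define \<Theta> where "\<Theta> = (\<lambda>z. (fst z, FD f (fst z) (snd z)))"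
  have opW: "open (W \<times> (UNIV::'a set))" using W by (simp add: open_Times)
  have smT: "smooth_on (W \<times> UNIV) \<Theta>" unfolding \<Theta>_def
    by (intro smooth_on_Pair smooth_on_FD_compose[OF f] smooth_on_fst smooth_on_snd smooth_on_id opW) auto
  have injT: "inj_on \<Theta> (W \<times> UNIV)"
    using NF unfolding inj_on_def \<Theta>_def by (metis fst_conv snd_conv mem_Times_iff prod_eqI)
  have FDT: "FD \<Theta> (x, v) (a, b) = (a, FD (\<lambda>z. FD f (fst z) (snd z)) (x, v) (a, b))"
    "FD (\<lambda>z. FD f (fst z) (snd z)) (x, v) (0, b) = FD f x b" if "x \<in> W" for x v a b
  proof -
    have 1: "((\<lambda>z. FD f (fst z) (snd z)) has_derivative FD (\<lambda>z. FD f (fst z) (snd z)) (x, v)) (at (x, v))"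
      by (rule smooth_on_has_derivative[where U = "W \<times> UNIV"])
        (use that in \<open>auto intro!: smooth_on_FD_compose[OF f] smooth_on_fst smooth_on_snd smooth_on_id opW\<close>)
    have "(\<Theta> has_derivative (\<lambda>c. (fst c, FD (\<lambda>z. FD f (fst z) (snd z)) (x, v) c))) (at (x, v))"
      unfolding \<Theta>_def by (auto intro!: derivative_eq_intros 1)
    from FD_eq[OF this] show "FD \<Theta> (x, v) (a, b) = (a, FD (\<lambda>z. FD f (fst z) (snd z)) (x, v) (a, b))" by simp
    have "((\<lambda>w. (x, w)) has_derivative (\<lambda>b. (0, b))) (at v)"
      by (auto intro!: derivative_eq_intros)
    from diff_chain_at[OF this 1] have "(FD f x has_derivative (\<lambda>b. FD (\<lambda>z. FD f (fst z) (snd z)) (x, v) (0, b))) (at v)"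
      by (simp add: o_def)
    from has_derivative_unique[OF this] have "(\<lambda>b. FD (\<lambda>z. FD f (fst z) (snd z)) (x, v) (0, b)) = FD f x"
      using lin[OF that] by (simp add: bounded_linear_imp_has_derivative linear_conv_bounded_linear)
    then show "FD (\<lambda>z. FD f (fst z) (snd z)) (x, v) (0, b) = FD f x b"
      by (rule fun_cong)
  qed
  \<comment> \<open>The derivative of \<open>\<Theta>\<close> is block triangular, with the identity
    and \<open>FD f x\<close> on the diagonal.\<close>
  have dinj: "v = 0" if "z \<in> W \<times> UNIV" "FD \<Theta> z v = 0" for z v
  proof -
    obtain x w a b where [simp]: "z = (x, w)" "v = (a, b)" by (metis surj_pair)
    have "x \<in> W" using that by simp
    then show ?thesis using that(2) FDT(1)[of x w a b] FDT(2)[of x w b] inj'[of x b] by (auto simp: zero_prod_def)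
  qed
  have derT: "(inv_into (W \<times> UNIV) \<Theta> has_derivative inv (FD \<Theta> z)) (at (\<Theta> z))"
    if "z \<in> W \<times> UNIV" for z
    by (rule inj_derivative_inverse(3)[OF opW injT smooth_on_has_derivative[OF smT]])
      (use dinj that in blast)+
  have invT: "inv_into (W \<times> UNIV) \<Theta> (x, v) = (x, ?N v x)" if "x \<in> W" for x v
    by (rule inv_into_f_eq[OF injT]) (use that FN in \<open>auto simp: \<Theta>_def\<close>)
  have diffN: "(\<lambda>x. ?N v x) differentiable (at x)" if x: "x \<in> W" for x v
  proof -
    have "\<Theta> (x, ?N v x) = (x, v)" using FN[OF x] by (simp add: \<Theta>_def)
    then have "(inv_into (W \<times> UNIV) \<Theta> has_derivative inv (FD \<Theta> (x, ?N v x))) (at (x, v))"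
      using derT[of "(x, ?N v x)"] x by auto
    moreover have "((\<lambda>y. (y, v)) has_derivative (\<lambda>h. (h, 0))) (at x)"
      by (auto intro!: derivative_eq_intros)
    ultimately have "((\<lambda>y. snd (inv_into (W \<times> UNIV) \<Theta> (y, v))) has_derivative
        (\<lambda>h. snd (inv (FD \<Theta> (x, ?N v x)) (h, 0)))) (at x)"
      using diff_chain_at[of "\<lambda>y. (y, v)" "\<lambda>h. (h, 0)" x "inv_into (W \<times> UNIV) \<Theta>"] has_derivative_snd
      by (fastforce simp: o_def)
    then have "(\<lambda>y. snd (inv_into (W \<times> UNIV) \<Theta> (y, v))) differentiable (at x)"
      by (auto simp: differentiable_def)
    from FD_cong(1)[OF this W x] show ?thesis using invT by auto
  qed
  \<comment> \<open>The formula involves only \<open>?N\<close> at \<open>v\<close> and at basis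
    vectors, and the derivatives of the columns \<open>FD f y c\<close>; hence the induction at the
    end, run for all \<open>v\<close> at once, closes.\<close>
  have derN: "(?N v has_derivative (\<lambda>w. - (\<Sum>b\<in>Basis. \<Sum>c\<in>Basis.
      ((?N v x \<bullet> c) * (FD (\<lambda>y. FD f y c) x w \<bullet> b)) *\<^sub>R ?N b x))) (at x)" if x: "x \<in> W" for x v
  proof -
    let ?M = "FD (?N v) x" and ?S = "\<lambda>w. \<Sum>c\<in>Basis. (?N v x \<bullet> c) *\<^sub>R FD (\<lambda>y. FD f y c) x w"
    have exp: "FD f y u = (\<Sum>c\<in>Basis. (u \<bullet> c) *\<^sub>R FD f y c)" if "y \<in> W" for y u
      by (rule linear_euclidean_expansion[OF lin[OF that]])
    have d1: "((\<lambda>y. \<Sum>c\<in>Basis. (?N v y \<bullet> c) *\<^sub>R FD f y c) has_derivative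
       (\<lambda>w. \<Sum>c\<in>Basis. (?N v x \<bullet> c) *\<^sub>R FD (\<lambda>y. FD f y c) x w + (?M w \<bullet> c) *\<^sub>R FD f x c)) (at x)"
      by (intro has_derivative_sum has_derivative_scaleR has_derivative_inner_left FD_works diffN x
          smooth_on_differentiable[OF smooth_on_FD[OF f]])
    \<comment> \<open>The product \<open>FD f y (?N v y)\<close> is the constant \<open>v\<close>,
      so its derivative is 0; solving for the derivative of \<open>?N v\<close> gives the
      formula.\<close>
    have "((\<lambda>y. v) has_derivative
       (\<lambda>w. \<Sum>c\<in>Basis. (?N v x \<bullet> c) *\<^sub>R FD (\<lambda>y. FD f y c) x w + (?M w \<bullet> c) *\<^sub>R FD f x c)) (at x)"
      by (rule has_derivative_transform_within_open[OF d1 W x]) (use exp FN in metis)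
    then have "(\<lambda>w. 0) = (\<lambda>w. \<Sum>c\<in>Basis. (?N v x \<bullet> c) *\<^sub>R FD (\<lambda>y. FD f y c) x w + (?M w \<bullet> c) *\<^sub>R FD f x c)"
      using has_derivative_unique[OF has_derivative_const] by blast
    from fun_cong[OF this] have "?S w + FD f x (?M w) = 0" for w
      by (subst exp[OF x, of "?M w"]) (simp only: sum.distrib)
    then have MS: "FD f x (?M w) = - ?S w" for w
      by (simp only: add_eq_0_iff)
    have "?M w = - ?N (?S w) x" for w
    proof -
      have "?M w = ?N (FD f x (?M w)) x" by (rule NF[OF x, symmetric])
      also have "\<dots> = - ?N (?S w) x" unfolding MS by (rule linear_neg[OF linN[OF x]])
      finally show ?thesis .
    qed
    moreover have "?N (?S w) x = (\<Sum>b\<in>Basis. \<Sum>c\<in>Basis.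
      ((?N v x \<bullet> c) * (FD (\<lambda>y. FD f y c) x w \<bullet> b)) *\<^sub>R ?N b x)" for w
      by (subst linear_euclidean_expansion[OF linN[OF x]])
        (simp add: inner_sum_left scaleR_left.sum sum_distrib_right)
    ultimately show ?thesis using FD_works[OF diffN[OF x, of v]] by presburger
  qed
  show ?thesis
  proof (induction k arbitrary: v)
    case 0
    then show ?case using diffN
      by (auto intro!: continuous_at_imp_continuous_on differentiable_imp_continuous_within)
  next
    case (Suc k)
    have neg: "Ck_on k W (\<lambda>x. - g x)" if "Ck_on k W g" for g :: "'a \<Rightarrow> 'a"
      using Ck_on_bounded_linear_outer[OF bounded_linear_minus[OF bounded_linear_ident] W that] .
    have sm: "Ck_on k W (\<lambda>y. FD (\<lambda>y. FD f y c) y w)" for c w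
      using smooth_on_FD[OF smooth_on_FD[OF f]] by (auto simp: smooth_on_def)
    show ?case
      by (rule Ck_on_SucI[OF W derN])
        (auto intro!: neg Ck_on_sum W Ck_on_bilinear[OF bounded_bilinear_scaleR]
          Ck_on_bilinear[OF bounded_bilinear_mult] Suc.IH sm
          Ck_on_bounded_linear_outer[OF bounded_linear_inner_left])
  qed
qed

text \<open>Bootstrapping: the derivative of the inverse \<open>g\<close> at \<open>y\<close> is
  \<open>inv (FD f (g y))\<close>, a smooth map composed with \<open>g\<close> itself, so each order
  of differentiability of \<open>g\<close> yields the next.\<close>

lemma smooth_on_inv_into:
  fixes f :: "'a::euclidean_space \<Rightarrow> 'a"
  assumes W: "open W" and f: "smooth_on W f" and inj: "inj_on f W"
    and inj': "\<And>x v. x \<in> W \<Longrightarrow> FD f x v = 0 \<Longrightarrow> v = 0"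
  shows "open (f ` W)" "smooth_on (f ` W) (inv_into W f)"
proof -
  have der: "(inv_into W f has_derivative inv (FD f x)) (at (f x))" if "x \<in> W" for x
    by (rule inj_derivative_inverse(3)[OF W inj smooth_on_has_derivative[OF f]]) (auto intro: inj' that)
  show op: "open (f ` W)"
    using invariance_of_domain_gen[OF W smooth_on_continuous_on[OF f] inj] by simp
  have "Ck_on k (f ` W) (inv_into W f)" for k
  proof (induction k)
    case 0
    have "continuous (at y) (inv_into W f)" if "y \<in> f ` W" for y
      using der has_derivative_continuous that by blast
    then show ?case by (simp add: continuous_at_imp_continuous_on)
  next
    case (Suc k)
    show ?case
    proof (rule Ck_on_SucI[OF op])
      show "(inv_into W f has_derivative inv (FD f (inv_into W f y))) (at y)" if "y \<in> f ` W" for y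
        using der that inj by auto
      show "Ck_on k (f ` W) (\<lambda>y. inv (FD f (inv_into W f y)) v)" for v
        by (rule Ck_on_compose[OF op _ Ck_on_inv_FD[OF W f inj'] Suc.IH])
          (auto simp: inv_into_into)
    qed
  qed
  then show "smooth_on (f ` W) (inv_into W f)" by (simp add: smooth_on_def)
qed

section \<open>Bump functions\<close>

lemma power_div_fact_le_exp:
  fixes y :: real assumes "y \<ge> 0" shows "y ^ m / fact m \<le> exp y"
proof -
  have s: "(\<lambda>n. y ^ n / fact n) sums exp y"
    using exp_converges[of y] by (simp add: divide_inverse mult.commute)
  have "(\<Sum>n\<in>{m}. y ^ n / fact n) \<le> (\<Sum>n. y ^ n / fact n)"
    by (rule sum_le_suminf) (use s assms in \<open>auto simp: sums_iff\<close>)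
  then show ?thesis using s by (simp add: sums_iff)
qed

text \<open>The powers of \<open>x\<close> in the denominator make the family closed under
  differentiation up to linear combinations, so smoothness of all members follows by one induction
  over the order.\<close>

definition bump_fun :: "nat \<Rightarrow> real \<Rightarrow> real" where
  "bump_fun n x = (if x > 0 then exp (- 1 / x) / x ^ n else 0)"

text \<open>The term of degree \<open>n + 2\<close> of the series of \<open>exp (1 / x)\<close>
  absorbs the denominator \<open>x ^ n\<close> and leaves a factor \<open>x\<^sup>2\<close>, enough
  for the difference quotient at 0 to tend to 0.\<close>

lemma bump_fun_le: "\<bar>bump_fun n x\<bar> \<le> fact (n + 2) * x\<^sup>2"
proof (cases "x > 0")
  case True
  have "(1 / x) ^ (n + 2) / fact (n + 2) \<le> exp (1 / x)"
    by (rule power_div_fact_le_exp) (use True in auto)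
  then have "1 \<le> fact (n + 2) * x ^ (n + 2) * exp (1 / x)"
    using True by (simp add: field_simps del: fact_Suc power_Suc add_2_eq_Suc')
  then have "exp (- 1 / x) \<le> fact (n + 2) * x ^ (n + 2)"
    by (simp add: exp_minus field_simps del: fact_Suc power_Suc add_2_eq_Suc')
  then have "exp (- 1 / x) / x ^ n \<le> fact (n + 2) * x\<^sup>2"
    using True by (simp add: field_simps power_add power2_eq_square del: fact_Suc add_2_eq_Suc')
  then show ?thesis using True by (simp add: bump_fun_def)
qed (simp add: bump_fun_def)

lemma bump_fun_derivative:
  "(bump_fun n has_real_derivative (bump_fun (n + 2) x - n * bump_fun (n + 1) x)) (at x)"
proof -
  consider "x > 0" | "x < 0" | "x = 0" by linarith
  then show ?thesis
  proof cases
    case 1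
    have "((\<lambda>x. exp (- 1 / x) / x ^ n) has_real_derivative (bump_fun (n + 2) x - n * bump_fun (n + 1) x)) (at x)"
      using 1 by (cases n) (auto intro!: derivative_eq_intros simp: bump_fun_def field_simps power2_eq_square,
          metis One_nat_def power_eq_if)
    then show ?thesis
      by (rule has_field_derivative_transform_within_open[where S = "{0<..}"]) (use 1 in \<open>auto simp: bump_fun_def\<close>)
  next
    case 2
    have "((\<lambda>x. 0) has_real_derivative (bump_fun (n + 2) x - n * bump_fun (n + 1) x)) (at x)"
      using 2 by (simp add: bump_fun_def)
    then show ?thesis
      by (rule has_field_derivative_transform_within_open[where S = "{..<0}"]) (use 2 in \<open>auto simp: bump_fun_def\<close>)
  next
    case 3
    have "((\<lambda>h. (bump_fun n (0 + h) - bump_fun n 0) / h) \<longlongrightarrow> 0) (at 0)"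
    proof (rule Lim_null_comparison)
      have "\<bar>bump_fun n h / h\<bar> \<le> fact (n + 2) * \<bar>h\<bar>" if "h \<noteq> 0" for h
      proof -
        have "\<bar>bump_fun n h\<bar> \<le> (fact (n + 2) * \<bar>h\<bar>) * \<bar>h\<bar>"
          using bump_fun_le[of n h] by (simp only: power2_eq_square abs_mult_self_eq mult.assoc)
        then show ?thesis unfolding abs_divide by (subst pos_divide_le_eq) (use that in simp_all)
      qed
      then show "\<forall>\<^sub>F h in at 0. norm ((bump_fun n (0 + h) - bump_fun n 0) / h) \<le> fact (n + 2) * \<bar>h\<bar>"
        by (auto simp: eventually_at bump_fun_def[of n 0] intro!: exI[of _ 1])
      show "((\<lambda>h. fact (n + 2) * \<bar>h\<bar>) \<longlongrightarrow> 0) (at (0::real))"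
        by (auto intro!: tendsto_eq_intros)
    qed
    then show ?thesis using 3 by (simp add: DERIV_def bump_fun_def)
  qed
qed

lemma smooth_on_bump_fun: "smooth_on UNIV (bump_fun n)"
proof -
  have "Ck_on k UNIV (bump_fun n)" for k
  proof (induction k arbitrary: n)
    case 0
    then show ?case
      using DERIV_isCont[OF bump_fun_derivative] by (simp add: continuous_at_imp_continuous_on)
  next
    case (Suc k)
    have lin: "bounded_linear (\<lambda>t::real. c * t)" for c by (rule bounded_linear_mult_right)
    have "Ck_on k UNIV (\<lambda>x. v * bump_fun (n + 2) x + (- v * n) * bump_fun (n + 1) x)" for v
      by (intro Ck_on_add open_UNIV Ck_on_bounded_linear_outer[OF lin] Suc.IH)
    then have "Ck_on k UNIV (\<lambda>x. (bump_fun (n + 2) x - n * bump_fun (n + 1) x) * v)" for v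
      by (simp add: algebra_simps)
    then show ?case
      by (intro Ck_on_SucI[OF _ bump_fun_derivative[unfolded has_field_derivative_def]]) auto
  qed
  then show ?thesis by (simp add: smooth_on_def)
qed

text \<open>\<open>bump_fun 0\<close> is applied to the quadratic function r^2 - |x - q|^2, which is
  positive exactly inside the ball.\<close>

lemma smooth_bump:
  fixes q :: "'a::euclidean_space"
  assumes "r > 0"
  obtains \<rho> :: "'a \<Rightarrow> real" where "smooth_on UNIV \<rho>" "\<rho> q > 0" "\<And>x. x \<notin> ball q r \<Longrightarrow> \<rho> x = 0"
proof
  let ?\<rho> = "\<lambda>x. bump_fun 0 (r\<^sup>2 + (- 1) *\<^sub>R ((- q + x) \<bullet> (- q + x)))"
  have 1: "smooth_on UNIV (\<lambda>x. - q + x)"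
    by (intro smooth_on_add smooth_on_const smooth_on_id) auto
  show "smooth_on UNIV ?\<rho>"
    by (intro smooth_on_compose[OF smooth_on_bump_fun] smooth_on_add smooth_on_const
        smooth_on_bilinear[OF bounded_bilinear_scaleR] smooth_on_bilinear[OF bounded_bilinear_inner] 1) auto
  show "?\<rho> q > 0" using assms by (simp add: bump_fun_def)
  show "?\<rho> x = 0" if "x \<notin> ball q r" for x
  proof -
    have "r \<le> norm (- q + x)" using that by (simp add: dist_norm norm_minus_commute)
    then have "r\<^sup>2 \<le> (norm (- q + x))\<^sup>2" using assms by (intro power_mono) auto
    then show ?thesis by (simp add: bump_fun_def power2_norm_eq_inner)
  qed
qed

section \<open>Atlases and tangent bundles\<close>

lemma cinv_cmap_inj: "inj_on (cmap M i) (cdom M i) \<Longrightarrow> p \<in> cdom M i \<Longrightarrow> cinv M i (cmap M i p) = p"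
  unfolding cinv_def by (rule inv_into_f_f)

text \<open>The chart conditions of \<open>smooth_manifold\<close> alone. Tangent bundles, slit
  bundles and intervals inherit them by chart computations; the Hausdorff property enters
  separately, when fields are extended by zero.\<close>

locale smooth_atlas =
  fixes M :: "('a, 'i, 'e::real_normed_vector) atlas"
  assumes inj: "inj_on (cmap M i) (cdom M i)"
    and open_overlap: "open (cmap M i ` (cdom M i \<inter> cdom M j))"
    and smooth_overlap: "smooth_on (cmap M i ` (cdom M i \<inter> cdom M j)) (cmap M j \<circ> cinv M i)"

lemma smooth_manifold_atlas: "smooth_manifold M \<Longrightarrow> smooth_atlas M"
  unfolding smooth_manifold_def smooth_atlas_def by auto

context smooth_atlas
begin

abbreviation tr :: "'i \<Rightarrow> 'i \<Rightarrow> 'e \<Rightarrow> 'e" where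
  "tr i j \<equiv> cmap M j \<circ> cinv M i"

lemma open_chart: "open (cmap M i ` cdom M i)"
  using open_overlap[of i i] by simp

lemma cinv_cmap [simp]: "p \<in> cdom M i \<Longrightarrow> cinv M i (cmap M i p) = p"
  using cinv_cmap_inj inj .

lemma cmap_cinv: "x \<in> cmap M i ` cdom M i \<Longrightarrow> cmap M i (cinv M i x) = x"
  by auto

lemma cinv_in: "x \<in> cmap M i ` cdom M i \<Longrightarrow> cinv M i x \<in> cdom M i"
  by auto

lemma cmap_image_Int:
  "cmap M i ` (cdom M i \<inter> (A \<inter> B)) = cmap M i ` (cdom M i \<inter> A) \<inter> cmap M i ` (cdom M i \<inter> B)"
  using inj[of i] unfolding inj_on_def by blast

lemma has_derivative_tr:
  "p \<in> cdom M i \<Longrightarrow> p \<in> cdom M j \<Longrightarrow> (tr i j has_derivative FD (tr i j) (cmap M i p)) (at (cmap M i p))"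
  using smooth_on_has_derivative[OF smooth_overlap[of i j]] by blast

text \<open>The cocycle identity of the transition maps, by the chain rule. Through it a single
  component determines a tangent vector.\<close>

lemma FD_tr_tr:
  assumes "p \<in> cdom M i" "p \<in> cdom M j" "p \<in> cdom M k"
  shows "FD (tr j k) (cmap M j p) (FD (tr i j) (cmap M i p) v) = FD (tr i k) (cmap M i p) v"
proof -
  have "(tr j k has_derivative FD (tr j k) (cmap M j p)) (at (tr i j (cmap M i p)))"
    using has_derivative_tr[OF assms(2,3)] assms(1) by simp
  from diff_chain_at[OF has_derivative_tr[OF assms(1,2)] this]
  have "(tr i k has_derivative FD (tr j k) (cmap M j p) \<circ> FD (tr i j) (cmap M i p)) (at (cmap M i p))"
    by (rule has_derivative_transform_within_open[OF _ open_overlap[of i j]]) (use assms in auto)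
  from FD_eq[OF this] show ?thesis by simp
qed

lemma FD_tr_refl:
  assumes "p \<in> cdom M i" shows "FD (tr i i) (cmap M i p) v = v"
proof -
  have "(tr i i has_derivative (\<lambda>v. v)) (at (cmap M i p))"
    by (rule has_derivative_transform_within_open[OF has_derivative_ident open_chart[of i]]) (use assms in auto)
  from FD_eq[OF this] show ?thesis by simp
qed

text \<open>For \<open>p\<close> in chart \<open>i\<close> this inverts the evaluation of tangent
  vectors at \<open>i\<close>, and so identifies \<open>tangent_space M p\<close> with the model
  space.\<close>

definition tvec :: "'i \<Rightarrow> 'a \<Rightarrow> 'e \<Rightarrow> 'i \<Rightarrow> 'e" where
  "tvec i p x = (\<lambda>k. if p \<in> cdom M k then FD (tr i k) (cmap M i p) x else 0)"

lemma tvec_self: "p \<in> cdom M i \<Longrightarrow> tvec i p x i = x"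
  by (simp add: tvec_def FD_tr_refl del: o_apply)

lemma tvec_in: "p \<in> cdom M i \<Longrightarrow> tvec i p x \<in> tangent_space M p"
  by (auto simp: tangent_space_def tvec_def FD_tr_tr)

lemma tangent_tr:
  "v \<in> tangent_space M p \<Longrightarrow> p \<in> cdom M i \<Longrightarrow> p \<in> cdom M j \<Longrightarrow> FD (tr i j) (cmap M i p) (v i) = v j"
  unfolding tangent_space_def mem_Collect_eq by (metis IntI)

lemma tangent_eq_tvec: "v \<in> tangent_space M p \<Longrightarrow> p \<in> cdom M i \<Longrightarrow> v = tvec i p (v i)"
proof (rule ext)
  fix k assume *: "v \<in> tangent_space M p" "p \<in> cdom M i"
  then have "p \<notin> cdom M k \<Longrightarrow> v k = 0" unfolding tangent_space_def by blast
  then show "v k = tvec i p (v i) k"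
    using tangent_tr[OF *, of k] unfolding tvec_def by presburger
qed

lemma tangent_eqI:
  "v \<in> tangent_space M p \<Longrightarrow> w \<in> tangent_space M p \<Longrightarrow> p \<in> cdom M i \<Longrightarrow> v i = w i \<Longrightarrow> v = w"
  using tangent_eq_tvec by metis

lemma linear_FD_tr: "p \<in> cdom M i \<Longrightarrow> p \<in> cdom M j \<Longrightarrow> linear (FD (tr i j) (cmap M i p))"
  using has_derivative_tr has_derivative_linear by blast

lemma zero_in_tangent: "(\<lambda>i. 0) \<in> tangent_space M p"
  using linear_0[OF linear_FD_tr] by (auto simp: tangent_space_def)

lemma scaleR_in_tangent: "v \<in> tangent_space M p \<Longrightarrow> (\<lambda>i. t *\<^sub>R v i) \<in> tangent_space M p"
  using linear_cmul[OF linear_FD_tr] by (auto simp: tangent_space_def)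

lemma tvec_zero: "p \<in> cdom M i \<Longrightarrow> tvec i p 0 = (\<lambda>k. 0)"
  by (rule tangent_eqI[of _ p _ i]) (auto simp: tvec_in zero_in_tangent tvec_self)

lemma tvec_scaleR: "p \<in> cdom M i \<Longrightarrow> tvec i p (t *\<^sub>R x) = (\<lambda>k. t *\<^sub>R tvec i p x k)"
  by (rule tangent_eqI[of _ p _ i]) (auto simp: tvec_in scaleR_in_tangent tvec_self)

lemma tangent_zero_iff: "v \<in> tangent_space M p \<Longrightarrow> p \<in> cdom M i \<Longrightarrow> v = (\<lambda>i. 0) \<longleftrightarrow> v i = 0"
  using tangent_eqI[OF _ zero_in_tangent] by auto

end

lemma cdom_TB: "cdom (TB M) i = {u. fst u \<in> cdom M i \<and> snd u \<in> tangent_space M (fst u)}"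
  by (auto simp: TB_def)

lemma cmap_TB: "cmap (TB M) i u = (cmap M i (fst u), snd u i)"
  by (auto simp: TB_def split: prod.split)

lemma points_TB: "points (TB M) = {u. fst u \<in> points M \<and> snd u \<in> tangent_space M (fst u)}"
  by (auto simp: points_def cdom_TB)

lemma cdom_sub: "cdom (sub_atlas M W) i = cdom M i \<inter> W"
  and cmap_sub: "cmap (sub_atlas M W) i = cmap M i"
  by (auto simp: sub_atlas_def)

lemma points_sub: "points (sub_atlas M W) = points M \<inter> W"
  by (auto simp: points_def cdom_sub)

lemma cdom_slit_TB: "cdom (slit_TB M) i = {u\<in>cdom (TB M) i. u \<noteq> tzero (fst u)}"
  and cmap_slit_TB: "cmap (slit_TB M) i = cmap (TB M) i"
  by (auto simp: slit_TB_def cdom_sub cmap_sub)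

lemma points_slit_TB: "points (slit_TB M) = {u\<in>points (TB M). u \<noteq> tzero (fst u)}"
  by (auto simp: points_def cdom_slit_TB)

lemma eq_tzero_iff: "u = tzero (fst u) \<longleftrightarrow> snd u = (\<lambda>i. 0)"
  by (auto simp: tzero_def prod_eq_iff)

context smooth_atlas
begin

lemma inj_TB: "inj_on (cmap (TB M) i) (cdom (TB M) i)"
proof (rule inj_onI)
  fix u v assume *: "u \<in> cdom (TB M) i" "v \<in> cdom (TB M) i" "cmap (TB M) i u = cmap (TB M) i v"
  then have "fst u = fst v" using inj[of i] by (auto simp: cdom_TB cmap_TB inj_on_def)
  moreover from this have "snd u = snd v"
    using * by (intro tangent_eqI[of _ "fst u" _ i]) (auto simp: cdom_TB cmap_TB)
  ultimately show "u = v" by (simp add: prod_eq_iff)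
qed

lemma cmap_TB_image:
  "cmap (TB M) i ` (cdom (TB M) i \<inter> {u. fst u \<in> A}) = cmap M i ` (cdom M i \<inter> A) \<times> UNIV"
proof (intro equalityI subsetI)
  fix z assume "z \<in> cmap M i ` (cdom M i \<inter> A) \<times> (UNIV::'e set)"
  then obtain p x where p: "p \<in> cdom M i" "p \<in> A" "z = (cmap M i p, x)" by auto
  then have "z = cmap (TB M) i (p, tvec i p x)" by (simp add: cmap_TB tvec_self)
  then show "z \<in> cmap (TB M) i ` (cdom (TB M) i \<inter> {u. fst u \<in> A})"
    using p tvec_in by (auto simp: cdom_TB)
qed (auto simp: cdom_TB cmap_TB)

lemma cmap_TB_chart: "cmap (TB M) i ` cdom (TB M) i = cmap M i ` cdom M i \<times> UNIV"
  using cmap_TB_image[of i UNIV] by simp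

lemma TB_overlap: "cdom (TB M) i \<inter> cdom (TB M) j = cdom (TB M) i \<inter> {u. fst u \<in> cdom M j}"
  by (auto simp: cdom_TB)

lemma cinv_TB:
  assumes "q \<in> cmap M i ` cdom M i"
  shows "cinv (TB M) i (q, x) = (cinv M i q, tvec i (cinv M i q) x)"
proof -
  have "(q, x) = cmap (TB M) i (cinv M i q, tvec i (cinv M i q) x)"
    using assms by (auto simp: cmap_TB tvec_self)
  moreover have "(cinv M i q, tvec i (cinv M i q) x) \<in> cdom (TB M) i"
    using assms tvec_in by (auto simp: cdom_TB)
  ultimately show ?thesis using cinv_cmap_inj[OF inj_TB] by metis
qed

lemma tr_TB:
  assumes "q \<in> cmap M i ` (cdom M i \<inter> cdom M j)"
  shows "cmap (TB M) j (cinv (TB M) i (q, x)) = (tr i j q, FD (tr i j) q x)"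
  using assms by (subst cinv_TB) (auto simp: cmap_TB tvec_def)

text \<open>The inverse chart of the restricted atlas is an \<open>inv_into\<close> on a smaller
  set, so it agrees with the old one only on the image of that set; derivatives can still be
  compared because this image is open.\<close>

lemma smooth_atlas_sub:
  assumes W: "\<And>i. open (cmap M i ` (cdom M i \<inter> W))"
  shows "smooth_atlas (sub_atlas M W)"
    and "x \<in> cmap M i ` (cdom M i \<inter> W) \<Longrightarrow> cinv (sub_atlas M W) i x = cinv M i x"
proof -
  have injW: "inj_on (cmap (sub_atlas M W) i) (cdom (sub_atlas M W) i)" for i
    using inj[of i] by (auto simp: cdom_sub cmap_sub inj_on_def)
  show cinv: "cinv (sub_atlas M W) i x = cinv M i x" if "x \<in> cmap M i ` (cdom M i \<inter> W)" for i x
    using that cinv_cmap_inj[OF injW[of i]] by (auto simp: cdom_sub cmap_sub)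
  have eq: "cmap M i ` (cdom M i \<inter> W \<inter> (cdom M j \<inter> W)) =
      cmap M i ` (cdom M i \<inter> cdom M j) \<inter> cmap M i ` (cdom M i \<inter> W)" for i j
    using cmap_image_Int[of i "cdom M j" W] by (metis inf.assoc inf.commute inf.right_idem)
  have op: "open (cmap M i ` (cdom M i \<inter> W \<inter> (cdom M j \<inter> W)))" for i j
    unfolding eq by (intro open_Int open_overlap W)
  show "smooth_atlas (sub_atlas M W)"
  proof
    fix i j
    show "smooth_on (cmap (sub_atlas M W) i ` (cdom (sub_atlas M W) i \<inter> cdom (sub_atlas M W) j))
        (cmap (sub_atlas M W) j \<circ> cinv (sub_atlas M W) i)"
      unfolding cdom_sub cmap_sub
      by (rule smooth_on_cong[OF smooth_on_subset[OF smooth_overlap[of i j]] op]) (use cinv in auto)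
  qed (use op injW in \<open>auto simp: cdom_sub cmap_sub\<close>)
qed

end

lemma (in smooth_atlas) smooth_map_differentiable:
  assumes "smooth_map M N f" "p \<in> cdom M i" "f p \<in> cdom N j"
  shows "(cmap N j \<circ> f \<circ> cinv M i) differentiable (at (cmap M i p))"
  using assms unfolding smooth_map_def by (blast intro: smooth_on_differentiable)

text \<open>Frees \<open>tderiv\<close> from its arbitrarily chosen chart: by the chain rule,
  differentiability in chart \<open>i\<close> passes to the chosen chart, and the components of
  \<open>v\<close> transform accordingly.\<close>

lemma (in smooth_atlas) tderiv_chart:
  assumes p: "p \<in> cdom M i" and v: "v \<in> tangent_space M p"
    and f: "(f \<circ> cinv M i) differentiable (at (cmap M i p))"
  shows "tderiv M (p, v) f = FD (f \<circ> cinv M i) (cmap M i p) (v i)"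
proof -
  define j where "j = (SOME i. p \<in> cdom M i)"
  have j: "p \<in> cdom M j" using p unfolding j_def by (rule someI)
  have "(f \<circ> cinv M i has_derivative FD (f \<circ> cinv M i) (cmap M i p)) (at (tr j i (cmap M j p)))"
    using FD_works[OF f] j by simp
  from diff_chain_at[OF has_derivative_tr[OF j p] this]
  have "(f \<circ> cinv M j has_derivative FD (f \<circ> cinv M i) (cmap M i p) \<circ> FD (tr j i) (cmap M j p)) (at (cmap M j p))"
    by (rule has_derivative_transform_within_open[OF _ open_overlap[of j i]]) (use j p in auto)
  from FD_eq[OF this] show ?thesis
    using tangent_tr[OF v j p] by (simp add: tderiv_def del: o_apply flip: j_def) simp
qed

lemma (in smooth_atlas) tangent_map_chart:
  assumes f: "smooth_map M N f" and p: "p \<in> cdom M i" and v: "v \<in> tangent_space M p"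
  shows "tangent_map M N f (p, v) =
    (f p, \<lambda>j. if f p \<in> cdom N j then FD (cmap N j \<circ> f \<circ> cinv M i) (cmap M i p) (v i) else 0)"
proof -
  define k where "k = (SOME i. p \<in> cdom M i)"
  have k: "p \<in> cdom M k" using p unfolding k_def by (rule someI)
  have "FD (cmap N j \<circ> f \<circ> cinv M k) (cmap M k p) (v k) = FD (cmap N j \<circ> f \<circ> cinv M i) (cmap M i p) (v i)"
    if j: "f p \<in> cdom N j" for j
  proof -
    have "(cmap N j \<circ> f \<circ> cinv M i has_derivative FD (cmap N j \<circ> f \<circ> cinv M i) (cmap M i p)) (at (tr k i (cmap M k p)))"
      using FD_works[OF smooth_map_differentiable[OF f p j]] k by simp
    from diff_chain_at[OF has_derivative_tr[OF k p] this]
    have "(cmap N j \<circ> f \<circ> cinv M k has_derivative FD (cmap N j \<circ> f \<circ> cinv M i) (cmap M i p) \<circ> FD (tr k i) (cmap M k p)) (at (cmap M k p))"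
      by (rule has_derivative_transform_within_open[OF _ open_overlap[of k i]]) (use k p in auto)
    from FD_eq[OF this] show ?thesis using tangent_tr[OF v k p] by simp
  qed
  then show ?thesis by (auto simp: tangent_map_def simp flip: k_def)
qed

text \<open>By the chain rule the components of the image in two charts of \<open>N\<close> differ
  by the derivative of the transition map, as the definition of a tangent vector demands.\<close>

lemma (in smooth_atlas) tangent_map_in_TB:
  assumes N: "smooth_atlas N" and f: "smooth_map M N f" and u: "u \<in> points (TB M)"
  shows "tangent_map M N f u \<in> points (TB N)"
proof -
  interpret N: smooth_atlas N by (rule N)
  obtain p v i where [simp]: "u = (p, v)" and p: "p \<in> cdom M i" and v: "v \<in> tangent_space M p"
    using u by (cases u) (auto simp: points_def cdom_TB)
  have "FD (cmap N k \<circ> f \<circ> cinv M i) (cmap M i p) (v i) =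
      FD (N.tr j k) (cmap N j (f p)) (FD (cmap N j \<circ> f \<circ> cinv M i) (cmap M i p) (v i))"
    if j: "f p \<in> cdom N j" and k: "f p \<in> cdom N k" for j k
  proof -
    have "(N.tr j k has_derivative FD (N.tr j k) (cmap N j (f p)))
        (at ((cmap N j \<circ> f \<circ> cinv M i) (cmap M i p)))"
      using N.has_derivative_tr[OF j k] p by simp
    from diff_chain_at[OF FD_works[OF smooth_map_differentiable[OF f p j]] this]
    have "(cmap N k \<circ> f \<circ> cinv M i has_derivative
        FD (N.tr j k) (cmap N j (f p)) \<circ> FD (cmap N j \<circ> f \<circ> cinv M i) (cmap M i p)) (at (cmap M i p))"
    proof (rule has_derivative_transform_within_open)
      show "open (cmap M i ` (cdom M i \<inter> f -` cdom N j))"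
        using f unfolding smooth_map_def by blast
    qed (use p j in auto)
    from FD_eq[OF this] show ?thesis by simp
  qed
  moreover have "f p \<in> points N" using f p unfolding smooth_map_def points_def by blast
  ultimately show ?thesis
    using tangent_map_chart[OF f p v] by (auto simp: points_TB tangent_space_def)
qed

lemma smooth_atlas_TB:
  fixes M :: "('a, 'i, 'e::euclidean_space) atlas"
  assumes "smooth_atlas M" shows "smooth_atlas (TB M)"
proof -
  interpret smooth_atlas M by (rule assms)
  have im: "cmap (TB M) i ` (cdom (TB M) i \<inter> cdom (TB M) j) = cmap M i ` (cdom M i \<inter> cdom M j) \<times> UNIV" for i j
    unfolding TB_overlap by (rule cmap_TB_image)
  have op: "open (cmap M i ` (cdom M i \<inter> cdom M j) \<times> (UNIV::'e set))" for i j
    by (intro open_Times open_overlap open_UNIV)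
  show ?thesis
  proof
    fix i j
    show "inj_on (cmap (TB M) i) (cdom (TB M) i)" by (rule inj_TB)
    show "open (cmap (TB M) i ` (cdom (TB M) i \<inter> cdom (TB M) j))" unfolding im by (rule op)
    have "smooth_on (cmap M i ` (cdom M i \<inter> cdom M j) \<times> (UNIV::'e set))
        (\<lambda>z. (tr i j (fst z), FD (tr i j) (fst z) (snd z)))"
      by (intro smooth_on_Pair op smooth_on_compose[OF smooth_overlap[of i j]]
          smooth_on_FD_compose[OF smooth_overlap[of i j]] smooth_on_fst smooth_on_snd smooth_on_id) auto
    then show "smooth_on (cmap (TB M) i ` (cdom (TB M) i \<inter> cdom (TB M) j)) (cmap (TB M) j \<circ> cinv (TB M) i)"
      unfolding im by (rule smooth_on_cong[OF _ op]) (auto simp: tr_TB)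
  qed
qed

text \<open>A tangent vector is zero as soon as its component in one chart around the base point is,
  so every chart sees the zero section as the same linear condition.\<close>

lemma (in smooth_atlas) slit_TB_image:
  "cmap (TB M) i ` (cdom (TB M) i \<inter> {u. u \<noteq> tzero (fst u)}) = cmap M i ` cdom M i \<times> (- {0})"
proof -
  have *: "u \<noteq> tzero (fst u) \<longleftrightarrow> snd (cmap (TB M) i u) \<noteq> 0" if "u \<in> cdom (TB M) i" for u
    using that tangent_zero_iff[of "snd u" "fst u" i] unfolding eq_tzero_iff by (auto simp: cdom_TB cmap_TB)
  have "cmap (TB M) i ` (cdom (TB M) i \<inter> {u. u \<noteq> tzero (fst u)}) =
     cmap (TB M) i ` cdom (TB M) i \<inter> UNIV \<times> (- {0})"
    using * by (auto simp: cmap_TB)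
  then show ?thesis unfolding cmap_TB_chart by auto
qed

lemma smooth_atlas_slit_TB:
  fixes M :: "('a, 'i, 'e::euclidean_space) atlas"
  assumes "smooth_atlas M" shows "smooth_atlas (slit_TB M)"
    and "q \<in> cmap M i ` cdom M i \<Longrightarrow> x \<noteq> 0 \<Longrightarrow> cinv (slit_TB M) i (q, x) = cinv (TB M) i (q, x)"
proof -
  interpret smooth_atlas M by (rule assms)
  interpret TB: smooth_atlas "TB M" using assms by (rule smooth_atlas_TB)
  have "open (cmap (TB M) i ` (cdom (TB M) i \<inter> {u. u \<noteq> tzero (fst u)}))" for i
    unfolding slit_TB_image by (intro open_Times open_chart) auto
  note s = TB.smooth_atlas_sub[OF this]
  from s(1) show "smooth_atlas (slit_TB M)" unfolding slit_TB_def .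
  show "q \<in> cmap M i ` cdom M i \<Longrightarrow> x \<noteq> 0 \<Longrightarrow> cinv (slit_TB M) i (q, x) = cinv (TB M) i (q, x)"
    unfolding slit_TB_def by (rule s(2)) (simp add: slit_TB_image)
qed

text \<open>The transition maps of the target take care of its other charts.\<close>

lemma smooth_mapI_local:
  fixes N :: "('b, 'j, 'd::euclidean_space) atlas"
  assumes N: "smooth_atlas N"
    and into: "f ` points X \<subseteq> points N"
    and loc: "\<And>a x. x \<in> cdom X a \<Longrightarrow> \<exists>i V. open V \<and> cmap X a x \<in> V \<and>
      V \<subseteq> cmap X a ` (cdom X a \<inter> f -` cdom N i) \<and> smooth_on V (cmap N i \<circ> f \<circ> cinv X a)"
    and injX: "\<And>a. inj_on (cmap X a) (cdom X a)"
  shows "smooth_map X N f"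
  unfolding smooth_map_def
proof (intro conjI allI into)
  interpret N: smooth_atlas N by (rule N)
  fix a j
  let ?D = "cmap X a ` (cdom X a \<inter> f -` cdom N j)"
  have key: "\<exists>V. open V \<and> y \<in> V \<and> V \<subseteq> ?D \<and> smooth_on V (cmap N j \<circ> f \<circ> cinv X a)" if y: "y \<in> ?D" for y
  proof -
    obtain x where x: "x \<in> cdom X a" "f x \<in> cdom N j" "y = cmap X a x" using y by auto
    obtain i V where V: "open V" "y \<in> V" "V \<subseteq> cmap X a ` (cdom X a \<inter> f -` cdom N i)"
      "smooth_on V (cmap N i \<circ> f \<circ> cinv X a)" using loc[OF x(1)] x(3) by blast
    let ?g = "cmap N i \<circ> f \<circ> cinv X a"
    let ?V = "V \<inter> ?g -` (cmap N i ` (cdom N i \<inter> cdom N j))"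
    have op: "open ?V"
      using continuous_open_preimage[OF smooth_on_continuous_on[OF V(4)] V(1) N.open_overlap] .
    have memV: "\<exists>x'. x' \<in> cdom X a \<and> f x' \<in> cdom N i \<and> f x' \<in> cdom N j \<and> z = cmap X a x'" if z: "z \<in> ?V" for z
    proof -
      obtain x' where x': "x' \<in> cdom X a" "f x' \<in> cdom N i" "z = cmap X a x'" using z V(3) by auto
      obtain n where n: "n \<in> cdom N i" "n \<in> cdom N j" "cmap N i (f x') = cmap N i n"
        using z x' cinv_cmap_inj[OF injX x'(1)] by auto
      then have "f x' = n" using x' N.inj[of i] by (auto simp: inj_on_def)
      then show ?thesis using x' n by blast
    qed
    have "smooth_on ?V (\<lambda>z. N.tr i j (?g z))"
      by (rule smooth_on_compose[OF N.smooth_overlap op _ smooth_on_subset[OF V(4)]]) auto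
    then have "smooth_on ?V (cmap N j \<circ> f \<circ> cinv X a)"
    proof (rule smooth_on_cong[OF _ op])
      fix z assume "z \<in> ?V"
      then obtain x' where "x' \<in> cdom X a" "f x' \<in> cdom N i" "z = cmap X a x'" using memV by blast
      then show "N.tr i j (?g z) = (cmap N j \<circ> f \<circ> cinv X a) z" using cinv_cmap_inj[OF injX] by simp
    qed
    moreover have "y \<in> ?V" "?V \<subseteq> ?D"
    proof -
      have "f x \<in> cdom N i"
      proof -
        obtain x' where "x' \<in> cdom X a" "f x' \<in> cdom N i" "cmap X a x = cmap X a x'" using V(2,3) x(3) by auto
        then show ?thesis using injX[of a] x(1) by (auto simp: inj_on_def)
      qed
      then show "y \<in> ?V" using V(2) x cinv_cmap_inj[OF injX x(1)] by auto
      show "?V \<subseteq> ?D" using memV by blast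
    qed
    ultimately show ?thesis using op by blast
  qed
  show "open ?D" using key by (subst open_subopen) blast
  show "smooth_on ?D (cmap N j \<circ> f \<circ> cinv X a)" using key by (intro smooth_on_local) blast
qed

section \<open>Critical points along the fibres of a submersion, in coordinates\<close>

locale slit_function =
  fixes U :: "'e::euclidean_space set" and E :: "'e \<times> 'e \<Rightarrow> real"
  assumes smooth_E: "smooth_on (U \<times> - {0}) E"
begin

lemma has_derivative_E: "q \<in> U \<Longrightarrow> u \<noteq> 0 \<Longrightarrow> (E has_derivative FD E (q, u)) (at (q, u))"
  using smooth_on_has_derivative[OF smooth_E] by auto

lemma linear_E:
  assumes "q \<in> U" "u \<noteq> 0" shows "linear (\<lambda>y. FD E (q, u) (0, y))"
proof -
  have "linear (\<lambda>y::'e. (0::'e, y))" by (simp add: linear_iff)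
  from linear_compose[OF this has_derivative_linear[OF has_derivative_E[OF assms]]]
  show ?thesis by (simp add: o_def)
qed

lemma smooth_grad:
  assumes "open V" "smooth_on V f" "\<And>z. z \<in> V \<Longrightarrow> f z \<in> U \<times> - {0}" "smooth_on V w"
  shows "smooth_on V (\<lambda>z. FD E (f z) (0, w z))"
  using assms by (intro smooth_on_FD_compose[OF smooth_E] smooth_on_Pair smooth_on_const) auto

lemma has_derivative_grad:
  assumes "q \<in> U" "u \<noteq> 0"
  shows "((\<lambda>v. FD E (q, v) (0, y)) has_derivative FD (\<lambda>v. FD E (q, v) (0, y)) u) (at u)"
  by (rule smooth_on_has_derivative[OF smooth_grad[where V = "- {0}"]])
    (use assms in \<open>auto intro!: smooth_on_Pair smooth_on_const smooth_on_id\<close>)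

text \<open>Linearity in \<open>b\<close> is built into the derivative; linearity in the other
  argument comes from differentiating the basis expansion of the inner derivative. It turns the
  Hessian into a linear form to which \<open>rep\<close> applies.\<close>

lemma linear_hess:
  assumes q: "q \<in> U" and u: "u \<noteq> 0"
  shows "linear (\<lambda>y. FD (\<lambda>v. FD E (q, v) (0, y)) u b)"
proof -
  have exp: "FD E (q, v) (0, y) = (\<Sum>c\<in>Basis. (y \<bullet> c) *\<^sub>R FD E (q, v) (0, c))" if "v \<noteq> 0" for v y
    using linear_euclidean_expansion[OF linear_E[OF q that]] .
  have "FD (\<lambda>v. FD E (q, v) (0, y)) u = (\<lambda>b. \<Sum>c\<in>Basis. (y \<bullet> c) *\<^sub>R FD (\<lambda>v. FD E (q, v) (0, c)) u b)" for y
  proof (rule FD_eq)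
    have "((\<lambda>v. \<Sum>c\<in>Basis. (y \<bullet> c) *\<^sub>R FD E (q, v) (0, c)) has_derivative
       (\<lambda>b. \<Sum>c\<in>Basis. (y \<bullet> c) *\<^sub>R FD (\<lambda>v. FD E (q, v) (0, c)) u b)) (at u)"
      by (intro has_derivative_sum has_derivative_scaleR_right has_derivative_grad q u)
    then show "((\<lambda>v. FD E (q, v) (0, y)) has_derivative
       (\<lambda>b. \<Sum>c\<in>Basis. (y \<bullet> c) *\<^sub>R FD (\<lambda>v. FD E (q, v) (0, c)) u b)) (at u)"
      by (rule has_derivative_transform_within_open[where s = "- {0}"]) (use u exp in auto)
  qed
  then have "(\<lambda>y. FD (\<lambda>v. FD E (q, v) (0, y)) u b) =
      (\<lambda>y. \<Sum>c\<in>Basis. (y \<bullet> c) *\<^sub>R FD (\<lambda>v. FD E (q, v) (0, c)) u b)"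
    by (intro ext) (rule fun_cong)
  moreover have "linear (\<lambda>y. \<Sum>c\<in>Basis. (y \<bullet> c) *\<^sub>R k c)" for k :: "'e \<Rightarrow> real"
    by (simp add: linear_iff inner_add_left distrib_right sum.distrib sum_distrib_left mult.assoc)
  ultimately show ?thesis by (simp only:)
qed

end

text \<open>Here \<open>A\<close> is a coordinate change with inverse \<open>B\<close> after which the submersion becomes the linear
  map \<open>R\<close>, with right inverse \<open>J\<close>, and \<open>E\<close> is a fibrewise strongly convex function on the slit tangent
  bundle. The map \<open>\<Phi>\<close> is a coordinate change under which the set of critical points of \<open>E\<close> along the
  vertical directions becomes the set of pairs \<open>(q, J v)\<close>.\<close>

locale fibre_critical = slit_function U E
  for U :: "'e::euclidean_space set" and E :: "'e \<times> 'e \<Rightarrow> real" +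
  fixes A B :: "'e \<Rightarrow> 'e"
    and R :: "'e \<Rightarrow> 'd::real_normed_vector" and J :: "'d \<Rightarrow> 'e"
  assumes open_U: "open U" and smooth_A: "smooth_on U A"
    and open_AU: "open (A ` U)" and smooth_B: "smooth_on (A ` U) B"
    and BA: "x \<in> U \<Longrightarrow> B (A x) = x"
    and R: "bounded_linear R" and J: "bounded_linear J" and RJ: "R (J v) = v"
    and convex_E: "q \<in> U \<Longrightarrow> u \<noteq> 0 \<Longrightarrow> w \<noteq> 0 \<Longrightarrow> FD (\<lambda>y. FD E (q, y) (0, w)) u w > 0"
begin

text \<open>The constant field \<open>a\<close>, transported by the coordinate change
  \<open>B\<close>. For \<open>R a = 0\<close> these fields are vertical, and at each point of
  \<open>U\<close> they exhaust the vertical vectors.\<close>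

definition vert :: "'e \<Rightarrow> 'e \<Rightarrow> 'e" where "vert a q = FD B (A q) a"

definition crit :: "'e \<Rightarrow> 'e \<Rightarrow> bool" where
  "crit q u \<longleftrightarrow> (\<forall>y. R (FD A q y) = 0 \<longrightarrow> FD E (q, u) (0, y) = 0)"

text \<open>Projection onto the kernel of \<open>R\<close> along the range of \<open>J\<close>; in
  general it is not orthogonal.\<close>

definition proj :: "'e \<Rightarrow> 'e" where "proj a = a - J (R a)"

text \<open>For linear \<open>l\<close>, the gradient of the form
  \<open>a \<mapsto> l (vert (proj a) q)\<close> with respect to the inner product: it records
  \<open>l\<close> on vertical vectors only.\<close>

definition rep :: "('e \<Rightarrow> real) \<Rightarrow> 'e \<Rightarrow> 'e" where
  "rep l q = (\<Sum>b\<in>Basis. l (vert (proj b) q) *\<^sub>R b)"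

text \<open>A non-zero projection is a stronger demand than \<open>u \<noteq> 0\<close>: lines in
  vertical directions then avoid the zero vector altogether, where \<open>E\<close> may fail to be
  smooth.\<close>

definition Dom :: "('e \<times> 'e) set" where "Dom = {(q, u). q \<in> U \<and> R (FD A q u) \<noteq> 0}"

definition \<Phi> :: "'e \<times> 'e \<Rightarrow> 'e \<times> 'e" where
  "\<Phi> z = (fst z, J (R (FD A (fst z) (snd z))) + proj (rep (\<lambda>y. FD E z (0, y)) (fst z)))"

lemma linear_R: "linear R" and linear_J: "linear J"
  using R J bounded_linear.linear by auto

lemma bl_proj: "bounded_linear proj"
  unfolding proj_def by (intro bounded_linear_sub bounded_linear_ident bounded_linear_compose[OF J R])

lemma linear_proj: "linear proj"
  using bl_proj by (rule bounded_linear.linear)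

lemma R_proj: "R (proj a) = 0"
  by (simp add: proj_def linear_diff[OF linear_R] RJ)

lemma proj_J: "proj (J v) = 0"
  by (simp add: proj_def RJ)

lemma proj_ker: "R a = 0 \<Longrightarrow> proj a = a"
  by (simp add: proj_def linear_0[OF linear_J])

lemma has_derivative_A: "q \<in> U \<Longrightarrow> (A has_derivative FD A q) (at q)"
  using smooth_on_has_derivative[OF smooth_A] .

lemma has_derivative_B: "q \<in> U \<Longrightarrow> (B has_derivative FD B (A q)) (at (A q))"
  using smooth_on_has_derivative[OF smooth_B] by blast

lemma linear_A: "q \<in> U \<Longrightarrow> linear (FD A q)"
  using has_derivative_linear has_derivative_A by blast

lemma linear_RA: "q \<in> U \<Longrightarrow> linear (\<lambda>u. R (FD A q u))"
  using linear_compose[OF linear_A linear_R] by (simp add: o_def)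

lemma linear_vert: "q \<in> U \<Longrightarrow> linear (\<lambda>a. vert a q)"
  using has_derivative_linear[OF has_derivative_B] by (simp add: vert_def)

lemma vert_A:
  assumes "q \<in> U" shows "vert (FD A q y) q = y"
proof -
  have "(B \<circ> A has_derivative FD B (A q) \<circ> FD A q) (at q)"
    by (rule diff_chain_at[OF has_derivative_A has_derivative_B]) (rule assms)+
  moreover have "(B \<circ> A has_derivative (\<lambda>y. y)) (at q)"
    by (rule has_derivative_transform_within_open[OF has_derivative_ident open_U assms]) (simp add: BA)
  ultimately have "FD B (A q) \<circ> FD A q = (\<lambda>y. y)" by (rule has_derivative_unique)
  then show ?thesis unfolding vert_def by (metis o_apply)
qed

lemma A_vert:
  assumes "q \<in> U" shows "FD A q (vert a q) = a"
proof -
  have "(\<lambda>a. vert a q) \<circ> FD A q = id" using vert_A[OF assms] by auto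
  then have "FD A q \<circ> (\<lambda>a. vert a q) = id"
    using eucl.linear_inverse_left linear_A linear_vert assms by blast
  then show ?thesis by (metis comp_apply id_apply)
qed

lemma rep_inner:
  assumes "q \<in> U" "linear l" shows "rep l q \<bullet> a = l (vert (proj a) q)"
proof -
  have "linear (\<lambda>a. l (vert (proj a) q))"
    using linear_compose[OF linear_compose[OF linear_proj linear_vert[OF assms(1)]] assms(2)] by (simp add: o_def)
  from linear_euclidean_expansion[OF this, of a] show ?thesis
    unfolding rep_def inner_sum_left inner_scaleR_left by (simp add: inner_commute[of a] mult.commute)
qed

text \<open>The inner product of \<open>rep l q\<close> with \<open>a\<close> depends on
  \<open>proj a\<close> only, so \<open>rep l q\<close> is orthogonal to the kernel of
  \<open>proj\<close>. If it also lies in that kernel, it is orthogonal to itself and vanishes. Thus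
  applying \<open>proj\<close> to it loses nothing.\<close>

lemma proj_rep_eq_0:
  assumes q: "q \<in> U" and l: "linear l"
  shows "proj (rep l q) = 0 \<longleftrightarrow> (\<forall>y. R (FD A q y) = 0 \<longrightarrow> l y = 0)"
proof
  assume 0: "proj (rep l q) = 0"
  have "rep l q \<bullet> rep l q = 0"
    unfolding rep_inner[OF q l] 0 using linear_0[OF linear_vert[OF q]] linear_0[OF l] by simp
  then have "rep l q = 0" by simp
  then have "l (vert (proj a) q) = 0" for a using rep_inner[OF q l, of a] by simp
  then show "\<forall>y. R (FD A q y) = 0 \<longrightarrow> l y = 0" using proj_ker vert_A[OF q] by metis
next
  assume "\<forall>y. R (FD A q y) = 0 \<longrightarrow> l y = 0"
  then have "l (vert (proj b) q) = 0" for b using A_vert[OF q] R_proj by metis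
  then show "proj (rep l q) = 0" by (simp add: rep_def linear_0[OF linear_proj])
qed

lemma rep_diff: "rep l q - rep l' q = rep (\<lambda>y. l y - l' y) q"
  by (simp add: rep_def scaleR_diff_left sum_subtractf)

lemma nonzero_Dom: "(q, u) \<in> Dom \<Longrightarrow> q \<in> U \<and> u \<noteq> 0 \<and> R (FD A q u) \<noteq> 0"
  unfolding Dom_def using linear_0[OF linear_RA] by auto

lemma crit_iff: "(q, u) \<in> Dom \<Longrightarrow> proj (rep (\<lambda>y. FD E (q, u) (0, y)) q) = 0 \<longleftrightarrow> crit q u"
  using proj_rep_eq_0[OF _ linear_E] nonzero_Dom[of q u] unfolding crit_def by blast

lemma R_snd_\<Phi>: "R (snd (\<Phi> z)) = R (FD A (fst z) (snd z))"
  by (simp add: \<Phi>_def linear_add[OF linear_R] RJ R_proj)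

lemma proj_snd_\<Phi>: "proj (snd (\<Phi> z)) = proj (rep (\<lambda>y. FD E z (0, y)) (fst z))"
  by (simp add: \<Phi>_def linear_add[OF linear_proj] proj_J proj_ker R_proj)

lemma \<Phi>_crit: "z \<in> Dom \<Longrightarrow> crit (fst z) (snd z) \<Longrightarrow> \<Phi> z = (fst z, J (R (FD A (fst z) (snd z))))"
  using crit_iff[of "fst z" "snd z"] by (simp add: \<Phi>_def)

text \<open>The derivative of \<open>FD E (q, u + s y) (0, y)\<close> with respect to
  \<open>s\<close> is the Hessian evaluated twice on \<open>y\<close>, which is positive along a
  line that avoids zero.\<close>

lemma strict_monotone:
  assumes q: "q \<in> U" and y: "y \<noteq> 0" and nz: "\<And>s. u + s *\<^sub>R y \<noteq> 0"
  shows "FD E (q, u) (0, y) < FD E (q, u + y) (0, y)"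
proof -
  let ?f = "\<lambda>s. FD E (q, u + s *\<^sub>R y) (0, y)"
  have *: "\<exists>D. (?f has_real_derivative D) (at s) \<and> D > 0" for s
  proof -
    let ?L = "FD (\<lambda>v. FD E (q, v) (0, y)) (u + s *\<^sub>R y)"
    have "((\<lambda>s. u + s *\<^sub>R y) has_derivative (\<lambda>h. h *\<^sub>R y)) (at s)"
      by (auto intro!: derivative_eq_intros)
    from diff_chain_at[OF this has_derivative_grad[OF q nz]]
    have "(?f has_derivative (\<lambda>h. ?L (h *\<^sub>R y))) (at s)" by (simp add: o_def)
    moreover have "?L (h *\<^sub>R y) = ?L y * h" for h
      using linear_cmul[OF has_derivative_linear[OF has_derivative_grad[OF q nz]]] by simp
    ultimately have "(?f has_real_derivative ?L y) (at s)"
      by (simp add: has_field_derivative_def)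
    then show ?thesis using convex_E[OF q nz y] by blast
  qed
  have "?f 0 < ?f 1" by (rule DERIV_pos_imp_increasing[OF zero_less_one]) (rule *)
  then show ?thesis by simp
qed

text \<open>Two vectors with the same image have the same projection, so their difference is
  vertical, and the difference \<open>?l\<close> of the two differentials vanishes on it. Strict
  monotonicity along the segment allows this only for equal vectors.\<close>

lemma inj_\<Phi>: "inj_on \<Phi> Dom"
proof (rule inj_onI, clarify)
  fix q u q' u' assume z: "(q, u) \<in> Dom" "(q', u') \<in> Dom" and eq: "\<Phi> (q, u) = \<Phi> (q', u')"
  have [simp]: "q' = q" using eq by (simp add: \<Phi>_def)
  note nz = nonzero_Dom[OF z(1)] nonzero_Dom[OF z(2), simplified]
  let ?y = "u' - u" and ?l = "\<lambda>y. FD E (q, u') (0, y) - FD E (q, u) (0, y)"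
  have lin: "linear ?l" using nz by (intro linear_compose_sub linear_E) auto
  have RA: "R (FD A q u') = R (FD A q u)" using R_snd_\<Phi> eq by (metis \<open>q' = q\<close> fst_conv snd_conv)
  have "proj (rep ?l q) = 0"
    using proj_snd_\<Phi>[of "(q, u)"] proj_snd_\<Phi>[of "(q', u')"] eq
    by (simp add: linear_diff[OF linear_proj] flip: rep_diff)
  moreover have ker: "R (FD A q ?y) = 0" using RA nz linear_diff[OF linear_RA] by auto
  ultimately have l0: "?l ?y = 0" using proj_rep_eq_0[OF _ lin] nz by blast
  have "?y = 0"
  proof (rule ccontr)
    assume y: "?y \<noteq> 0"
    \<comment> \<open>Moving in the direction \<open>?y\<close> does not change the projection,
      which is non-zero.\<close>
    have nz': "u + s *\<^sub>R ?y \<noteq> 0" for s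
    proof
      assume "u + s *\<^sub>R ?y = 0"
      then have "R (FD A q (u + s *\<^sub>R ?y)) = 0" using nz linear_0[OF linear_RA] by auto
      moreover have "R (FD A q (u + s *\<^sub>R ?y)) = R (FD A q u)"
        using nz ker linear_add[OF linear_RA] linear_cmul[OF linear_RA] by auto
      ultimately show False using nz by simp
    qed
    have "FD E (q, u) (0, ?y) < FD E (q, u + ?y) (0, ?y)"
      by (rule strict_monotone[OF _ y nz']) (use nz in auto)
    then show False using l0 by simp
  qed
  then show "q = q' \<and> u = u'" by simp
qed

lemma smooth_RA: "smooth_on (U \<times> UNIV) (\<lambda>z. FD A (fst z) (snd z))"
  using open_U
  by (intro smooth_on_FD_compose[OF smooth_A] smooth_on_fst smooth_on_snd smooth_on_id open_Times) auto

lemma open_Dom: "open Dom"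
proof -
  have "Dom = (U \<times> UNIV) \<inter> (\<lambda>z. R (FD A (fst z) (snd z))) -` (- {0})" by (auto simp: Dom_def)
  moreover have "continuous_on (U \<times> UNIV) (\<lambda>z. R (FD A (fst z) (snd z)))"
    by (intro smooth_on_continuous_on smooth_on_bounded_linear_outer[OF R] smooth_RA)
      (simp add: open_U open_Times)
  ultimately show ?thesis
    using continuous_open_preimage[of "U \<times> UNIV" _ "- {0}"] open_U by (auto simp: open_Times)
qed

lemma smooth_vert: "smooth_on U (vert a)"
  unfolding vert_def by (intro smooth_on_compose[OF smooth_on_FD[OF smooth_B] open_U] smooth_A) auto

lemma smooth_vert_E: "smooth_on (U \<times> - {0}) (\<lambda>z. FD E z (0, vert a (fst z)))"
proof -
  have op: "open (U \<times> (- {0::'e}))" using open_U by (auto intro: open_Times)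
  show ?thesis
    by (intro smooth_grad op smooth_on_id smooth_on_compose[OF smooth_vert op] smooth_on_fst) auto
qed

lemma Dom_sub: "Dom \<subseteq> U \<times> - {0}"
  using nonzero_Dom by auto

lemma smooth_\<Phi>: "smooth_on Dom \<Phi>"
proof -
  have "smooth_on Dom (\<lambda>z. FD A (fst z) (snd z))"
    by (rule smooth_on_subset[OF smooth_RA]) (use Dom_sub in auto)
  then show ?thesis unfolding \<Phi>_def rep_def
    by (intro smooth_on_Pair smooth_on_add smooth_on_bounded_linear_outer[OF J] smooth_on_bounded_linear_outer[OF R]
       smooth_on_bounded_linear_outer[OF bl_proj] smooth_on_sum smooth_on_bilinear[OF bounded_bilinear_scaleR]
       smooth_on_const smooth_on_subset[OF smooth_vert_E Dom_sub] smooth_on_fst smooth_on_id open_Dom)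
qed

text \<open>The infinitesimal form of the preceding injectivity: a kernel vector has base part 0,
  its fibre part \<open>b\<close> is vertical, and the form \<open>?l b\<close> vanishes on vertical
  vectors, in particular on \<open>b\<close>; positivity of the Hessian leaves only
  \<open>b = 0\<close>.\<close>

lemma inj_FD_\<Phi>:
  assumes z: "z \<in> Dom" and 0: "FD \<Phi> z v = 0" shows "v = 0"
proof -
  obtain q u a b where [simp]: "z = (q, u)" "v = (a, b)" by (metis surj_pair)
  note nz = nonzero_Dom[OF z[simplified]]
  have q: "q \<in> U" and u: "u \<noteq> 0" using nz by auto
  have d: "(\<Phi> has_derivative FD \<Phi> (q, u)) (at (q, u))"
    using smooth_on_has_derivative[OF smooth_\<Phi> z] by simp
  have "((\<lambda>z. fst (\<Phi> z)) has_derivative (\<lambda>w. fst (FD \<Phi> (q, u) w))) (at (q, u))"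
    using d by (rule has_derivative_fst)
  moreover have "((\<lambda>z. fst (\<Phi> z)) has_derivative fst) (at (q, u))"
    by (auto simp: \<Phi>_def intro!: derivative_eq_intros)
  ultimately have "(\<lambda>w. fst (FD \<Phi> (q, u) w)) = fst" by (rule has_derivative_unique)
  then have a: "a = 0" using 0 by (metis \<open>v = (a, b)\<close> \<open>z = (q, u)\<close> fst_conv fst_zero)
  let ?l = "\<lambda>b y. FD (\<lambda>v. FD E (q, v) (0, y)) u b"
  have "((\<lambda>v. (q, v)) has_derivative (\<lambda>b. (0, b))) (at u)"
    by (auto intro!: derivative_eq_intros)
  from diff_chain_at[OF this d]
  have 1: "((\<lambda>v. \<Phi> (q, v)) has_derivative (\<lambda>b. FD \<Phi> (q, u) (0, b))) (at u)" by (simp add: o_def)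
  have bA: "bounded_linear (FD A q)" using has_derivative_A[OF q] has_derivative_bounded_linear by blast
  have "((\<lambda>v. \<Phi> (q, v)) has_derivative (\<lambda>b. (0, J (R (FD A q b)) + proj (rep (?l b) q)))) (at u)"
    unfolding \<Phi>_def rep_def fst_conv snd_conv
    by (intro has_derivative_Pair has_derivative_const has_derivative_add
        bounded_linear.has_derivative[OF J] bounded_linear.has_derivative[OF R]
        bounded_linear_imp_has_derivative[OF bA] bounded_linear.has_derivative[OF bl_proj]
        has_derivative_sum has_derivative_scaleR_left has_derivative_grad q u)
  from fun_cong[OF has_derivative_unique[OF 1 this], of b]
  have eq: "J (R (FD A q b)) + proj (rep (?l b) q) = 0"
    using 0 a by (simp add: zero_prod_def)
  have Rb: "R (FD A q b) = 0"
    using arg_cong[OF eq, of R] by (simp add: linear_add[OF linear_R] linear_0[OF linear_R] RJ R_proj)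
  then have "proj (rep (?l b) q) = 0" using eq by (simp add: linear_0[OF linear_J])
  then have "?l b b = 0" using proj_rep_eq_0[OF q linear_hess[OF q u]] Rb by blast
  then have "b = 0" using convex_E[OF q u, of b] by force
  then show ?thesis using a by (simp add: zero_prod_def)
qed

definition \<Psi> :: "'e \<times> 'e \<Rightarrow> 'e \<times> 'e" where "\<Psi> = inv_into Dom \<Phi>"

lemma open_image_\<Phi>: "open (\<Phi> ` Dom)" and smooth_\<Psi>: "smooth_on (\<Phi> ` Dom) \<Psi>"
  unfolding \<Psi>_def by (rule smooth_on_inv_into[OF open_Dom smooth_\<Phi> inj_\<Phi> inj_FD_\<Phi>]; assumption)+

lemma \<Psi>_\<Phi>: "z \<in> Dom \<Longrightarrow> \<Psi> (\<Phi> z) = z"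
  unfolding \<Psi>_def using inj_\<Phi> by (rule inv_into_f_f)

lemma \<Phi>_\<Psi>: "y \<in> \<Phi> ` Dom \<Longrightarrow> \<Phi> (\<Psi> y) = y"
  and \<Psi>_Dom: "y \<in> \<Phi> ` Dom \<Longrightarrow> \<Psi> y \<in> Dom"
  unfolding \<Psi>_def by (auto intro: f_inv_into_f inv_into_into)

lemma crit_unique:
  assumes "q \<in> U" "R (FD A q u) = v" "R (FD A q u') = v" "v \<noteq> 0" "crit q u" "crit q u'"
  shows "u = u'"
proof -
  have d: "(q, u) \<in> Dom" "(q, u') \<in> Dom" using assms by (auto simp: Dom_def)
  then have "\<Phi> (q, u) = \<Phi> (q, u')" using \<Phi>_crit assms by simp
  then show ?thesis using inj_\<Phi> d by (auto simp: inj_on_def)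
qed

text \<open>\<Phi> sends \<open>(q, g (q, v))\<close> to \<open>(q, J v)\<close>, so
  \<open>g\<close> is the fibre part of the smooth inverse \<open>\<Psi>\<close> composed with a
  linear map.\<close>

lemma smooth_crit:
  assumes "\<And>q v. q \<in> U \<Longrightarrow> v \<noteq> 0 \<Longrightarrow> crit q (g (q, v)) \<and> R (FD A q (g (q, v))) = v"
  shows "smooth_on (U \<times> - {0}) g"
proof -
  have op: "open (U \<times> (- {0::'d}))" using open_U by (auto intro: open_Times)
  have *: "(q, g (q, v)) \<in> Dom \<and> \<Phi> (q, g (q, v)) = (q, J v)" if "q \<in> U" "v \<noteq> 0" for q v
    using assms[OF that] that \<Phi>_crit[of "(q, g (q, v))"] by (auto simp: Dom_def)
  have bl: "bounded_linear (\<lambda>z. (fst z, J (snd z)))"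
    by (intro bounded_linear_Pair bounded_linear_fst bounded_linear_compose[OF J bounded_linear_snd])
  \<comment> \<open>The summand 0 gives the linear map the affine shape expected by
    \<open>smooth_on_affine_inner\<close>.\<close>
  have "smooth_on (U \<times> - {0}) (\<lambda>z. snd (\<Psi> (0 + (fst z, J (snd z)))))"
  proof (intro smooth_on_snd op smooth_on_affine_inner[OF bl op _ smooth_\<Psi>])
    show "0 + (fst z, J (snd z)) \<in> \<Phi> ` Dom" if "z \<in> U \<times> - {0}" for z
      using *[of "fst z" "snd z"] that by (force intro: image_eqI[of _ _ "(fst z, g z)"])
  qed
  then show ?thesis
  proof (rule smooth_on_cong[OF _ op])
    fix z :: "'e \<times> 'd" assume "z \<in> U \<times> - {0}"
    with * \<Psi>_\<Phi> show "snd (\<Psi> (0 + (fst z, J (snd z)))) = g z"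
      by (cases z) (auto, metis snd_conv)
  qed
qed

text \<open>In the coordinates \<Phi> the critical set is part of a linear subspace and
  \<open>\<xi>\<close> becomes a direction in it, so the required curve is the preimage of a
  straight line.\<close>

lemma crit_curve:
  assumes x: "(q, u) \<in> Dom" and c: "crit q u"
    and \<xi>: "\<And>a. R a = 0 \<Longrightarrow> FD (\<lambda>z. FD E z (0, vert a (fst z))) (q, u) \<xi> = 0"
  obtains \<epsilon> \<gamma> where "\<epsilon> > 0" "smooth_on {-\<epsilon><..<\<epsilon>} \<gamma>" "\<gamma> 0 = (q, u)"
    "\<And>t. t \<in> {-\<epsilon><..<\<epsilon>} \<Longrightarrow> \<gamma> t \<in> Dom \<and> crit (fst (\<gamma> t)) (snd (\<gamma> t))"
    "(\<gamma> has_derivative (\<lambda>t. t *\<^sub>R \<xi>)) (at 0)"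
proof -
  let ?y = "\<Phi> (q, u)" and ?\<eta> = "FD \<Phi> (q, u) \<xi>"
  have q: "q \<in> U" and u: "u \<noteq> 0" using nonzero_Dom[OF x] by auto
  have d: "(\<Phi> has_derivative FD \<Phi> (q, u)) (at (q, u))"
    using smooth_on_has_derivative[OF smooth_\<Phi> x] .
  have dE: "((\<lambda>z. FD E z (0, vert a (fst z))) has_derivative FD (\<lambda>z. FD E z (0, vert a (fst z))) (q, u)) (at (q, u))" for a
    by (rule smooth_on_has_derivative[OF smooth_vert_E]) (use q u in auto)
  have dA: "((\<lambda>z. FD A (fst z) (snd z)) has_derivative FD (\<lambda>z. FD A (fst z) (snd z)) (q, u)) (at (q, u))"
    by (rule smooth_on_has_derivative[OF smooth_RA]) (use q in auto)
  have "(\<Phi> has_derivative (\<lambda>\<xi>. (fst \<xi>, J (R (FD (\<lambda>z. FD A (fst z) (snd z)) (q, u) \<xi>)) +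
     proj (\<Sum>b\<in>Basis. FD (\<lambda>z. FD E z (0, vert (proj b) (fst z))) (q, u) \<xi> *\<^sub>R b)))) (at (q, u))"
    unfolding \<Phi>_def rep_def
    by (intro has_derivative_Pair has_derivative_add has_derivative_fst has_derivative_ident
        bounded_linear.has_derivative[OF J] bounded_linear.has_derivative[OF R]
        bounded_linear.has_derivative[OF bl_proj] has_derivative_sum has_derivative_scaleR_left dA dE)
  \<comment> \<open>Every summand under \<open>proj\<close> vanishes by the assumption on
    \<open>\<xi>\<close>, since \<open>R (proj b) = 0\<close>; what is left of the second component
    lies in the range of \<open>J\<close>.\<close>
  from fun_cong[OF FD_eq[OF this], of \<xi>] obtain \<nu> where \<eta>: "?\<eta> = (fst \<xi>, J \<nu>)"
    using \<xi>[OF R_proj] linear_0[OF linear_proj] by simp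
  have "continuous_on UNIV (\<lambda>t. ?y + t *\<^sub>R ?\<eta>)" by (intro continuous_intros)
  then have "open ((\<lambda>t. ?y + t *\<^sub>R ?\<eta>) -` (\<Phi> ` Dom))"
    using open_image_\<Phi> by (simp add: continuous_on_open_vimage)
  moreover have "0 \<in> (\<lambda>t. ?y + t *\<^sub>R ?\<eta>) -` (\<Phi> ` Dom)" using x by simp
  ultimately obtain \<epsilon> where "\<epsilon> > 0" and "ball 0 \<epsilon> \<subseteq> (\<lambda>t. ?y + t *\<^sub>R ?\<eta>) -` (\<Phi> ` Dom)"
    by (meson open_contains_ball)
  then have \<epsilon>: "\<epsilon> > 0" "\<And>t. \<bar>t\<bar> < \<epsilon> \<Longrightarrow> ?y + t *\<^sub>R ?\<eta> \<in> \<Phi> ` Dom"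
    by (auto simp: subset_iff dist_real_def)
  define \<gamma> where "\<gamma> = (\<lambda>t. \<Psi> (?y + t *\<^sub>R ?\<eta>))"
  show ?thesis
  proof (rule that[OF \<epsilon>(1)])
    show "smooth_on {-\<epsilon><..<\<epsilon>} \<gamma>" unfolding \<gamma>_def
      by (rule smooth_on_affine_inner[OF bounded_linear_scaleR_left _ _ smooth_\<Psi>]) (auto intro!: \<epsilon>)
    show "\<gamma> 0 = (q, u)" by (simp add: \<gamma>_def \<Psi>_\<Phi> x)
    show "\<gamma> t \<in> Dom \<and> crit (fst (\<gamma> t)) (snd (\<gamma> t))" if "t \<in> {-\<epsilon><..<\<epsilon>}" for t
    proof -
      have *: "?y + t *\<^sub>R ?\<eta> \<in> \<Phi> ` Dom" using that by (intro \<epsilon>) auto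
      \<comment> \<open>Along the line the \<open>proj\<close> part stays 0: it is 0 at the start by
        criticality, and the direction \<open>?\<eta>\<close> contributes nothing to it.\<close>
      have "proj (snd (\<Phi> (\<gamma> t))) = 0"
        unfolding \<gamma>_def unfolding \<Phi>_\<Psi>[OF *] unfolding \<eta> using \<Phi>_crit[OF x] c
        by (simp add: linear_add[OF linear_proj] linear_cmul[OF linear_proj] proj_J)
      then show ?thesis
        using \<Psi>_Dom[OF *] crit_iff[of "fst (\<gamma> t)" "snd (\<gamma> t)"] unfolding proj_snd_\<Phi> \<gamma>_def by simp
    qed
    have d\<Psi>: "(\<Psi> has_derivative FD \<Psi> ?y) (at ?y)"
      using smooth_on_has_derivative[OF smooth_\<Psi>] x by blast
    have "(\<Psi> \<circ> \<Phi> has_derivative (\<lambda>v. v)) (at (q, u))"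
      by (rule has_derivative_transform_within_open[OF has_derivative_ident open_Dom x]) (simp add: \<Psi>_\<Phi>)
    from has_derivative_unique[OF diff_chain_at[OF d d\<Psi>] this]
    have inv: "FD \<Psi> ?y ?\<eta> = \<xi>" by (metis o_apply)
    have "((\<lambda>t. ?y + t *\<^sub>R ?\<eta>) has_derivative (\<lambda>t. t *\<^sub>R ?\<eta>)) (at 0)"
      by (auto intro!: derivative_eq_intros)
    from diff_chain_at[OF this, of \<Psi> "FD \<Psi> ?y"] d\<Psi>
    have "(\<gamma> has_derivative (\<lambda>t. FD \<Psi> ?y (t *\<^sub>R ?\<eta>))) (at 0)" by (simp add: \<gamma>_def o_def)
    then show "(\<gamma> has_derivative (\<lambda>t. t *\<^sub>R \<xi>)) (at 0)"
      using linear_cmul[OF has_derivative_linear[OF d\<Psi>]] inv by simp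
  qed
qed

end

section \<open>Extension of local vector fields and charts adapted to the bundle\<close>

lemma (in smooth_atlas) open_transfer:
  assumes "open U" "U \<subseteq> cmap M i ` cdom M i"
  shows "open (cmap M a ` (cdom M a \<inter> cinv M i ` U))"
proof -
  have "cmap M a ` (cdom M a \<inter> cinv M i ` U) = cmap M a ` (cdom M a \<inter> cdom M i) \<inter> tr a i -` U"
  proof (intro equalityI subsetI)
    fix x assume "x \<in> cmap M a ` (cdom M a \<inter> cinv M i ` U)"
    then obtain q where "q \<in> U" "cinv M i q \<in> cdom M a" "x = cmap M a (cinv M i q)" by auto
    moreover from this have "cinv M i q \<in> cdom M i" "cmap M i (cinv M i q) = q"
      using assms(2) cinv_in cmap_cinv by blast+
    ultimately show "x \<in> cmap M a ` (cdom M a \<inter> cdom M i) \<inter> tr a i -` U" by auto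
  next
    fix x assume x: "x \<in> cmap M a ` (cdom M a \<inter> cdom M i) \<inter> tr a i -` U"
    then obtain p where "p \<in> cdom M a" "p \<in> cdom M i" "x = cmap M a p" by auto
    then show "x \<in> cmap M a ` (cdom M a \<inter> cinv M i ` U)"
      using x by (auto intro!: image_eqI[of _ _ p] image_eqI[of _ _ "cmap M i p"])
  qed
  then show ?thesis
    using continuous_open_preimage[OF smooth_on_continuous_on[OF smooth_overlap] open_overlap assms(1)] by simp
qed

lemma (in smooth_atlas) topspace_mtop: "topspace (mtop M) = points M"
proof -
  have "points M \<inter> cdom M i = cdom M i" for i by (auto simp: points_def)
  then have "openin (mtop M) (points M)"
    unfolding openin_mtop[of M, OF inj] by (simp add: open_chart)
  then show ?thesis
    using openin_mtop[of M, OF inj] openin_subset openin_topspace by (metis subset_antisym)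
qed

text \<open>A compact set in a chart is compact in the manifold and therefore closed, by the
  Hausdorff property. Its open complement is where an extension by zero is smooth for trivial
  reasons.\<close>

lemma (in smooth_atlas) closedin_mtop_image:
  fixes K :: "'e set"
  assumes haus: "Hausdorff_space (mtop M)" and K: "compact K" "K \<subseteq> cmap M i ` cdom M i"
  shows "closedin (mtop M) (cinv M i ` K)"
proof (rule compactin_imp_closedin[OF haus])
  let ?O = "cmap M i ` cdom M i"
  note oi = openin_mtop[of M, OF inj]
  have "continuous_map (top_of_set ?O) (mtop M) (cinv M i)"
    unfolding continuous_map_def topspace_mtop
  proof (intro conjI allI impI)
    show "cinv M i \<in> topspace (top_of_set ?O) \<rightarrow> points M" by (auto simp: points_def)
    fix W assume "openin (mtop M) W"
    then have "open (cmap M i ` (W \<inter> cdom M i))" using oi by blast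
    moreover have "{x \<in> topspace (top_of_set ?O). cinv M i x \<in> W} = cmap M i ` (W \<inter> cdom M i)" by auto
    ultimately show "openin (top_of_set ?O) {x \<in> topspace (top_of_set ?O). cinv M i x \<in> W}"
      by (auto intro: open_subset)
  qed
  moreover have "compactin (top_of_set ?O) K" using K by (simp add: compactin_subtopology)
  ultimately show "compactin (mtop M) (cinv M i ` K)" using image_compactin by blast
qed

text \<open>\<open>X\<close> is cut off by a bump function supported in a closed ball inside
  \<open>U\<close>. The factor \<open>\<rho>\<close> stays visible in the conclusion, with
  \<open>\<rho> q > 0\<close>, so that later arguments can divide by its value at
  \<open>q\<close>.\<close>

lemma local_field_extension:
  fixes M :: "('a, 'i, 'e::euclidean_space) atlas"
  assumes M: "smooth_manifold M" and U: "open U" "U \<subseteq> cmap M i ` cdom M i"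
    and X: "smooth_on U X" and q: "q \<in> U"
  obtains \<rho> Y where "smooth_on UNIV \<rho>" "\<rho> q > (0::real)" "vector_field M Y"
    "\<And>x. x \<in> U \<Longrightarrow> snd (Y (cinv M i x)) i = \<rho> x *\<^sub>R X x"
    "\<And>p. p \<in> points M \<Longrightarrow> p \<notin> cinv M i ` U \<Longrightarrow> Y p = tzero p"
proof -
  interpret smooth_atlas M using M by (rule smooth_manifold_atlas)
  note oi = openin_mtop[of M, OF inj]
  obtain r where r: "r > 0" "cball q r \<subseteq> U" using U q open_contains_cball by blast
  obtain \<rho> where \<rho>: "smooth_on UNIV \<rho>" "\<rho> q > (0::real)" "\<And>x. x \<notin> ball q r \<Longrightarrow> \<rho> x = 0"
    using smooth_bump[OF r(1)] by blast
  define Y where "Y p = (if p \<in> cinv M i ` U then (p, tvec i p (\<rho> (cmap M i p) *\<^sub>R X (cmap M i p))) else tzero p)" for p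
  have UD: "p \<in> cdom M i \<and> cmap M i p \<in> U" if "p \<in> cinv M i ` U" for p
    using that U(2) by fastforce
  let ?K = "cinv M i ` cball q r"
  have Y0: "Y p = tzero p" if "p \<in> points M" "p \<notin> ?K" for p
  proof (cases "p \<in> cinv M i ` U")
    case True
    then have p: "p \<in> cdom M i" using UD by blast
    have "cmap M i p \<notin> ball q r" using that(2) p cinv_cmap[OF p] ball_subset_cball by (metis imageI subset_iff)
    then show ?thesis using True \<rho>(3) p by (simp add: Y_def tvec_zero tzero_def)
  qed (simp add: Y_def)
  have Y1: "Y p \<in> points (TB M) \<and> fst (Y p) = p" if "p \<in> points M" for p
    using that UD[of p] tvec_in zero_in_tangent by (auto simp: Y_def points_TB tzero_def)
  have "smooth_map M (TB M) Y"
  proof (rule smooth_mapI_local)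
    show "smooth_atlas (TB M)" by (rule smooth_atlas_TB) (rule smooth_atlas_axioms)
    show "Y ` points M \<subseteq> points (TB M)" using Y1 by blast
    show "inj_on (cmap M a) (cdom M a)" for a by (rule inj)
    fix a p assume p: "p \<in> cdom M a"
    then have pM: "p \<in> points M" by (auto simp: points_def)
    show "\<exists>b V. open V \<and> cmap M a p \<in> V \<and> V \<subseteq> cmap M a ` (cdom M a \<inter> Y -` cdom (TB M) b) \<and>
        smooth_on V (cmap (TB M) b \<circ> Y \<circ> cinv M a)"
    proof (cases "p \<in> cinv M i ` U")
      case True
      let ?V = "cmap M a ` (cdom M a \<inter> cinv M i ` U)"
      have op: "open ?V" by (rule open_transfer[OF U])
      have VD: "?V \<subseteq> cmap M a ` (cdom M a \<inter> cdom M i)" using UD by blast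
      have trU: "tr a i x \<in> U" if "x \<in> ?V" for x using that UD by auto
      have "smooth_on ?V (\<lambda>x. (tr a i x, \<rho> (tr a i x) *\<^sub>R X (tr a i x)))"
        by (intro smooth_on_Pair op smooth_on_subset[OF smooth_overlap VD] smooth_on_bilinear[OF bounded_bilinear_scaleR]
            smooth_on_compose[OF \<rho>(1)] smooth_on_compose[OF X] trU) auto
      then have "smooth_on ?V (cmap (TB M) i \<circ> Y \<circ> cinv M a)"
      proof (rule smooth_on_cong[OF _ op])
        fix x assume "x \<in> ?V"
        then obtain p' where p': "p' \<in> cdom M a" "p' \<in> cinv M i ` U" "x = cmap M a p'" by auto
        then show "(tr a i x, \<rho> (tr a i x) *\<^sub>R X (tr a i x)) = (cmap (TB M) i \<circ> Y \<circ> cinv M a) x"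
          using UD[of p'] by (simp add: Y_def cmap_TB tvec_self)
      qed
      moreover have "?V \<subseteq> cmap M a ` (cdom M a \<inter> Y -` cdom (TB M) i)"
        using UD tvec_in by (auto simp: Y_def cdom_TB)
      ultimately show ?thesis using op True p by blast
    next
      case False
      \<comment> \<open>The complement of the image of \<open>U\<close> need not be open; the
        complement of the smaller compact set \<open>?K\<close> is, and the field vanishes on it
        too.\<close>
      let ?V = "cmap M a ` ((points M - ?K) \<inter> cdom M a)"
      have "closedin (mtop M) ?K"
        by (rule closedin_mtop_image) (use M r U in \<open>auto simp: smooth_manifold_def\<close>)
      then have "openin (mtop M) (topspace (mtop M) - ?K)" by blast
      then have op: "open ?V" using oi by (simp add: topspace_mtop)
      have "smooth_on ?V (\<lambda>x. (x, 0::'e))"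
        by (intro smooth_on_Pair smooth_on_id smooth_on_const op)
      then have "smooth_on ?V (cmap (TB M) a \<circ> Y \<circ> cinv M a)"
        by (rule smooth_on_cong[OF _ op]) (use Y0 in \<open>auto simp: cmap_TB tzero_def\<close>)
      moreover have "?V \<subseteq> cmap M a ` (cdom M a \<inter> Y -` cdom (TB M) a)"
        using Y0 zero_in_tangent by (auto simp: cdom_TB tzero_def)
      moreover have "cmap M a p \<in> ?V" using False p pM r(2) by blast
      ultimately show ?thesis using op by blast
    qed
  qed
  then have "vector_field M Y" using Y1 by (auto simp: vector_field_def)
  moreover have "snd (Y (cinv M i x)) i = \<rho> x *\<^sub>R X x" if "x \<in> U" for x
    using that UD[of "cinv M i x"] cmap_cinv[of x i] U(2) by (auto simp: Y_def tvec_self)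
  moreover have "Y p = tzero p" if "p \<in> points M" "p \<notin> cinv M i ` U" for p
    using that by (simp add: Y_def)
  ultimately show ?thesis using that \<rho>(1,2) by blast
qed

text \<open>A local trivialisation, followed by the inverse of its own derivative at the given point so that
  the coordinate change takes values in the model space of \<open>M\<close>.\<close>

lemma adapted_chart:
  fixes M :: "('a, 'i, 'e::euclidean_space) atlas"
    and N :: "('b, 'j, 'd::real_normed_vector) atlas"
    and Fib :: "('c, 'k, 'f::real_normed_vector) atlas"
  assumes fb: "fibre_bundle M N Fib \<pi>" and mi: "m \<in> cdom M i" and mj: "\<pi> m \<in> cdom N j"
  obtains U A B R J where "open U" "cmap M i m \<in> U" "U \<subseteq> cmap M i ` (cdom M i \<inter> \<pi> -` cdom N j)"
    "smooth_on U A" "open (A ` U)" "smooth_on (A ` U) (B :: 'e \<Rightarrow> 'e)" "\<And>x. x \<in> U \<Longrightarrow> B (A x) = x"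
    "bounded_linear R" "bounded_linear J" "\<And>v. R (J v) = v"
    "\<And>x. x \<in> U \<Longrightarrow> R (A x) = (cmap N j \<circ> \<pi> \<circ> cinv M i) x"
proof -
  have sm: "smooth_manifold M" "smooth_manifold N" "smooth_manifold Fib"
    using fb by (auto simp: fibre_bundle_def)
  have "\<pi> m \<in> points N" using mj by (auto simp: points_def)
  then obtain W \<psi> where W: "\<pi> m \<in> W"
    and \<psi>: "diffeo (sub_atlas M (\<pi> -` W)) (prod_atlas (sub_atlas N W) Fib) \<psi>"
    and fst\<psi>: "\<And>p. p \<in> points M \<Longrightarrow> \<pi> p \<in> W \<Longrightarrow> fst (\<psi> p) = \<pi> p"
    using fb unfolding fibre_bundle_def by fastforce
  let ?P = "sub_atlas M (\<pi> -` W)" and ?Q = "prod_atlas (sub_atlas N W) Fib"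
  let ?\<psi>' = "inv_into (points ?P) \<psi>"
  have cdQ: "cdom ?Q (j, k) = (cdom N j \<inter> W) \<times> cdom Fib k"
    and cmQ: "cmap ?Q (j, k) z = (cmap N j (fst z), cmap Fib k (snd z))" for k z
    by (auto simp: prod_atlas_def sub_atlas_def split: prod.split)
  have injP: "inj_on (cmap ?P i) (cdom ?P i)"
    using sm(1) by (auto simp: smooth_manifold_def cdom_sub cmap_sub inj_on_def)
  have injQ: "inj_on (cmap ?Q (j, k)) (cdom ?Q (j, k))" for k
    using sm(2,3) by (auto simp: smooth_manifold_def cdQ cmQ inj_on_def)
  have bij: "bij_betw \<psi> (points ?P) (points ?Q)" using \<psi> by (simp add: diffeo_def)
  have mP: "m \<in> points ?P" using mi W by (auto simp: points_def cdom_sub)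
  have "\<psi> m \<in> points ?Q" using bij mP by (auto simp: bij_betw_def)
  then obtain k where "snd (\<psi> m) \<in> cdom Fib k"
    by (auto simp: points_def prod_atlas_def split: prod.splits)
  moreover have "fst (\<psi> m) = \<pi> m" using fst\<psi> mP W by (auto simp: points_sub)
  ultimately have \<psi>m: "\<psi> m \<in> cdom ?Q (j, k)" using W mj by (auto simp: cdQ mem_Times_iff)
  define \<kappa> where "\<kappa> = cmap ?Q (j, k) \<circ> \<psi> \<circ> cinv ?P i"
  define \<omega> where "\<omega> = cmap ?P i \<circ> ?\<psi>' \<circ> cinv ?Q (j, k)"
  define U where "U = cmap ?P i ` (cdom ?P i \<inter> \<psi> -` cdom ?Q (j, k))"
  define V where "V = cmap ?Q (j, k) ` (cdom ?Q (j, k) \<inter> ?\<psi>' -` cdom ?P i)"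
  have U: "open U" "smooth_on U \<kappa>" and V: "open V" "smooth_on V \<omega>"
    using \<psi> unfolding diffeo_def smooth_map_def U_def V_def \<kappa>_def \<omega>_def by blast+
  have \<kappa>_cmap: "\<kappa> (cmap ?P i p) = cmap ?Q (j, k) (\<psi> p)" if "p \<in> cdom ?P i" for p
    using cinv_cmap_inj[OF injP that] by (simp add: \<kappa>_def)
  have \<omega>_cmap: "\<omega> (cmap ?Q (j, k) z) = cmap ?P i (?\<psi>' z)" if "z \<in> cdom ?Q (j, k)" for z
    using cinv_cmap_inj[OF injQ that] by (simp add: \<omega>_def)
  have \<psi>'\<psi>: "?\<psi>' (\<psi> p) = p" if "p \<in> cdom ?P i" for p
    by (rule bij_betw_inv_into_left[OF bij]) (use that in \<open>auto simp: points_def\<close>)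
  have \<psi>\<psi>': "\<psi> (?\<psi>' z) = z" if "z \<in> cdom ?Q (j, k)" for z
    by (rule bij_betw_inv_into_right[OF bij]) (use that in \<open>auto simp: points_def\<close>)
  have \<omega>\<kappa>: "\<kappa> x \<in> V \<and> \<omega> (\<kappa> x) = x" if "x \<in> U" for x
  proof -
    obtain p where p: "p \<in> cdom ?P i" "\<psi> p \<in> cdom ?Q (j, k)" and x: "x = cmap ?P i p"
      using \<open>x \<in> U\<close> unfolding U_def by blast
    have "\<psi> p \<in> cdom ?Q (j, k) \<inter> ?\<psi>' -` cdom ?P i" using p \<psi>'\<psi> by simp
    then show ?thesis unfolding V_def x \<kappa>_cmap[OF p(1)] \<omega>_cmap[OF p(2)] \<psi>'\<psi>[OF p(1)] by blast
  qed
  have \<kappa>\<omega>: "\<omega> y \<in> U \<and> \<kappa> (\<omega> y) = y" if "y \<in> V" for y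
  proof -
    obtain z where z: "z \<in> cdom ?Q (j, k)" "?\<psi>' z \<in> cdom ?P i" and y: "y = cmap ?Q (j, k) z"
      using \<open>y \<in> V\<close> unfolding V_def by blast
    have "?\<psi>' z \<in> cdom ?P i \<inter> \<psi> -` cdom ?Q (j, k)" using z \<psi>\<psi>' by simp
    then show ?thesis unfolding U_def y \<omega>_cmap[OF z(1)] \<kappa>_cmap[OF z(2)] \<psi>\<psi>'[OF z(1)] by blast
  qed
  let ?x = "cmap M i m"
  have x: "?x \<in> U" using \<psi>m mi W by (auto simp: U_def cmap_sub cdom_sub)
  let ?D = "FD \<kappa> ?x" and ?D' = "FD \<omega> (\<kappa> ?x)"
  have d: "(\<kappa> has_derivative ?D) (at ?x)" using smooth_on_has_derivative[OF U(2) x] .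
  have d': "(\<omega> has_derivative ?D') (at (\<kappa> ?x))" using smooth_on_has_derivative[OF V(2)] \<omega>\<kappa>[OF x] by blast
  have bl: "bounded_linear ?D" "bounded_linear ?D'" using d d' has_derivative_bounded_linear by blast+
  \<comment> \<open>Both composites of \<open>\<kappa>\<close> and \<open>\<omega>\<close> are
    identities near the point, so \<open>?D\<close> and \<open>?D'\<close> are inverse to each
    other; no dimension count for the normed model spaces enters.\<close>
  have "(\<omega> \<circ> \<kappa> has_derivative (\<lambda>v. v)) (at ?x)"
    by (rule has_derivative_transform_within_open[OF has_derivative_ident U(1) x]) (simp add: \<omega>\<kappa>)
  from has_derivative_unique[OF diff_chain_at[OF d d'] this]
  have D'D: "?D' (?D v) = v" for v by (metis o_apply)
  have d2: "(\<kappa> has_derivative ?D) (at (\<omega> (\<kappa> ?x)))" using d \<omega>\<kappa>[OF x] by simp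
  have "(\<kappa> \<circ> \<omega> has_derivative (\<lambda>v. v)) (at (\<kappa> ?x))"
    by (rule has_derivative_transform_within_open[OF has_derivative_ident V(1)]) (use \<omega>\<kappa>[OF x] \<kappa>\<omega> in auto)
  from has_derivative_unique[OF diff_chain_at[OF d' d2] this]
  have DD': "?D (?D' v) = v" for v by (metis o_apply)
  \<comment> \<open>Writing the image as a preimage of \<open>V\<close> under the continuous map
    \<open>?D\<close> shows that it is open.\<close>
  have im: "(\<lambda>x. ?D' (\<kappa> x)) ` U = ?D -` V"
  proof (intro equalityI subsetI)
    fix y assume "y \<in> ?D -` V"
    then have "y = ?D' (\<kappa> (\<omega> (?D y)))" "\<omega> (?D y) \<in> U" using \<kappa>\<omega> D'D by auto
    then show "y \<in> (\<lambda>x. ?D' (\<kappa> x)) ` U" by blast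
  next
    fix y assume "y \<in> (\<lambda>x. ?D' (\<kappa> x)) ` U"
    then obtain z where z: "z \<in> U" "y = ?D' (\<kappa> z)" by blast
    then have "?D y = \<kappa> z" by (simp only: DD')
    then show "y \<in> ?D -` V" using \<omega>\<kappa>[OF z(1)] by simp
  qed
  have opim: "open ((\<lambda>x. ?D' (\<kappa> x)) ` U)"
    unfolding im using V(1) bl(1) by (simp add: open_vimage linear_continuous_on)
  have smB: "smooth_on ((\<lambda>x. ?D' (\<kappa> x)) ` U) (\<lambda>y. \<omega> (0 + ?D y))"
    by (rule smooth_on_affine_inner[OF bl(1) opim _ V(2)]) (auto simp: im)
  show ?thesis
  \<comment> \<open>For these choices \<open>R (A x)\<close> is the first component of
    \<open>\<kappa> x\<close>, which is \<pi> in charts because the trivialisation preserves base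
    points.\<close>
  proof (rule that[of U "\<lambda>x. ?D' (\<kappa> x)" "\<lambda>y. \<omega> (0 + ?D y)" "\<lambda>y. fst (?D y)" "\<lambda>v. ?D' (v, 0)"])
    show "open U" by (rule U(1))
    show "?x \<in> U" by (rule x)
    show "U \<subseteq> cmap M i ` (cdom M i \<inter> \<pi> -` cdom N j)"
    proof
      fix y assume "y \<in> U"
      then obtain p where p: "p \<in> cdom M i" "\<pi> p \<in> W" "\<psi> p \<in> cdom ?Q (j, k)" "y = cmap M i p"
        by (auto simp: U_def cdom_sub cmap_sub)
      moreover from p have "fst (\<psi> p) = \<pi> p" using fst\<psi>[of p] by (auto simp: points_def)
      ultimately show "y \<in> cmap M i ` (cdom M i \<inter> \<pi> -` cdom N j)" by (auto simp: cdQ)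
    qed
    show "smooth_on U (\<lambda>x. ?D' (\<kappa> x))" by (rule smooth_on_bounded_linear_outer[OF bl(2) U])
    show "open ((\<lambda>x. ?D' (\<kappa> x)) ` U)" by (rule opim)
    show "smooth_on ((\<lambda>x. ?D' (\<kappa> x)) ` U) (\<lambda>y. \<omega> (0 + ?D y))" by (rule smB)
    show "\<omega> (0 + ?D (?D' (\<kappa> y))) = y" if "y \<in> U" for y using that \<omega>\<kappa> DD' by simp
    show "bounded_linear (\<lambda>y. fst (?D y))" using bounded_linear_compose[OF bounded_linear_fst bl(1)] .
    show "bounded_linear (\<lambda>v. ?D' (v, 0))"
      by (intro bounded_linear_compose[OF bl(2)] bounded_linear_Pair bounded_linear_ident bounded_linear_zero)
    show "fst (?D (?D' (v, 0))) = v" for v by (simp add: DD')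
    show "fst (?D (?D' (\<kappa> y))) = (cmap N j \<circ> \<pi> \<circ> cinv M i) y" if y: "y \<in> U" for y
    proof -
      obtain p where p: "p \<in> cdom M i" "\<pi> p \<in> W" "\<psi> p \<in> cdom ?Q (j, k)" "y = cmap M i p"
        using y by (auto simp: U_def cdom_sub cmap_sub)
      moreover have "fst (\<psi> p) = \<pi> p" using p fst\<psi>[of p] by (auto simp: points_def)
      moreover have "cinv M i (cmap M i p) = p"
        using sm(1) p(1) by (intro cinv_cmap_inj) (auto simp: smooth_manifold_def)
      ultimately show ?thesis using \<kappa>_cmap[of p] by (simp add: DD' cmQ cmap_sub cdom_sub)
    qed
  qed
qed

section \<open>Open submanifolds and curves\<close>

lemma in_points: "p \<in> cdom M i \<Longrightarrow> p \<in> points M"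
  by (auto simp: points_def)

lemma (in smooth_atlas) vector_fieldD:
  "vector_field M X \<Longrightarrow> p \<in> points M \<Longrightarrow> fst (X p) = p \<and> snd (X p) \<in> tangent_space M p"
  using points_TB[of M] unfolding vector_field_def smooth_map_def by force

text \<open>Derivatives are local, so at points of \<open>W\<close> both atlases impose the same
  transformation law on the same families of components.\<close>

lemma (in smooth_atlas) tangent_space_sub:
  assumes W: "\<And>i. open (cmap M i ` (cdom M i \<inter> W))" and p: "p \<in> W"
  shows "tangent_space (sub_atlas M W) p = tangent_space M p"
proof -
  have "FD (cmap (sub_atlas M W) j \<circ> cinv (sub_atlas M W) i) (cmap (sub_atlas M W) i p) = FD (tr i j) (cmap M i p)"
    if "p \<in> cdom M i" "p \<in> cdom M j" for i j
    unfolding cmap_sub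
  proof (rule FD_cong(2))
    show "tr i j differentiable (at (cmap M i p))"
      using has_derivative_tr[OF that] by (auto simp: differentiable_def)
    show "open (cmap M i ` (cdom M i \<inter> W))" by (rule W)
  qed (use that p in \<open>auto simp: smooth_atlas_sub(2)[OF W]\<close>)
  then show ?thesis using p by (auto simp: tangent_space_def cdom_sub)
qed

lemma smooth_atlas_real_line: "smooth_atlas real_line"
proof -
  have "cinv real_line i x = x" for i x
    by (simp add: cinv_def real_line_def)
  then have "cmap real_line j \<circ> cinv real_line i = (\<lambda>x. x)" for i j by (auto simp: real_line_def)
  moreover have "cmap real_line i ` (cdom real_line i \<inter> cdom real_line j) = UNIV" for i j
    by (auto simp: real_line_def)
  ultimately show ?thesis
    by unfold_locales (auto simp: smooth_on_id, simp add: real_line_def)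
qed

abbreviation interval_atlas :: "real \<Rightarrow> (real, unit, real) atlas" where
  "interval_atlas \<epsilon> \<equiv> sub_atlas real_line {-\<epsilon><..<\<epsilon>}"

lemma interval_atlas:
  shows "smooth_atlas (interval_atlas \<epsilon>)"
    and "cdom (interval_atlas \<epsilon>) i = {-\<epsilon><..<\<epsilon>}"
    and "cmap (interval_atlas \<epsilon>) i t = t"
    and "t \<in> {-\<epsilon><..<\<epsilon>} \<Longrightarrow> cinv (interval_atlas \<epsilon>) i t = t"
proof -
  interpret smooth_atlas real_line by (rule smooth_atlas_real_line)
  have op: "open (cmap real_line i ` (cdom real_line i \<inter> {-\<epsilon><..<\<epsilon>}))" for i
    by (simp add: real_line_def)
  show s: "smooth_atlas (interval_atlas \<epsilon>)" by (rule smooth_atlas_sub(1)[OF op])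
  show cd: "cdom (interval_atlas \<epsilon>) i = {-\<epsilon><..<\<epsilon>}" and cm: "cmap (interval_atlas \<epsilon>) i t = t" for i t
    by (auto simp: cdom_sub cmap_sub real_line_def)
  show "t \<in> {-\<epsilon><..<\<epsilon>} \<Longrightarrow> cinv (interval_atlas \<epsilon>) i t = t"
    using smooth_atlas.cinv_cmap[OF s, of t i] by (simp add: cd cm)
qed

lemma interval_unit_tangent:
  assumes \<epsilon>: "\<epsilon> > 0" shows "(\<lambda>_. 1) \<in> tangent_space (interval_atlas \<epsilon>) 0"
proof -
  interpret L: smooth_atlas "interval_atlas \<epsilon>" by (rule interval_atlas)
  have "L.tvec () 0 1 = (\<lambda>_. 1)" using L.tvec_self[of 0 "()"] \<epsilon> by (auto simp: interval_atlas)
  then show ?thesis using L.tvec_in[of 0 "()" 1] \<epsilon> by (simp add: interval_atlas)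
qed

text \<open>The inverse chart of the interval is known to be the identity on the interval only, so
  the velocity at 0 is computed through it and then identified, by locality, with the derivative of
  the curve itself.\<close>

lemma tangent_map_curve:
  fixes X :: "('a, 'i, 'e::real_normed_vector) atlas"
  assumes c: "smooth_map (interval_atlas \<epsilon>) X c" and \<epsilon>: "\<epsilon> > 0"
  shows "open {t \<in> {-\<epsilon><..<\<epsilon>}. c t \<in> cdom X k}"
    and "c 0 \<in> cdom X k \<Longrightarrow> (cmap X k \<circ> c) differentiable (at 0)"
    and "tangent_map (interval_atlas \<epsilon>) X c (0, \<lambda>_. 1) =
      (c 0, \<lambda>k. if c 0 \<in> cdom X k then FD (cmap X k \<circ> c) 0 1 else 0)"
proof -
  interpret L: smooth_atlas "interval_atlas \<epsilon>" by (rule interval_atlas)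
  have im: "cmap (interval_atlas \<epsilon>) () ` (cdom (interval_atlas \<epsilon>) () \<inter> c -` cdom X k) =
      {t \<in> {-\<epsilon><..<\<epsilon>}. c t \<in> cdom X k}" for k
    by (auto simp: interval_atlas)
  then show op: "open {t \<in> {-\<epsilon><..<\<epsilon>}. c t \<in> cdom X k}" for k
    using c unfolding smooth_map_def by metis
  have d: "(cmap X k \<circ> c \<circ> cinv (interval_atlas \<epsilon>) ()) differentiable (at 0)" if "c 0 \<in> cdom X k" for k
    using L.smooth_map_differentiable[OF c, of 0 "()" k] that \<epsilon> by (simp add: interval_atlas)
  have eq: "(cmap X k \<circ> c) differentiable (at 0) \<and> FD (cmap X k \<circ> c) 0 = FD (cmap X k \<circ> c \<circ> cinv (interval_atlas \<epsilon>) ()) 0"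
    if "c 0 \<in> cdom X k" for k
    using FD_cong[OF d[OF that] op[of k], of "cmap X k \<circ> c"] that \<epsilon> by (simp add: interval_atlas)
  then show "c 0 \<in> cdom X k \<Longrightarrow> (cmap X k \<circ> c) differentiable (at 0)" for k by blast
  show "tangent_map (interval_atlas \<epsilon>) X c (0, \<lambda>_. 1) =
      (c 0, \<lambda>k. if c 0 \<in> cdom X k then FD (cmap X k \<circ> c) 0 1 else 0)"
    using L.tangent_map_chart[OF c _ interval_unit_tangent[OF \<epsilon>], of "()"] eq \<epsilon> by (auto simp: interval_atlas)
qed

section \<open>The energy in natural charts\<close>

definition local_energy ::
  "('a, 'i, 'e::real_normed_vector) atlas \<Rightarrow> (('a, 'i, 'e) tangent \<Rightarrow> real) \<Rightarrow> 'i \<Rightarrow> 'e \<times> 'e \<Rightarrow> real" where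
  "local_energy M F i z = energy F (cinv (TB M) i z)"

locale finsler_manifold = smooth_atlas M
  for M :: "('a, 'i, 'e::euclidean_space) atlas" +
  fixes F :: "('a, 'i, 'e) tangent \<Rightarrow> real"
  assumes finsler: "finsler M F"
begin

sublocale T: smooth_atlas "TB M"
  by (rule smooth_atlas_TB) (rule smooth_atlas_axioms)

sublocale slit: smooth_atlas "slit_TB M"
  by (rule smooth_atlas_slit_TB) (rule smooth_atlas_axioms)

abbreviation "LE \<equiv> local_energy M F"

lemma slit_tangent_space: "u \<in> points (slit_TB M) \<Longrightarrow> tangent_space (slit_TB M) u = tangent_space (TB M) u"
  unfolding slit_TB_def
  by (rule T.tangent_space_sub) (auto simp: slit_TB_image points_sub intro!: open_Times open_chart)

lemma cinv_slit_TB: "z \<in> cmap M i ` cdom M i \<times> - {0} \<Longrightarrow> cinv (slit_TB M) i z = cinv (TB M) i z"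
  using smooth_atlas_slit_TB(2)[OF smooth_atlas_axioms, of "fst z" i "snd z"] by (simp add: mem_Times_iff)

lemma slit_TB_domain: "cmap (slit_TB M) i ` cdom (slit_TB M) i = cmap M i ` cdom M i \<times> - {0}"
  using slit_TB_image[of i] by (simp add: slit_TB_def cdom_sub cmap_sub)

lemma slit_pointD:
  assumes "u \<in> points (slit_TB M)" "fst u \<in> cdom M i"
  shows "u \<in> cdom (slit_TB M) i" "u \<in> cdom (TB M) i" "snd u i \<noteq> 0"
    "(cmap M i (fst u), snd u i) \<in> cmap M i ` cdom M i \<times> - {0}"
    "cinv (TB M) i (cmap M i (fst u), snd u i) = u"
proof -
  show 1: "u \<in> cdom (slit_TB M) i" using assms by (auto simp: points_slit_TB points_TB cdom_slit_TB cdom_TB)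
  then show 2: "u \<in> cdom (TB M) i" by (simp add: cdom_slit_TB)
  have "cmap (slit_TB M) i u \<in> cmap M i ` cdom M i \<times> - {0}" using 1 unfolding slit_TB_domain[symmetric] by blast
  then show "(cmap M i (fst u), snd u i) \<in> cmap M i ` cdom M i \<times> - {0}" by (simp add: cmap_slit_TB cmap_TB)
  then show "snd u i \<noteq> 0" by auto
  show "cinv (TB M) i (cmap M i (fst u), snd u i) = u"
    using T.cinv_cmap[OF 2] by (simp add: cmap_TB)
qed

lemma slit_cinv:
  assumes "q \<in> cmap M i ` cdom M i" "x \<noteq> 0"
  shows "cinv (TB M) i (q, x) \<in> points (slit_TB M)" "fst (cinv (TB M) i (q, x)) = cinv M i q"
    "snd (cinv (TB M) i (q, x)) i = x" "cmap M i (fst (cinv (TB M) i (q, x))) = q"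
  using assms tvec_in[of "cinv M i q" i x] tvec_self[of "cinv M i q" i x] cmap_cinv[of q i]
    in_points[of "cinv M i q" M i]
  by (auto simp: cinv_TB points_slit_TB points_TB eq_tzero_iff)

lemma smooth_LE: "smooth_on (cmap M i ` cdom M i \<times> - {0}) (LE i)"
proof -
  have op: "open (cmap M i ` cdom M i \<times> (- {0::'e}))" by (intro open_Times open_chart) auto
  have "smooth_map (slit_TB M) real_line F" using finsler by (simp add: finsler_def)
  then have "smooth_on (cmap M i ` cdom M i \<times> - {0}) (cmap real_line () \<circ> F \<circ> cinv (slit_TB M) i)"
    unfolding smooth_map_def slit_TB_domain[symmetric] by (auto simp: real_line_def)
  then have "smooth_on (cmap M i ` cdom M i \<times> - {0}) (\<lambda>z. F (cinv (TB M) i z))"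
    by (rule smooth_on_cong[OF _ op]) (auto simp: real_line_def cinv_slit_TB)
  from smooth_on_bounded_linear_outer[OF bounded_linear_mult_right op
      smooth_on_bilinear[OF bounded_bilinear_mult op this this], of "1 / 2"]
  show ?thesis by (simp add: local_energy_def[abs_def] energy_def power2_eq_square)
qed

sublocale LE: slit_function "cmap M i ` cdom M i" "LE i" for i
  by unfold_locales (rule smooth_LE)

text \<open>\<open>finsler\<close> states convexity by double sums over the basis, with derivatives
  of the energy restricted to a fibre. Bilinearity of the second derivative folds these sums into
  one value on \<open>w\<close>.\<close>

lemma convex_LE:
  assumes q: "q \<in> cmap M i ` cdom M i" and u: "u \<noteq> 0" and w: "w \<noteq> 0"
  shows "FD (\<lambda>y. FD (LE i) (q, y) (0, w)) u w > 0"
proof -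
  let ?u = "cinv (TB M) i (q, u)" and ?H = "\<lambda>b. FD (\<lambda>y. FD (LE i) (q, y) (0, b)) u"
  note s = slit_cinv[OF q u]
  have "?u \<in> cdom (slit_TB M) i" using slit_pointD(1)[OF s(1)] s(2) cinv_in[OF q] by simp
  then have pos: "(\<Sum>a\<in>Basis. \<Sum>b\<in>Basis. (w \<bullet> a) * (w \<bullet> b) * fibre_hessian M (energy F) i ?u a b) > 0"
    using finsler w unfolding finsler_def by blast
  \<comment> \<open>This holds away from zero only, which is why the second derivatives are compared
    on the open set \<open>- {0}\<close> below.\<close>
  have 1: "FD (\<lambda>x. LE i (q, x)) y b = FD (LE i) (q, y) (0, b)" if "y \<noteq> 0" for y b
  proof -
    have "((\<lambda>x. (q, x)) has_derivative (\<lambda>b. (0, b))) (at y)" by (auto intro!: derivative_eq_intros)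
    from diff_chain_at[OF this LE.has_derivative_E[OF q that]]
    show ?thesis by (simp add: FD_eq o_def)
  qed
  have "fibre_hessian M (energy F) i ?u a b = ?H b a" for a b
  proof -
    have "fibre_hessian M (energy F) i ?u a b = FD (\<lambda>y. FD (\<lambda>x. LE i (q, x)) y b) u a"
      unfolding fibre_hessian_def s(3,4) local_energy_def ..
    also have "FD (\<lambda>y. FD (\<lambda>x. LE i (q, x)) y b) u = ?H b"
      by (rule FD_cong(2)[where U = "- {0}"])
        (use u 1 LE.has_derivative_grad[OF q u] in \<open>auto simp: differentiable_def\<close>)
    finally show ?thesis .
  qed
  then have "(\<Sum>a\<in>Basis. \<Sum>b\<in>Basis. (w \<bullet> a) * (w \<bullet> b) * fibre_hessian M (energy F) i ?u a b) =
      (\<Sum>a\<in>Basis. (w \<bullet> a) *\<^sub>R (\<Sum>b\<in>Basis. (w \<bullet> b) *\<^sub>R ?H b a))"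
    by (simp add: sum_distrib_left mult.assoc)
  also have "\<dots> = (\<Sum>a\<in>Basis. (w \<bullet> a) *\<^sub>R ?H w a)"
    by (intro sum.cong refl arg_cong2[where f = scaleR]
        linear_euclidean_expansion[OF LE.linear_hess[OF q u], symmetric])
  also have "\<dots> = ?H w w"
    by (rule linear_euclidean_expansion[OF has_derivative_linear[OF LE.has_derivative_grad[OF q u]], symmetric])
  finally show ?thesis using pos by simp
qed

lemma LE_scaleR:
  assumes q: "q \<in> cmap M i ` cdom M i" and u: "u \<noteq> 0" and t: "t > 0"
  shows "LE i (q, t *\<^sub>R u) = t\<^sup>2 * LE i (q, u)"
proof -
  have "cinv (TB M) i (q, t *\<^sub>R u) = tscale t (cinv (TB M) i (q, u))"
    using q by (auto simp: cinv_TB tscale_def tvec_scaleR)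
  moreover have "cinv (TB M) i (q, u) \<in> points (TB M)"
    using slit_cinv(1)[OF q u] by (simp add: points_slit_TB)
  ultimately have "F (cinv (TB M) i (q, t *\<^sub>R u)) = t * F (cinv (TB M) i (q, u))"
    using finsler t unfolding finsler_def by simp
  then show ?thesis by (simp add: local_energy_def energy_def power_mult_distrib)
qed

text \<open>Differentiate the homogeneity of degree 2 along the fibre and cancel one factor
  \<open>t\<close>. As a consequence criticality is invariant under positive scaling.\<close>

lemma FD_LE_scaleR:
  assumes q: "q \<in> cmap M i ` cdom M i" and u: "u \<noteq> 0" and t: "t > 0"
  shows "FD (LE i) (q, t *\<^sub>R u) (0, y) = t * FD (LE i) (q, u) (0, y)"
proof -
  have tu: "t *\<^sub>R u \<noteq> 0" using u t by simp
  have "((\<lambda>x. (q, t *\<^sub>R x)) has_derivative (\<lambda>y. (0, t *\<^sub>R y))) (at u)"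
    by (auto intro!: derivative_eq_intros)
  from diff_chain_at[OF this LE.has_derivative_E[OF q tu]]
  have "((\<lambda>x. LE i (q, t *\<^sub>R x)) has_derivative (\<lambda>y. FD (LE i) (q, t *\<^sub>R u) (0, t *\<^sub>R y))) (at u)"
    by (simp add: o_def)
  then have 1: "((\<lambda>x. t\<^sup>2 * LE i (q, x)) has_derivative (\<lambda>y. FD (LE i) (q, t *\<^sub>R u) (0, t *\<^sub>R y))) (at u)"
    by (rule has_derivative_transform_within_open[where s = "- {0}"]) (use u LE_scaleR[OF q _ t] in auto)
  have "((\<lambda>x. (q, x)) has_derivative (\<lambda>y. (0, y))) (at u)"
    by (auto intro!: derivative_eq_intros)
  from has_derivative_mult_right[OF diff_chain_at[OF this LE.has_derivative_E[OF q u]], of "t\<^sup>2"]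
  have "((\<lambda>x. t\<^sup>2 * LE i (q, x)) has_derivative (\<lambda>y. t\<^sup>2 * FD (LE i) (q, u) (0, y))) (at u)"
    by (simp add: o_def)
  from fun_cong[OF has_derivative_unique[OF 1 this], of y]
  have "t * FD (LE i) (q, t *\<^sub>R u) (0, y) = t * (t * FD (LE i) (q, u) (0, y))"
    using linear_cmul[OF LE.linear_E[OF q tu], of t y] by (simp add: power2_eq_square)
  then show ?thesis using t by simp
qed

lemma tderiv_slit:
  assumes u: "u \<in> points (slit_TB M)" "fst u \<in> cdom M i" and \<xi>: "\<xi> \<in> tangent_space (slit_TB M) u"
    and g: "g differentiable (at (cmap M i (fst u), snd u i))"
    and fg: "\<And>z. z \<in> cmap M i ` cdom M i \<times> - {0} \<Longrightarrow> f (cinv (TB M) i z) = g z"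
  shows "tderiv (slit_TB M) (u, \<xi>) f = FD g (cmap M i (fst u), snd u i) (\<xi> i)"
proof -
  have op: "open (cmap M i ` cdom M i \<times> (- {0::'e}))" by (intro open_Times open_chart) auto
  have "(f \<circ> cinv (slit_TB M) i) differentiable (at (cmap M i (fst u), snd u i)) \<and>
    FD (f \<circ> cinv (slit_TB M) i) (cmap M i (fst u), snd u i) = FD g (cmap M i (fst u), snd u i)"
    using FD_cong[OF g op slit_pointD(4)[OF u], of "f \<circ> cinv (slit_TB M) i"]
    using fg cinv_slit_TB by simp
  then show ?thesis
    using slit.tderiv_chart[OF slit_pointD(1)[OF u] \<xi>] by (simp add: cmap_slit_TB cmap_TB)
qed

text \<open>\<open>tderiv\<close> may be evaluated in any chart once its argument is a genuine
  tangent vector. The transition maps of \<open>TB M\<close> are linear on fibres, so their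
  derivatives keep the base part 0 and transform the fibre part like a vector of
  \<open>M\<close>.\<close>

lemma vertical_lift_in:
  assumes u: "u \<in> points (slit_TB M)" and X: "snd (X (fst u)) \<in> tangent_space M (fst u)"
  shows "snd (vertical_lift M X u) \<in> tangent_space (slit_TB M) u"
proof -
  let ?X = "snd (X (fst u))"
  have "(0, ?X k) = FD (cmap (TB M) k \<circ> cinv (TB M) j) (cmap (TB M) j u) (0, ?X j)"
    if j: "u \<in> cdom (TB M) j" and k: "u \<in> cdom (TB M) k" for j k
  proof -
    let ?q = "cmap M j (fst u)"
    have p: "fst u \<in> cdom M j" "fst u \<in> cdom M k" using j k by (auto simp: cdom_TB)
    have "((\<lambda>v. (?q, v)) has_derivative (\<lambda>y. (0, y))) (at (snd u j))"
      by (auto intro!: derivative_eq_intros)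
    from diff_chain_at[OF this T.has_derivative_tr[OF j k, unfolded cmap_TB]]
    have 1: "((\<lambda>v. T.tr j k (?q, v)) has_derivative (\<lambda>y. FD (T.tr j k) (?q, snd u j) (0, y))) (at (snd u j))"
      by (simp add: o_def cmap_TB)
    have eq: "T.tr j k (?q, v) = (tr j k ?q, FD (tr j k) ?q v)" for v
      using p by (simp add: tr_TB)
    have "bounded_linear (FD (tr j k) ?q)"
      using has_derivative_tr[OF p] has_derivative_bounded_linear by blast
    then have "((\<lambda>v. T.tr j k (?q, v)) has_derivative (\<lambda>y. (0, FD (tr j k) ?q y))) (at (snd u j))"
      unfolding eq by (intro has_derivative_Pair has_derivative_const bounded_linear_imp_has_derivative)
    from fun_cong[OF has_derivative_unique[OF 1 this], of "?X j"] show ?thesis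
      using tangent_tr[OF X p] by (simp add: cmap_TB)
  qed
  moreover have "u \<in> cdom (TB M) k \<longleftrightarrow> fst u \<in> cdom M k" for k
    using u by (auto simp: points_slit_TB points_TB cdom_TB)
  ultimately show ?thesis
    unfolding slit_tangent_space[OF u] by (auto simp: tangent_space_def vertical_lift_def zero_prod_def)
qed

text \<open>The coordinate expression of the function \<open>X\<^sup>V(E)\<close>.\<close>

definition vertical_derivative :: "'i \<Rightarrow> ('a \<Rightarrow> ('a, 'i, 'e) tangent) \<Rightarrow> 'e \<times> 'e \<Rightarrow> real" where
  "vertical_derivative i X z = FD (LE i) z (0, comps M X i (fst z))"

lemma smooth_comps:
  assumes X: "vector_field M X" shows "smooth_on (cmap M i ` cdom M i) (comps M X i)"
proof -
  have "cmap M i ` (cdom M i \<inter> X -` cdom (TB M) i) = cmap M i ` cdom M i"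
    using vector_fieldD[OF X in_points] by (force simp: cdom_TB)
  then have "smooth_on (cmap M i ` cdom M i) (cmap (TB M) i \<circ> X \<circ> cinv M i)"
    using X unfolding vector_field_def smooth_map_def by metis
  from smooth_on_snd[OF open_chart this] show ?thesis by (simp add: cmap_TB comps_def[abs_def])
qed

lemma differentiable_vertical_derivative:
  assumes X: "vector_field M X" and z: "z \<in> cmap M i ` cdom M i \<times> - {0}"
  shows "vertical_derivative i X differentiable (at z)"
proof -
  have op: "open (cmap M i ` cdom M i \<times> (- {0::'e}))" by (intro open_Times open_chart) auto
  have "smooth_on (cmap M i ` cdom M i \<times> - {0}) (vertical_derivative i X)"
    unfolding vertical_derivative_def
    by (intro LE.smooth_grad op smooth_on_id smooth_on_compose[OF smooth_comps[OF X] op] smooth_on_fst) auto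
  then show ?thesis using z by (rule smooth_on_differentiable)
qed

lemma tderiv_vertical_lift:
  assumes X: "vector_field M X" and u: "u \<in> points (slit_TB M)" "fst u \<in> cdom M i"
  shows "tderiv (slit_TB M) (vertical_lift M X u) (energy F) =
    vertical_derivative i X (cmap M i (fst u), snd u i)"
proof -
  have p: "fst u \<in> points M" using u(2) by (auto simp: points_def)
  have "tderiv (slit_TB M) (u, snd (vertical_lift M X u)) (energy F) =
      FD (LE i) (cmap M i (fst u), snd u i) (snd (vertical_lift M X u) i)"
  proof (rule tderiv_slit[OF u vertical_lift_in])
    show "LE i differentiable (at (cmap M i (fst u), snd u i))"
      using smooth_on_differentiable[OF smooth_LE slit_pointD(4)[OF u]] .
  qed (use vector_fieldD[OF X p] u in \<open>auto simp: local_energy_def\<close>)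
  then show ?thesis using u(2) by (simp add: vertical_lift_def vertical_derivative_def comps_def)
qed

text \<open>The inner derivative equals \<open>vertical_derivative i X\<close> on the whole slit
  chart and not just at \<open>u\<close>, so the outer one can be taken in coordinates.\<close>

lemma tderiv_tderiv_vertical_lift:
  assumes X: "vector_field M X" and u: "u \<in> points (slit_TB M)" "fst u \<in> cdom M i"
    and \<xi>: "\<xi> \<in> tangent_space (slit_TB M) u"
  shows "tderiv (slit_TB M) (u, \<xi>) (\<lambda>u'. tderiv (slit_TB M) (vertical_lift M X u') (energy F)) =
    FD (vertical_derivative i X) (cmap M i (fst u), snd u i) (\<xi> i)"
proof (rule tderiv_slit[OF u \<xi>])
  show "vertical_derivative i X differentiable (at (cmap M i (fst u), snd u i))"
    by (rule differentiable_vertical_derivative[OF X slit_pointD(4)[OF u]])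
  fix z assume "z \<in> cmap M i ` cdom M i \<times> - {0::'e}"
  then obtain q x where z: "z = (q, x)" "q \<in> cmap M i ` cdom M i" "x \<noteq> 0" by auto
  note s = slit_cinv[OF z(2,3)]
  show "tderiv (slit_TB M) (vertical_lift M X (cinv (TB M) i z)) (energy F) = vertical_derivative i X z"
    using tderiv_vertical_lift[OF X s(1), of i] s cinv_in[OF z(2)] z by simp
qed

end

section \<open>The horizontal manifold of a Finsler function\<close>

locale finsler_bundle =
  fixes M :: "('a, 'i, 'e::euclidean_space) atlas"
    and N :: "('b, 'j, 'd::real_normed_vector) atlas"
    and Fib :: "('c, 'k, 'f::real_normed_vector) atlas"
    and \<pi> :: "'a \<Rightarrow> 'b"
    and F :: "('a, 'i, 'e) tangent \<Rightarrow> real"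
    and h :: "'a \<times> ('b, 'j, 'd) tangent \<Rightarrow> ('a, 'i, 'e) tangent"
  assumes fibration: "fibre_bundle M N Fib \<pi>"
    and finsler: "finsler M F"
    and induced: "induced_splitting M N \<pi> F h"
begin

lemma manifold_M: "smooth_manifold M"
  and smooth_\<pi>: "smooth_map M N \<pi>"
  using fibration by (auto simp: fibre_bundle_def)

sublocale finsler_manifold M F
  by (intro finsler_manifold.intro smooth_manifold_atlas manifold_M finsler_manifold_axioms.intro finsler)

sublocale N: smooth_atlas N
  using fibration by (auto simp: fibre_bundle_def intro: smooth_manifold_atlas)

abbreviation PB where "PB \<equiv> pullback_TB M N \<pi>"
abbreviation SPB where "SPB \<equiv> slit_pullback_TB M N \<pi>"

lemma cdom_PB: "z \<in> cdom PB (i, j) \<longleftrightarrow> fst z \<in> cdom M i \<and> snd z \<in> cdom (TB N) j \<and> \<pi> (fst z) = fst (snd z)"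
  and cmap_PB: "cmap PB (i, j) z = (cmap M i (fst z), snd (snd z) j)"
  by (auto simp: pullback_TB_def split: prod.split)

lemma points_PB: "z \<in> points PB \<longleftrightarrow> fst z \<in> points M \<and> snd z \<in> points (TB N) \<and> \<pi> (fst z) = fst (snd z)"
  by (cases z) (auto simp: points_def cdom_PB)

lemma points_SPB: "z \<in> points SPB \<longleftrightarrow> z \<in> points PB \<and> snd (snd z) \<noteq> (\<lambda>_. 0)"
  by (auto simp: slit_pullback_TB_def points_sub eq_tzero_iff)

lemma cdom_SPB: "z \<in> cdom SPB k \<longleftrightarrow> z \<in> cdom PB k \<and> snd (snd z) \<noteq> (\<lambda>_. 0)"
  and cmap_SPB: "cmap SPB k = cmap PB k"
  by (auto simp: slit_pullback_TB_def cdom_sub cmap_sub eq_tzero_iff)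

lemma inj_SPB: "inj_on (cmap SPB k) (cdom SPB k)"
proof (rule inj_onI)
  fix z z' assume *: "z \<in> cdom SPB k" "z' \<in> cdom SPB k" "cmap SPB k z = cmap SPB k z'"
  obtain i j where [simp]: "k = (i, j)" by force
  have "fst z = fst z'" using * inj[of i] by (auto simp: cdom_SPB cmap_SPB cdom_PB cmap_PB inj_on_def)
  moreover from this have "snd z = snd z'"
    using * N.tangent_eqI[of "snd (snd z)" "fst (snd z)" "snd (snd z')" j]
    by (auto simp: cdom_SPB cmap_SPB cdom_PB cmap_PB cdom_TB prod_eq_iff)
  ultimately show "z = z'" by (simp add: prod_eq_iff)
qed

lemma splitting_h:
  assumes "z \<in> points PB"
  shows "h z \<in> points (TB M)" "fst (h z) = fst z" "tangent_map M N \<pi> (h z) = snd z"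
  using induced assms unfolding induced_splitting_def splitting_map_def by auto

lemma tangent_map_\<pi>:
  assumes "u \<in> points (TB M)" "fst u \<in> cdom M i"
  shows "fst (tangent_map M N \<pi> u) = \<pi> (fst u)"
    "\<pi> (fst u) \<in> cdom N j \<Longrightarrow>
      snd (tangent_map M N \<pi> u) j = FD (cmap N j \<circ> \<pi> \<circ> cinv M i) (cmap M i (fst u)) (snd u i)"
  using tangent_map_chart[OF smooth_\<pi> assms(2), of "snd u"] assms(1) by (auto simp: points_TB)

lemma tangent_map_\<pi>_in: "u \<in> points (TB M) \<Longrightarrow> tangent_map M N \<pi> u \<in> points (TB N)"
  by (rule tangent_map_in_TB[OF N.smooth_atlas_axioms smooth_\<pi>])

text \<open>A zero value of \<open>h\<close> would have zero projection, but its projection is the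
  given non-zero vector.\<close>

lemma h_slit:
  assumes z: "z \<in> points SPB" shows "h z \<in> points (slit_TB M)"
proof -
  have zP: "z \<in> points PB" using z by (simp add: points_SPB)
  note s = splitting_h[OF zP]
  have "fst z \<in> points M" using zP by (simp add: points_PB)
  then obtain i where i: "fst z \<in> cdom M i" by (auto simp: points_def)
  have "snd (h z) \<noteq> (\<lambda>_. 0)"
  proof
    assume 0: "snd (h z) = (\<lambda>_. 0)"
    have "snd (snd z) j = 0" if "\<pi> (fst z) \<in> cdom N j" for j
      using tangent_map_\<pi>(2)[OF s(1), of i j] s(2,3) i that 0
        linear_0[OF linear_frechet_derivative[OF smooth_map_differentiable[OF smooth_\<pi> i that]]] by simp
    moreover have "snd (snd z) j = 0" if "\<pi> (fst z) \<notin> cdom N j" for j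
      using zP that by (simp add: points_PB points_TB tangent_space_def)
    ultimately have "snd (snd z) = (\<lambda>_. 0)" by blast
    then show False using z by (simp add: points_SPB)
  qed
  then show ?thesis using s(1) by (simp add: points_slit_TB eq_tzero_iff)
qed

text \<open>\<open>induced_splitting\<close> prescribes zero values on zero vectors, so a non-zero
  element of \<open>Im h\<close> must come from a non-zero vector of \<open>N\<close>.\<close>

lemma h_of_horizontal:
  assumes "u \<in> horizontal_manifold M N \<pi> h" "snd u \<noteq> (\<lambda>_. 0)"
  obtains z where "z \<in> points SPB" "u = h z"
proof -
  obtain z where z: "z \<in> points PB" "u = h z" using assms(1) by (auto simp: horizontal_manifold_def)
  have "snd (snd z) \<noteq> (\<lambda>_. 0)"
  proof
    assume "snd (snd z) = (\<lambda>_. 0)"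
    then have "z = (fst z, tzero (\<pi> (fst z)))" using z by (simp add: points_PB prod_eq_iff tzero_def)
    then have "h z = tzero (fst z)" using induced z by (metis induced_splitting_def points_PB)
    then show False using z assms by (simp add: tzero_def)
  qed
  then show thesis using that z by (simp add: points_SPB)
qed

lemma vertical_derivative_h:
  assumes "z \<in> points SPB" "fst z \<in> cdom M i" "vertical_field M N \<pi> Y"
  shows "vertical_derivative i Y (cmap M i (fst z), snd (h z) i) = 0"
proof -
  have "fst (h z) = fst z" using splitting_h assms(1) by (simp add: points_SPB)
  moreover have "tderiv (slit_TB M) (vertical_lift M Y (h z)) (energy F) = 0"
    using induced assms by (auto simp: induced_splitting_def)
  ultimately show ?thesis
    using tderiv_vertical_lift[OF _ h_slit[OF assms(1)], of Y i] assms by (simp add: vertical_field_def)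
qed

end

section \<open>The splitting in an adapted chart\<close>

locale adapted_finsler_bundle = finsler_bundle M N Fib \<pi> F h + fibre_critical U "local_energy M F i" A B R J
  for M :: "('a, 'i, 'e::euclidean_space) atlas"
    and N :: "('b, 'j, 'd::real_normed_vector) atlas"
    and Fib :: "('c, 'k, 'f::real_normed_vector) atlas"
    and \<pi> :: "'a \<Rightarrow> 'b"
    and F :: "('a, 'i, 'e) tangent \<Rightarrow> real"
    and h :: "'a \<times> ('b, 'j, 'd) tangent \<Rightarrow> ('a, 'i, 'e) tangent"
    and U :: "'e set" and i :: 'i and A B :: "'e \<Rightarrow> 'e" and R :: "'e \<Rightarrow> 'd" and J :: "'d \<Rightarrow> 'e" +
  fixes j :: 'j
  assumes U_sub: "U \<subseteq> cmap M i ` (cdom M i \<inter> \<pi> -` cdom N j)"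
    and RA_eq: "x \<in> U \<Longrightarrow> R (A x) = (cmap N j \<circ> \<pi> \<circ> cinv M i) x"

lemma (in finsler_bundle) adapted:
  assumes "m \<in> cdom M i" "\<pi> m \<in> cdom N j"
  obtains U A B R J where "adapted_finsler_bundle M N Fib \<pi> F h U i A B R J j" "cmap M i m \<in> U"
proof -
  obtain U A B R J where *: "open U" "cmap M i m \<in> U" "U \<subseteq> cmap M i ` (cdom M i \<inter> \<pi> -` cdom N j)"
    "smooth_on U A" "open (A ` U)" "smooth_on (A ` U) (B :: 'e \<Rightarrow> 'e)" "\<And>x. x \<in> U \<Longrightarrow> B (A x) = x"
    "bounded_linear R" "bounded_linear J" "\<And>v. R (J v) = v"
    "\<And>x. x \<in> U \<Longrightarrow> R (A x) = (cmap N j \<circ> \<pi> \<circ> cinv M i) x"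
    using adapted_chart[OF fibration assms] by blast
  have sub: "U \<subseteq> cmap M i ` cdom M i" using *(3) by auto
  have "fibre_critical U (LE i) A B R J"
  proof (intro fibre_critical.intro slit_function.intro fibre_critical_axioms.intro)
    show "smooth_on (U \<times> - {0}) (LE i)"
      by (rule smooth_on_subset[OF smooth_LE]) (use sub in auto)
    show "0 < FD (\<lambda>y. FD (LE i) (q, y) (0, w)) u w" if "q \<in> U" "u \<noteq> 0" "w \<noteq> 0" for q u w
      using convex_LE that sub by blast
  qed (use * in auto)
  then have "adapted_finsler_bundle M N Fib \<pi> F h U i A B R J j"
    using * finsler_bundle_axioms
    by (auto intro!: adapted_finsler_bundle.intro adapted_finsler_bundle_axioms.intro)
  then show thesis using that *(2) by blast
qed

context adapted_finsler_bundle
begin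

lemma U_chart: "U \<subseteq> cmap M i ` cdom M i"
  using U_sub by auto

lemma cinv_U: "q \<in> U \<Longrightarrow> cinv M i q \<in> cdom M i" "q \<in> U \<Longrightarrow> \<pi> (cinv M i q) \<in> cdom N j"
  "q \<in> U \<Longrightarrow> cmap M i (cinv M i q) = q"
  using U_sub cinv_cmap by (force dest: subsetD[OF U_sub])+

lemma FD_\<pi>:
  assumes "q \<in> U" shows "FD (cmap N j \<circ> \<pi> \<circ> cinv M i) q y = R (FD A q y)"
proof -
  have 1: "((\<lambda>x. R (A x)) has_derivative (\<lambda>y. R (FD A q y))) (at q)"
    by (rule bounded_linear.has_derivative[OF R has_derivative_A[OF assms]])
  then have "(cmap N j \<circ> \<pi> \<circ> cinv M i has_derivative (\<lambda>y. R (FD A q y))) (at q)"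
    by (rule has_derivative_transform_within_open[OF _ open_U assms]) (rule RA_eq)
  from FD_eq[OF this] show ?thesis by simp
qed

text \<open>On \<open>U\<close> the derivative of \<pi> sends \<open>vert a\<close> to
  \<open>R a = 0\<close>, and outside the image of \<open>U\<close> the extended field is zero, so
  it is vertical everywhere.\<close>

lemma vertical_frame:
  assumes a: "R a = 0" and q: "q \<in> U"
  obtains \<rho> Y where "smooth_on UNIV \<rho>" "\<rho> q > (0::real)" "vertical_field M N \<pi> Y"
    "\<And>x. x \<in> U \<Longrightarrow> comps M Y i x = \<rho> x *\<^sub>R vert a x"
proof -
  obtain \<rho> Y where \<rho>: "smooth_on UNIV \<rho>" "\<rho> q > (0::real)" and Y: "vector_field M Y"
    "\<And>x. x \<in> U \<Longrightarrow> snd (Y (cinv M i x)) i = \<rho> x *\<^sub>R vert a x"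
    "\<And>p. p \<in> points M \<Longrightarrow> p \<notin> cinv M i ` U \<Longrightarrow> Y p = tzero p"
    using local_field_extension[OF manifold_M open_U U_chart smooth_vert q] by metis
  have "tangent_map M N \<pi> (Y p) = tzero (\<pi> p)" if p: "p \<in> points M" for p
  proof -
    have Yp: "Y p \<in> points (TB M)" "fst (Y p) = p" using vector_fieldD[OF Y(1) p] p by (auto simp: points_TB)
    obtain k where k: "p \<in> cdom M k" using p by (auto simp: points_def)
    note t = tangent_map_\<pi>[OF Yp(1), unfolded Yp(2)] tangent_map_\<pi>_in[OF Yp(1)]
    have "snd (tangent_map M N \<pi> (Y p)) = (\<lambda>_. 0)"
    proof (cases "p \<in> cinv M i ` U")
      case True
      then obtain x where x: "x \<in> U" "p = cinv M i x" by auto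
      \<comment> \<open>Chart \<open>j\<close> suffices, because a tangent vector with one zero
        component in a chart around its base point is zero.\<close>
      have "snd (tangent_map M N \<pi> (Y p)) j = 0"
        using t(2)[of i j] cinv_U[OF x(1)] Y(2)[OF x(1)] x A_vert[OF x(1)] a
        by (simp add: FD_\<pi> linear_cmul[OF linear_A] linear_cmul[OF linear_R])
      moreover have "snd (tangent_map M N \<pi> (Y p)) \<in> tangent_space N (\<pi> p)"
        using t(3) t(1)[OF k] by (auto simp: points_TB)
      ultimately show ?thesis
        using N.tangent_zero_iff cinv_U(2)[OF x(1)] x(2) by blast
    next
      case False
      have "snd (tangent_map M N \<pi> (Y p)) l = 0" if "\<pi> p \<in> cdom N l" for l
        using t(2)[OF k that] Y(3)[OF p False]
          linear_0[OF linear_frechet_derivative[OF smooth_map_differentiable[OF smooth_\<pi> k that]]]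
        by (simp add: tzero_def)
      moreover have "snd (tangent_map M N \<pi> (Y p)) l = 0" if "\<pi> p \<notin> cdom N l" for l
        using t(3) t(1)[OF k] that by (auto simp: points_TB tangent_space_def)
      ultimately show ?thesis by blast
    qed
    then show ?thesis using t(1)[OF k] by (simp add: tzero_def prod_eq_iff)
  qed
  then have "vertical_field M N \<pi> Y" using Y(1) by (simp add: vertical_field_def)
  then show thesis using that \<rho> Y(2) by (simp add: comps_def)
qed

text \<open>\<open>h\<close> is characterised by global vertical fields. Each \<open>y\<close> in
  the kernel is, up to the positive factor \<open>\<rho> ?q\<close>, the value of such a field at
  the base point, so that characterisation is pointwise criticality.\<close>

lemma crit_h:
  assumes z: "z \<in> points SPB" and q: "cmap M i (fst z) \<in> U" "fst z \<in> cdom M i"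
  shows "crit (cmap M i (fst z)) (snd (h z) i)"
    and "R (FD A (cmap M i (fst z)) (snd (h z) i)) = snd (snd z) j"
    and "snd (snd z) j \<noteq> 0"
proof -
  let ?q = "cmap M i (fst z)"
  have zP: "z \<in> points PB" using z by (simp add: points_SPB)
  note s = splitting_h[OF zP]
  have \<pi>j: "\<pi> (fst z) \<in> cdom N j" using cinv_U(2)[OF q(1)] q(2) by simp
  show "R (FD A ?q (snd (h z) i)) = snd (snd z) j"
    using tangent_map_\<pi>(2)[OF s(1), of i j] s(2,3) q \<pi>j FD_\<pi>[OF q(1)] by simp
  have "snd (snd z) \<in> tangent_space N (\<pi> (fst z))" using zP by (auto simp: points_PB points_TB)
  then show "snd (snd z) j \<noteq> 0" using N.tangent_zero_iff \<pi>j z by (auto simp: points_SPB)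
  have nz: "snd (h z) i \<noteq> 0" using slit_pointD(3)[OF h_slit[OF z]] s(2) q by simp
  show "crit ?q (snd (h z) i)"
    unfolding crit_def
  proof (intro allI impI)
    fix y assume "R (FD A ?q y) = 0"
    then obtain \<rho> Y where Y: "\<rho> ?q > (0::real)" "vertical_field M N \<pi> Y"
      "\<And>x. x \<in> U \<Longrightarrow> comps M Y i x = \<rho> x *\<^sub>R vert (FD A ?q y) x"
      using vertical_frame[OF _ q(1)] by metis
    have "FD (LE i) (?q, snd (h z) i) (0, \<rho> ?q *\<^sub>R y) = 0"
      using vertical_derivative_h[OF z q(2) Y(2)] Y(3)[OF q(1)] vert_A[OF q(1)]
      by (simp add: vertical_derivative_def)
    then show "FD (LE i) (?q, snd (h z) i) (0, y) = 0"
      using linear_cmul[OF linear_E[OF q(1) nz]] Y(1) by simp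
  qed
qed

text \<open>Recognises values of \<open>h\<close>: criticality and projection determine the
  component in chart \<open>i\<close>, which in turn determines the tangent vector.\<close>

lemma h_eqI:
  assumes u: "u \<in> points (TB M)" and q: "cmap M i (fst u) \<in> U" "fst u \<in> cdom M i"
    and z: "z \<in> points SPB" "fst z = fst u" "R (FD A (cmap M i (fst u)) (snd u i)) = snd (snd z) j"
    and c: "crit (cmap M i (fst u)) (snd u i)"
  shows "h z = u"
proof -
  note hz = crit_h[OF z(1), unfolded z(2), OF q]
  have "snd (h z) i = snd u i"
    by (rule crit_unique[OF q(1) hz(2) z(3) hz(3) hz(1) c])
  moreover have "h z \<in> points (TB M)" "fst (h z) = fst u"
    using splitting_h z(1,2) by (auto simp: points_SPB)
  ultimately show ?thesis
    using u tangent_eqI[of "snd (h z)" "fst u" "snd u" i] q(2) by (auto simp: points_TB prod_eq_iff)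
qed

lemma smooth_h_adapted:
  shows "U \<times> - {0} \<subseteq> cmap SPB (i, j) ` (cdom SPB (i, j) \<inter> h -` cdom (TB M) i)"
    and "smooth_on (U \<times> - {0}) (cmap (TB M) i \<circ> h \<circ> cinv SPB (i, j))"
proof -
  have *: "\<exists>z. z \<in> cdom SPB (i, j) \<and> cmap SPB (i, j) z = (q, v) \<and> cinv SPB (i, j) (q, v) = z \<and>
     z \<in> points SPB \<and> fst z \<in> cdom M i \<and> cmap M i (fst z) = q \<and> snd (snd z) j = v" if "q \<in> U" "v \<noteq> 0" for q v
  proof -
    let ?m = "cinv M i q"
    let ?z = "(?m, (\<pi> ?m, N.tvec j (\<pi> ?m) v))"
    note c = cinv_U[OF that(1)]
    have v: "N.tvec j (\<pi> ?m) v j = v" using N.tvec_self[OF c(2)] .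
    have 1: "?z \<in> cdom SPB (i, j)"
      using c N.tvec_in[OF c(2)] v that by (auto simp: cdom_SPB cdom_PB cdom_TB dest: fun_cong)
    moreover have 2: "cmap SPB (i, j) ?z = (q, v)" using c v by (simp add: cmap_SPB cmap_PB)
    moreover have "cinv SPB (i, j) (q, v) = ?z" using cinv_cmap_inj[OF inj_SPB 1] 2 by simp
    ultimately show ?thesis using in_points[OF 1] c v by (intro exI[of _ ?z]) simp
  qed
  have sub: "h z \<in> cdom (TB M) i \<and> fst (h z) = fst z" if "z \<in> points SPB" "fst z \<in> cdom M i" for z
    using splitting_h[of z] that by (auto simp: points_SPB points_TB cdom_TB)
  show "U \<times> - {0} \<subseteq> cmap SPB (i, j) ` (cdom SPB (i, j) \<inter> h -` cdom (TB M) i)"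
  proof
    fix y assume "y \<in> U \<times> - {0::'d}"
    then obtain q v where "y = (q, v)" "q \<in> U" "v \<noteq> 0" by auto
    with *[of q v] sub show "y \<in> cmap SPB (i, j) ` (cdom SPB (i, j) \<inter> h -` cdom (TB M) i)"
      by (metis IntI imageI vimageI)
  qed
  have op: "open (U \<times> (- {0::'d}))" using open_U by (auto intro: open_Times)
  have "smooth_on (U \<times> - {0}) (\<lambda>y. snd (h (cinv SPB (i, j) y)) i)"
  proof (rule smooth_crit)
    fix q v assume "q \<in> U" "v \<noteq> (0::'d)"
    from *[OF this] this crit_h
    show "crit q (snd (h (cinv SPB (i, j) (q, v))) i) \<and> R (FD A q (snd (h (cinv SPB (i, j) (q, v))) i)) = v"
      by metis
  qed
  from smooth_on_Pair[OF op smooth_on_fst[OF op smooth_on_id[OF op]] this]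
  show "smooth_on (U \<times> - {0}) (cmap (TB M) i \<circ> h \<circ> cinv SPB (i, j))"
  proof (rule smooth_on_cong[OF _ op])
    fix y assume "y \<in> U \<times> - {0::'d}"
    then obtain q v where "y = (q, v)" "q \<in> U" "v \<noteq> 0" by auto
    with *[of q v] sub show "(fst y, snd (h (cinv SPB (i, j) y)) i) = (cmap (TB M) i \<circ> h \<circ> cinv SPB (i, j)) y"
      by (auto simp: cmap_TB)
  qed
qed

end

context finsler_bundle
begin

lemma points_PB_adapted:
  assumes "z \<in> points PB"
  obtains i j U A B R J where "fst z \<in> cdom M i" "\<pi> (fst z) \<in> cdom N j" "cmap M i (fst z) \<in> U"
    "adapted_finsler_bundle M N Fib \<pi> F h U i A B R J j"
proof -
  have "fst z \<in> points M" "\<pi> (fst z) \<in> points N" using assms by (auto simp: points_PB points_TB)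
  then obtain i j where "fst z \<in> cdom M i" "\<pi> (fst z) \<in> cdom N j" by (auto simp: points_def)
  then show thesis using adapted that by metis
qed

lemma nonlinear_splitting_h: "nonlinear_splitting M N \<pi> h"
proof -
  have "smooth_map SPB (TB M) h"
  proof (rule smooth_mapI_local[OF T.smooth_atlas_axioms _ _ inj_SPB])
    show "h ` points SPB \<subseteq> points (TB M)" using splitting_h(1) by (auto simp: points_SPB)
    fix k z assume z: "z \<in> cdom SPB k"
    obtain i j where [simp]: "k = (i, j)" by force
    have ij: "fst z \<in> cdom M i" "\<pi> (fst z) \<in> cdom N j" using z by (auto simp: cdom_SPB cdom_PB cdom_TB)
    obtain U A B R J where ad: "adapted_finsler_bundle M N Fib \<pi> F h U i A B R J j" and x: "cmap M i (fst z) \<in> U"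
      using adapted[OF ij] by blast
    interpret ad: adapted_finsler_bundle M N Fib \<pi> F h U i A B R J j by (rule ad)
    have "cmap SPB k z \<in> U \<times> - {0}"
      using ad.crit_h(3)[OF in_points[OF z] x ij(1)] x by (simp add: cmap_SPB cmap_PB)
    moreover have "open (U \<times> (- {0::'d}))" using ad.open_U by (auto intro: open_Times)
    ultimately show "\<exists>i V. open V \<and> cmap SPB k z \<in> V \<and> V \<subseteq> cmap SPB k ` (cdom SPB k \<inter> h -` cdom (TB M) i) \<and>
        smooth_on V (cmap (TB M) i \<circ> h \<circ> cinv SPB k)"
      using ad.smooth_h_adapted by (intro exI[of _ i] exI[of _ "U \<times> - {0}"]) simp
  qed
  then show ?thesis using induced by (simp add: nonlinear_splitting_def induced_splitting_def)
qed

text \<open>Scaling by \<open>t\<close> preserves criticality and multiplies the projection by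
  \<open>t\<close>, so the scaled vector is the critical point over the scaled projection. On zero
  vectors both sides are zero by the prescribed value of \<open>h\<close>.\<close>

lemma homogeneous_splitting_h: "homogeneous_splitting M N \<pi> h"
  unfolding homogeneous_splitting_def
proof (clarify)
  fix m :: 'a and w :: "('b, 'j, 'd) tangent" and t :: real
  assume z: "(m, w) \<in> points PB" and t: "t > 0"
  show "h (m, tscale t w) = tscale t (h (m, w))"
  proof (cases "snd w = (\<lambda>_. 0)")
    case True
    then have w: "w = tzero (\<pi> m)" using z by (simp add: points_PB tzero_def prod_eq_iff)
    have "m \<in> points M" using z by (simp add: points_PB)
    then have "h (m, tzero (\<pi> m)) = tzero m"
      using induced unfolding induced_splitting_def by blast
    then show ?thesis unfolding w by (simp add: tscale_def tzero_def)
  next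
    case False
    then have zS: "(m, w) \<in> points SPB" using z by (simp add: points_SPB)
    obtain i j U A B R J where m: "m \<in> cdom M i" "\<pi> m \<in> cdom N j" "cmap M i m \<in> U"
      and ad: "adapted_finsler_bundle M N Fib \<pi> F h U i A B R J j" using points_PB_adapted[OF z, unfolded fst_conv] .
    interpret ad: adapted_finsler_bundle M N Fib \<pi> F h U i A B R J j by (rule ad)
    note hz = ad.crit_h[OF zS, simplified, OF m(3,1)]
    have hm: "h (m, w) \<in> points (TB M)" "fst (h (m, w)) = m" using splitting_h[OF z] by auto
    have nz: "snd (h (m, w)) i \<noteq> 0" using slit_pointD(3)[OF h_slit[OF zS]] hm(2) m(1) by simp
    show ?thesis
    proof (rule ad.h_eqI)
      show "tscale t (h (m, w)) \<in> points (TB M)" using hm scaleR_in_tangent by (auto simp: points_TB tscale_def)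
      show "(m, tscale t w) \<in> points SPB"
        using zS t N.scaleR_in_tangent[of "snd w" "fst w" t] by (auto simp: points_SPB points_PB points_TB tscale_def fun_eq_iff)
      show "R (FD A (cmap M i (fst (tscale t (h (m, w))))) (snd (tscale t (h (m, w))) i)) = snd (snd (m, tscale t w)) j"
        using hz(2) linear_cmul[OF ad.linear_RA[OF m(3)]] by (simp add: tscale_def hm)
      show "ad.crit (cmap M i (fst (tscale t (h (m, w))))) (snd (tscale t (h (m, w))) i)"
        using hz(1) FD_LE_scaleR[OF _ nz t] m(1) by (simp add: tscale_def hm ad.crit_def)
    qed (use m hm in \<open>auto simp: tscale_def\<close>)
  qed
qed

section \<open>Tangency to the horizontal manifold\<close>

lemma curve_lift:
  assumes \<epsilon>: "\<epsilon> > 0" and \<gamma>: "smooth_on {-\<epsilon><..<\<epsilon>} \<gamma>"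
    and im: "\<And>t. t \<in> {-\<epsilon><..<\<epsilon>} \<Longrightarrow> fst (\<gamma> t) \<in> cmap M i ` cdom M i"
  shows "smooth_map (interval_atlas \<epsilon>) (TB M) (\<lambda>t. cinv (TB M) i (\<gamma> t))"
proof -
  let ?I = "{-\<epsilon><..<\<epsilon>}" and ?c = "\<lambda>t. cinv (TB M) i (\<gamma> t)"
  have dom: "\<gamma> t \<in> cmap (TB M) i ` cdom (TB M) i" if "t \<in> ?I" for t
    unfolding cmap_TB_chart using im[OF that] by (simp add: mem_Times_iff)
  have c: "?c t \<in> cdom (TB M) i" "cmap (TB M) i (?c t) = \<gamma> t" if "t \<in> ?I" for t
    using T.cinv_in[OF dom[OF that]] T.cmap_cinv[OF dom[OF that]] by auto
  show ?thesis
  proof (rule smooth_mapI_local[OF T.smooth_atlas_axioms])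
    show "?c ` points (interval_atlas \<epsilon>) \<subseteq> points (TB M)"
      using in_points[OF c(1)] by (auto simp: points_def[of "interval_atlas \<epsilon>"] interval_atlas(2))
    show "inj_on (cmap (interval_atlas \<epsilon>) a) (cdom (interval_atlas \<epsilon>) a)" for a
      by (auto simp: inj_on_def interval_atlas(3))
    fix a t assume "t \<in> cdom (interval_atlas \<epsilon>) a"
    then have t: "t \<in> ?I" by (simp add: interval_atlas(2))
    have "smooth_on ?I (cmap (TB M) i \<circ> ?c \<circ> cinv (interval_atlas \<epsilon>) a)"
      by (rule smooth_on_cong[OF \<gamma>]) (simp_all add: interval_atlas(4) c(2))
    moreover have "?I \<subseteq> cmap (interval_atlas \<epsilon>) a ` (cdom (interval_atlas \<epsilon>) a \<inter> ?c -` cdom (TB M) i)"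
      using c(1) by (auto simp: interval_atlas(2,3))
    ultimately show "\<exists>i V. open V \<and> cmap (interval_atlas \<epsilon>) a t \<in> V \<and>
        V \<subseteq> cmap (interval_atlas \<epsilon>) a ` (cdom (interval_atlas \<epsilon>) a \<inter> ?c -` cdom (TB M) i) \<and>
        smooth_on V (cmap (TB M) i \<circ> ?c \<circ> cinv (interval_atlas \<epsilon>) a)"
      using t by (intro exI[of _ i] exI[of _ ?I]) (simp add: interval_atlas(3))
  qed
qed

text \<open>Along a curve in \<open>Im h\<close> the function \<open>Y\<^sup>V(E)\<close> vanishes
  near time 0, hence so does its derivative in the direction of the velocity.\<close>

lemma tangent_imp_vertical_derivative:
  assumes z: "z \<in> points SPB" "fst z \<in> cdom M i" and Y: "vertical_field M N \<pi> Y"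
    and tan: "(h z, \<xi>) \<in> tangent_to_subset (TB M) (horizontal_manifold M N \<pi> h)"
  shows "FD (vertical_derivative i Y) (cmap M i (fst z), snd (h z) i) (\<xi> i) = 0"
proof -
  let ?V = "vertical_derivative i Y" and ?x = "(cmap M i (fst z), snd (h z) i)"
  have hz: "h z \<in> points (slit_TB M)" by (rule h_slit[OF z(1)])
  have fz: "fst (h z) = fst z" using splitting_h(2) z(1) by (simp add: points_SPB)
  note sp = slit_pointD[OF hz, unfolded fz, OF z(2)]
  obtain \<epsilon> c where \<epsilon>: "\<epsilon> > 0" and c: "smooth_map (interval_atlas \<epsilon>) (TB M) c"
    "c ` {-\<epsilon><..<\<epsilon>} \<subseteq> horizontal_manifold M N \<pi> h"
    "tangent_map (interval_atlas \<epsilon>) (TB M) c (0, \<lambda>_. 1) = (h z, \<xi>)"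
    using tan unfolding tangent_to_subset_def by blast
  note tm = tangent_map_curve[OF c(1) \<epsilon>]
  have c0: "c 0 = h z" and \<xi>: "\<xi> = (\<lambda>k. if c 0 \<in> cdom (TB M) k then FD (cmap (TB M) k \<circ> c) 0 1 else 0)"
    using tm(3) c(3) by auto
  have c0i: "c 0 \<in> cdom (TB M) i" using c0 sp(2) by simp
  let ?g = "cmap (TB M) i \<circ> c"
  have dg: "(?g has_derivative FD ?g 0) (at 0)" using FD_works[OF tm(2)[OF c0i]] .
  have g0: "?g 0 = ?x" by (simp add: c0 cmap_TB fz)
  have "(?V has_derivative FD ?V ?x) (at (?g 0))"
    unfolding g0 using FD_works[OF differentiable_vertical_derivative[OF _ sp(4)]] Y
    by (simp add: vertical_field_def)
  from diff_chain_at[OF dg this]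
  have d: "(?V \<circ> ?g has_derivative FD ?V ?x \<circ> FD ?g 0) (at 0)" .
  \<comment> \<open>\<open>Im h\<close> also contains zero vectors, where the defining condition of
    \<open>h\<close> says nothing about \<open>Y\<^sup>V(E)\<close>; by continuity the curve avoids
    them for small times.\<close>
  have "continuous (at 0) (\<lambda>t. snd (?g t))"
    using has_derivative_continuous[OF dg] by (rule continuous_snd)
  moreover have "snd (?g 0) \<noteq> 0" using sp(3) g0 by simp
  ultimately have "\<forall>\<^sub>F t in at 0. snd (?g t) \<noteq> 0"
    unfolding continuous_at by (rule tendsto_imp_eventually_ne)
  moreover have "\<forall>\<^sub>F t in at 0. t \<in> {t \<in> {-\<epsilon><..<\<epsilon>}. c t \<in> cdom (TB M) i}"
    using tm(1)[of i] c0i \<epsilon> by (intro eventually_at_in_open') auto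
  ultimately have "\<forall>\<^sub>F t in at 0. (?V \<circ> ?g) t = 0"
  proof eventually_elim
    case (elim t)
    then have t: "t \<in> {-\<epsilon><..<\<epsilon>}" "c t \<in> cdom (TB M) i" "snd (c t) i \<noteq> 0" by (auto simp: cmap_TB)
    then have "c t \<in> horizontal_manifold M N \<pi> h" "snd (c t) \<noteq> (\<lambda>_. 0)" using c(2) by auto
    then obtain z' where z': "z' \<in> points SPB" "c t = h z'" by (rule h_of_horizontal)
    moreover from z' have "fst (h z') = fst z'" using splitting_h(2) by (simp add: points_SPB)
    ultimately show ?case using vertical_derivative_h[OF z'(1) _ Y, of i] t(2) by (simp add: cmap_TB cdom_TB)
  qed
  \<comment> \<open>The filter \<open>at 0\<close> omits time 0 itself, which has to be added to
    obtain a full neighbourhood.\<close>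
  moreover have "(?V \<circ> ?g) 0 = 0" using vertical_derivative_h[OF z Y] g0 by simp
  ultimately have "\<forall>\<^sub>F t in nhds 0. (?V \<circ> ?g) t = 0" by (simp add: eventually_nhds_conv_at)
  then obtain S where S: "open S" "0 \<in> S" "\<And>t. t \<in> S \<Longrightarrow> (?V \<circ> ?g) t = 0"
    unfolding eventually_nhds by blast
  have "((\<lambda>t. 0) has_derivative FD ?V ?x \<circ> FD ?g 0) (at 0)"
    by (rule has_derivative_transform_within_open[OF d S(1,2)]) (rule S(3))
  from has_derivative_unique[OF has_derivative_const this] have "FD ?V ?x (FD ?g 0 1) = 0"
    by (metis comp_apply)
  then show ?thesis using c0i by (simp add: \<xi>)
qed

text \<open>In an adapted chart the condition on global fields becomes the hypothesis of
  \<open>crit_curve\<close>, and the resulting curve stays in \<open>Im h\<close> by uniqueness of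
  critical points. The condition ranges over all charts because the adapted one is chosen inside the
  proof.\<close>

lemma vertical_derivative_imp_tangent:
  assumes z: "z \<in> points SPB" and \<xi>: "\<xi> \<in> tangent_space (slit_TB M) (h z)"
    and van: "\<And>i Y. fst z \<in> cdom M i \<Longrightarrow> vertical_field M N \<pi> Y \<Longrightarrow>
      FD (vertical_derivative i Y) (cmap M i (fst z), snd (h z) i) (\<xi> i) = 0"
  shows "(h z, \<xi>) \<in> tangent_to_subset (TB M) (horizontal_manifold M N \<pi> h)"
proof -
  have zP: "z \<in> points PB" using z by (simp add: points_SPB)
  obtain i j U A B R J where m: "fst z \<in> cdom M i" "\<pi> (fst z) \<in> cdom N j" "cmap M i (fst z) \<in> U"
    and ad: "adapted_finsler_bundle M N Fib \<pi> F h U i A B R J j"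
    using points_PB_adapted[OF zP] .
  interpret ad: adapted_finsler_bundle M N Fib \<pi> F h U i A B R J j by (rule ad)
  have hz: "h z \<in> points (slit_TB M)" by (rule h_slit[OF z])
  have fz: "fst (h z) = fst z" using splitting_h(2)[OF zP] .
  note sp = slit_pointD[OF hz, unfolded fz, OF m(1)]
  note ch = ad.crit_h[OF z m(3,1)]
  let ?q = "cmap M i (fst z)" and ?u = "snd (h z) i"
  have x: "(?q, ?u) \<in> ad.Dom" using m(3) ch(2,3) by (simp add: ad.Dom_def)
  have crit': "FD (\<lambda>z. FD (LE i) z (0, ad.vert a (fst z))) (?q, ?u) (\<xi> i) = 0" if a: "R a = 0" for a
  proof -
    let ?K = "\<lambda>z. FD (LE i) z (0, ad.vert a (fst z))"
    obtain \<rho> Y where \<rho>: "smooth_on UNIV \<rho>" "\<rho> ?q > (0::real)" and Y: "vertical_field M N \<pi> Y"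
      "\<And>x. x \<in> U \<Longrightarrow> comps M Y i x = \<rho> x *\<^sub>R ad.vert a x"
      using ad.vertical_frame[OF a m(3)] by metis
    \<comment> \<open>Criticality removes the term containing the derivative of
      \<open>\<rho>\<close> from the product rule, so the cut-off field still tests the first
      derivative of \<open>?K\<close>.\<close>
    have K0: "?K (?q, ?u) = 0"
      using ch(1) ad.A_vert[OF m(3)] a by (simp add: ad.crit_def)
    have "(?K has_derivative FD ?K (?q, ?u)) (at (?q, ?u))"
      by (rule smooth_on_has_derivative[OF ad.smooth_vert_E]) (use m(3) sp(3) in auto)
    moreover have "((\<lambda>z. \<rho> (fst z)) has_derivative (\<lambda>v. FD \<rho> ?q (fst v))) (at (?q, ?u))"
      using diff_chain_at[OF has_derivative_fst[OF has_derivative_ident], of \<rho> "FD \<rho> ?q" "(?q, ?u)"]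
        smooth_on_has_derivative[OF \<rho>(1)] by (simp add: o_def)
    ultimately have "((\<lambda>z. \<rho> (fst z) * ?K z) has_derivative
        (\<lambda>v. \<rho> ?q * FD ?K (?q, ?u) v + FD \<rho> ?q (fst v) * ?K (?q, ?u))) (at (?q, ?u))"
      using has_derivative_mult[of "\<lambda>z. \<rho> (fst z)" _ "(?q, ?u)" UNIV ?K] by simp
    then have "((\<lambda>z. \<rho> (fst z) * ?K z) has_derivative (\<lambda>v. \<rho> ?q * FD ?K (?q, ?u) v)) (at (?q, ?u))"
      using K0 by simp
    then have "(vertical_derivative i Y has_derivative (\<lambda>v. \<rho> ?q * FD ?K (?q, ?u) v)) (at (?q, ?u))"
    proof (rule has_derivative_transform_within_open)
      show "open (U \<times> (- {0::'e}))" using ad.open_U by (auto intro: open_Times)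
      show "(?q, ?u) \<in> U \<times> - {0}" using m(3) sp(3) by simp
      fix y assume "y \<in> U \<times> - {0::'e}"
      then obtain q u where y: "y = (q, u)" "q \<in> U" "u \<noteq> 0" by auto
      then show "\<rho> (fst y) * ?K y = vertical_derivative i Y y"
        using linear_cmul[OF ad.linear_E[OF y(2,3)], of "\<rho> q"] Y(2)[OF y(2)]
        by (simp add: vertical_derivative_def)
    qed
    from FD_eq[OF this] van[OF m(1) Y(1)] \<rho>(2) show ?thesis by simp
  qed
  obtain \<epsilon> \<gamma> where \<epsilon>: "\<epsilon> > 0" and \<gamma>: "smooth_on {-\<epsilon><..<\<epsilon>} \<gamma>" "\<gamma> 0 = (?q, ?u)"
    "\<And>t. t \<in> {-\<epsilon><..<\<epsilon>} \<Longrightarrow> \<gamma> t \<in> ad.Dom \<and> ad.crit (fst (\<gamma> t)) (snd (\<gamma> t))"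
    "(\<gamma> has_derivative (\<lambda>t. t *\<^sub>R \<xi> i)) (at 0)"
    by (rule ad.crit_curve[OF x ch(1)], erule crit') blast
  let ?I = "{-\<epsilon><..<\<epsilon>}" and ?c = "\<lambda>t. cinv (TB M) i (\<gamma> t)"
  have \<gamma>U: "fst (\<gamma> t) \<in> U" "snd (\<gamma> t) \<noteq> 0" "R (FD A (fst (\<gamma> t)) (snd (\<gamma> t))) \<noteq> 0" if "t \<in> ?I" for t
    using ad.nonzero_Dom[of "fst (\<gamma> t)" "snd (\<gamma> t)"] \<gamma>(3)[OF that] by auto
  have \<gamma>O: "fst (\<gamma> t) \<in> cmap M i ` cdom M i" if "t \<in> ?I" for t
    using \<gamma>U(1)[OF that] ad.U_chart by blast
  have sm: "smooth_map (interval_atlas \<epsilon>) (TB M) ?c"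
    by (rule curve_lift[OF \<epsilon> \<gamma>(1) \<gamma>O])
  have c: "?c t \<in> points (slit_TB M)" "fst (?c t) = cinv M i (fst (\<gamma> t))" "cmap M i (fst (?c t)) = fst (\<gamma> t)"
    "snd (?c t) i = snd (\<gamma> t)" if "t \<in> ?I" for t
    using slit_cinv[OF \<gamma>O[OF that] \<gamma>U(2)[OF that]] by auto
  have hor: "?c t \<in> horizontal_manifold M N \<pi> h" if t: "t \<in> ?I" for t
  proof -
    \<comment> \<open>The preimage under \<open>h\<close> can only be the base point paired with the
      projection of \<open>?c t\<close>.\<close>
    let ?p = "fst (?c t)" and ?w = "tangent_map M N \<pi> (?c t)"
    have p: "?p \<in> cdom M i" "\<pi> ?p \<in> cdom N j"
      using ad.cinv_U(1,2)[OF \<gamma>U(1)[OF t]] c(2)[OF t] by auto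
    have cT: "?c t \<in> points (TB M)" using c(1)[OF t] by (simp add: points_slit_TB)
    have wj: "snd ?w j = R (FD A (fst (\<gamma> t)) (snd (\<gamma> t)))"
      using tangent_map_\<pi>(2)[OF cT p] ad.FD_\<pi>[OF \<gamma>U(1)[OF t]] c[OF t] by simp
    then have "snd ?w \<noteq> (\<lambda>_. 0)" using \<gamma>U(3)[OF t] by auto
    then have zS: "(?p, ?w) \<in> points SPB"
      using tangent_map_\<pi>_in[OF cT] tangent_map_\<pi>(1)[OF cT p(1)] in_points[OF p(1)]
      by (simp add: points_SPB points_PB)
    have "h (?p, ?w) = ?c t"
      by (rule ad.h_eqI[OF cT _ p(1) zS]) (use c[OF t] \<gamma>U(1)[OF t] \<gamma>(3)[OF t] wj in auto)
    then show ?thesis using zS by (force simp: horizontal_manifold_def points_SPB)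
  qed
  note tm = tangent_map_curve[OF sm \<epsilon>]
  have I0: "0 \<in> ?I" using \<epsilon> by simp
  have c0: "?c 0 = h z" using sp(5) \<gamma>(2) by simp
  have "(cmap (TB M) i \<circ> ?c has_derivative (\<lambda>t. t *\<^sub>R \<xi> i)) (at 0)"
  proof (rule has_derivative_transform_within_open[OF \<gamma>(4) _ I0])
    show "\<gamma> t = (cmap (TB M) i \<circ> ?c) t" if "t \<in> ?I" for t
      using c(3,4)[OF that] by (simp add: cmap_TB prod_eq_iff)
  qed simp
  then have i: "FD (cmap (TB M) i \<circ> ?c) 0 1 = \<xi> i" using FD_eq by fastforce
  have L: "smooth_atlas (interval_atlas \<epsilon>)" by (rule interval_atlas(1))
  have "(0, \<lambda>_. 1) \<in> points (TB (interval_atlas \<epsilon>))"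
    using interval_unit_tangent[OF \<epsilon>] in_points[of 0 "interval_atlas \<epsilon>" "()"] \<epsilon>
    by (simp add: interval_atlas points_TB)
  from smooth_atlas.tangent_map_in_TB[OF L T.smooth_atlas_axioms sm this]
  have "snd (tangent_map (interval_atlas \<epsilon>) (TB M) ?c (0, \<lambda>_. 1)) \<in> tangent_space (TB M) (h z)"
    unfolding tm(3) by (simp add: points_TB[of "TB M"] c0)
  \<comment> \<open>Both sides are tangent vectors of \<open>TB M\<close> at \<open>h z\<close>, so
    agreement in chart \<open>i\<close> is equality.\<close>
  then have "snd (tangent_map (interval_atlas \<epsilon>) (TB M) ?c (0, \<lambda>_. 1)) = \<xi>"
    by (rule T.tangent_eqI[OF _ _ sp(2)])
      (use \<xi> slit_tangent_space[OF hz] sp(2) i in \<open>auto simp: tm(3) c0\<close>)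
  then have "tangent_map (interval_atlas \<epsilon>) (TB M) ?c (0, \<lambda>_. 1) = (h z, \<xi>)"
    by (simp add: tm(3) c0)
  then show ?thesis unfolding tangent_to_subset_def using \<epsilon> sm hor by blast
qed

text \<open>The Liouville field is tangent to the horizontal manifold, which is a cone.\<close>

lemma vertical_derivative_liouville:
  assumes z: "z \<in> points SPB" "fst z \<in> cdom M i" and Y: "vertical_field M N \<pi> Y"
  shows "FD (vertical_derivative i Y) (cmap M i (fst z), snd (h z) i) (0, snd (h z) i) = 0"
proof -
  let ?V = "vertical_derivative i Y" and ?q = "cmap M i (fst z)" and ?u = "snd (h z) i"
  have fz: "fst (h z) = fst z" using splitting_h(2) z(1) by (simp add: points_SPB)
  note sp = slit_pointD[OF h_slit[OF z(1)], unfolded fz, OF z(2)]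
  have dV: "(?V has_derivative FD ?V (?q, ?u)) (at (?q, ?u))"
    using FD_works[OF differentiable_vertical_derivative[OF _ sp(4)]] Y by (simp add: vertical_field_def)
  have "((\<lambda>t. (?q, t *\<^sub>R ?u)) has_derivative (\<lambda>t. (0, t *\<^sub>R ?u))) (at 1)"
    by (auto intro!: derivative_eq_intros)
  from diff_chain_at[OF this, of ?V "FD ?V (?q, ?u)"] dV
  have d: "((\<lambda>t. ?V (?q, t *\<^sub>R ?u)) has_derivative (\<lambda>t. FD ?V (?q, ?u) (0, t *\<^sub>R ?u))) (at 1)"
    by (simp add: o_def)
  \<comment> \<open>Homogeneity of the fibre derivative makes \<open>?V\<close> vanish on the whole
    positive ray; the derivative is taken at \<open>t = 1\<close>.\<close>
  have "((\<lambda>t. 0) has_derivative (\<lambda>t. FD ?V (?q, ?u) (0, t *\<^sub>R ?u))) (at (1::real))"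
  proof (rule has_derivative_transform_within_open[OF d])
    show "open {0::real<..}" "1 \<in> {0::real<..}" by auto
    show "?V (?q, t *\<^sub>R ?u) = 0" if "t \<in> {0<..}" for t
      using vertical_derivative_h[OF z Y] FD_LE_scaleR[OF _ sp(3)] z(2) that
      by (simp add: vertical_derivative_def)
  qed
  from fun_cong[OF has_derivative_unique[OF has_derivative_const this], of 1] show ?thesis by simp
qed

text \<open>Formulated for an arbitrary field on the slit bundle, so that it serves the canonical
  spray as well as the other sprays of its projective class.\<close>

lemma tangent_iff:
  assumes z: "z \<in> points SPB" and S: "vector_field (slit_TB M) S"
  shows "S (h z) \<in> tangent_to_subset (TB M) (horizontal_manifold M N \<pi> h) \<longleftrightarrow>
    (\<forall>Y. vertical_field M N \<pi> Y \<longrightarrow> tderiv (slit_TB M) (S (h z))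
      (\<lambda>u. tderiv (slit_TB M) (vertical_lift M Y u) (energy F)) = 0)"
proof -
  have hz: "h z \<in> points (slit_TB M)" by (rule h_slit[OF z])
  have "S (h z) \<in> points (TB (slit_TB M))" "fst (S (h z)) = h z"
    using S hz unfolding vector_field_def smooth_map_def by auto
  then obtain \<xi> where \<xi>: "\<xi> \<in> tangent_space (slit_TB M) (h z)" and Sh: "S (h z) = (h z, \<xi>)"
    by (metis (mono_tags, lifting) mem_Collect_eq points_TB prod.collapse)
  have fz: "fst (h z) = fst z" using splitting_h(2) z by (simp add: points_SPB)
  have *: "tderiv (slit_TB M) (h z, \<xi>) (\<lambda>u. tderiv (slit_TB M) (vertical_lift M Y u) (energy F)) =
      FD (vertical_derivative i Y) (cmap M i (fst z), snd (h z) i) (\<xi> i)"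
    if "vertical_field M N \<pi> Y" "fst z \<in> cdom M i" for i Y
    using tderiv_tderiv_vertical_lift[OF _ hz _ \<xi>, of Y i] that fz by (simp add: vertical_field_def)
  have "fst z \<in> points M" using z by (simp add: points_SPB points_PB)
  then obtain i where i: "fst z \<in> cdom M i" by (auto simp: points_def)
  show ?thesis
    unfolding Sh
  proof (intro iffI allI impI)
    fix Y assume "(h z, \<xi>) \<in> tangent_to_subset (TB M) (horizontal_manifold M N \<pi> h)" "vertical_field M N \<pi> Y"
    then show "tderiv (slit_TB M) (h z, \<xi>) (\<lambda>u. tderiv (slit_TB M) (vertical_lift M Y u) (energy F)) = 0"
      using tangent_imp_vertical_derivative[OF z i] *[OF _ i] by metis
  next
    assume van: "\<forall>Y. vertical_field M N \<pi> Y \<longrightarrow>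
      tderiv (slit_TB M) (h z, \<xi>) (\<lambda>u. tderiv (slit_TB M) (vertical_lift M Y u) (energy F)) = 0"
    show "(h z, \<xi>) \<in> tangent_to_subset (TB M) (horizontal_manifold M N \<pi> h)"
      by (rule vertical_derivative_imp_tangent[OF z \<xi>]) (metis van *)
  qed
qed

lemma tangent_canonical_iff:
  assumes S: "canonical_spray M F S"
  shows "tangent_to_horizontal M N \<pi> h S \<longleftrightarrow>
    (\<forall>Y. vertical_field M N \<pi> Y \<longrightarrow> (\<forall>z\<in>points SPB.
      tderiv (slit_TB M) (complete_lift M Y (h z)) (energy F) = 0))"
proof -
  have vf: "vector_field (slit_TB M) S" using S by (simp add: canonical_spray_def spray_def)
  have "tderiv (slit_TB M) (S (h z)) (\<lambda>u. tderiv (slit_TB M) (vertical_lift M Y u) (energy F)) =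
      tderiv (slit_TB M) (complete_lift M Y (h z)) (energy F)"
    if "vertical_field M N \<pi> Y" "z \<in> points SPB" for Y z
    using S h_slit[OF that(2)] that(1) by (simp add: canonical_spray_def vertical_field_def)
  then show ?thesis
    unfolding tangent_to_horizontal_def using tangent_iff[OF _ vf] by auto
qed

text \<open>At a fixed point of \<open>Im h\<close> the map
  \<open>\<xi> \<mapsto> \<xi>(Y\<^sup>V(E))\<close> is linear; it vanishes on \<open>S\<close> and
  on the Liouville field, hence on their combination \<open>S'\<close>.\<close>

lemma tangent_projectively_related:
  assumes S: "vector_field (slit_TB M) S" and tan: "tangent_to_horizontal M N \<pi> h S"
    and S': "projectively_related M S' S"
  shows "tangent_to_horizontal M N \<pi> h S'"
  unfolding tangent_to_horizontal_def
proof
  fix z assume z: "z \<in> points SPB"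
  have hz: "h z \<in> points (slit_TB M)" by (rule h_slit[OF z])
  have fz: "fst (h z) = fst z" using splitting_h(2) z by (simp add: points_SPB)
  have vf': "vector_field (slit_TB M) S'" using S' by (simp add: projectively_related_def spray_def)
  have mem: "snd (S (h z)) \<in> tangent_space (slit_TB M) (h z)" "snd (S' (h z)) \<in> tangent_space (slit_TB M) (h z)"
    "fst (S (h z)) = h z"
    using slit.vector_fieldD S vf' hz by blast+
  \<comment> \<open>\<open>P\<close> is the real value of the projective factor at
    \<open>h z\<close>.\<close>
  obtain P where P: "S' (h z) = (h z, \<lambda>i. snd (S (h z)) i - (2 * P) *\<^sub>R snd (liouville M (h z)) i)"
    using S' hz unfolding projectively_related_def by blast
  have "fst z \<in> points M" using z by (simp add: points_SPB points_PB)
  then obtain i where i: "fst z \<in> cdom M i" by (auto simp: points_def)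
  have "tderiv (slit_TB M) (S' (h z)) (\<lambda>u. tderiv (slit_TB M) (vertical_lift M Y u) (energy F)) = 0"
    if Y: "vertical_field M N \<pi> Y" for Y
  proof -
    let ?V = "vertical_derivative i Y" and ?x = "(cmap M i (fst z), snd (h z) i)"
    have vY: "vector_field M Y" using Y by (simp add: vertical_field_def)
    note t = tderiv_tderiv_vertical_lift[OF vY hz, unfolded fz, OF i]
    have lin: "linear (FD ?V ?x)"
      using linear_frechet_derivative differentiable_vertical_derivative[OF vY]
        slit_pointD(4)[OF hz, unfolded fz, OF i] by blast
    have "FD ?V ?x (snd (S (h z)) i) = 0"
      using tan tangent_iff[OF z S] t[OF mem(1)] mem(3) z Y unfolding tangent_to_horizontal_def
      by (metis prod.collapse)
    then have "FD ?V ?x (snd (S' (h z)) i) = 0"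
      using linear_cmul[OF lin, of "2 * P" "(0, snd (h z) i)"] vertical_derivative_liouville[OF z i Y] i fz
      by (simp add: P liouville_def linear_diff[OF lin])
    then show ?thesis using t[OF mem(2)] P by simp
  qed
  then show "S' (h z) \<in> tangent_to_subset (TB M) (horizontal_manifold M N \<pi> h)"
    using tangent_iff[OF z vf'] by blast
qed

end

theorem proposition1:
  fixes M :: "('a, 'i, 'e::euclidean_space) atlas"
    and N :: "('b, 'j, 'd::real_normed_vector) atlas"
    and Fib :: "('c, 'k, 'f::real_normed_vector) atlas"
    and \<pi> :: "'a \<Rightarrow> 'b"
    and F :: "('a, 'i, 'e) tangent \<Rightarrow> real"
    and S :: "('a, 'i, 'e) tangent \<Rightarrow> (('a, 'i, 'e) tangent, 'i, 'e \<times> 'e) tangent"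
    and h :: "'a \<times> ('b, 'j, 'd) tangent \<Rightarrow> ('a, 'i, 'e) tangent"
  assumes "fibre_bundle M N Fib \<pi>"
    and "finsler M F"
    and "canonical_spray M F S"
    and "induced_splitting M N \<pi> F h"
  shows "(nonlinear_splitting M N \<pi> h \<and> homogeneous_splitting M N \<pi> h) \<and>
     (tangent_to_horizontal M N \<pi> h S \<longleftrightarrow>
        (\<forall>Y. vertical_field M N \<pi> Y \<longrightarrow> (\<forall>z\<in>points (slit_pullback_TB M N \<pi>).
           tderiv (slit_TB M) (complete_lift M Y (h z)) (energy F) = 0))) \<and>
     (tangent_to_horizontal M N \<pi> h S \<longrightarrow>
        (\<forall>S'. projectively_related M S' S \<longrightarrow> tangent_to_horizontal M N \<pi> h S'))"
proof -
  interpret finsler_bundle M N Fib \<pi> F h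
    using assms by (intro finsler_bundle.intro)
  have "vector_field (slit_TB M) S" using assms(3) by (simp add: canonical_spray_def spray_def)
  then show ?thesis
    using nonlinear_splitting_h homogeneous_splitting_h tangent_canonical_iff[OF assms(3)]
      tangent_projectively_related by blast
qed

end
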